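(* Let $V=\{V(n)\}_{n\in\mathbb{Z}}$ be a bounded real sequence and let $H$ be the Schrödinger operator on $\ell^2(\mathbb{Z})$, $(Hu)_n=u_{n+1}+u_{n-1}+V(n)u_n$, with spectral measure $\mu$. For every $\epsilon>0$ there is a constant $C=C(\epsilon,V)>0$, depending only on $\epsilon$ and $V$, such that the following holds: if $0<\beta<\infty$ and $V$ is $\beta$-almost periodic with constant $\epsilon$, then for every $\gamma\in(0,1)$ with $$\gamma<1-\frac{C}{\beta}$$ the spectral measure $\mu$ is $\gamma$-spectral continuous.
   Context: For $0<\beta<\infty$ and $\epsilon>0$, a real sequence $\{V(n)\}_{n\in\mathbb{Z}}$ is $\beta$-almost periodic with constant $\epsilon$ if there is a sequence of positive integers $q_n\to\infty$ such that for every $n$ $$\max_{1\le j\le q_n,\ k\in\mathbb{Z},\ |k|\le e^{\epsilon\beta q_n}/q_n}|V(j+kq_n)-V(j+(k\pm1)q_n)|\le e^{-\beta q_n}$$ (for both signs). The spectral measure $\mu$ of $H$ is the one associated with the vectors $\delta_0,\delta_1$: $\mu=\mu_{\delta_0}+\mu_{\delta_1}$, where $\mu_{\delta_j}(B)=\langle\delta_j,\chi_B(H)\delta_j\rangle$. For a finite Borel measure $\mu$ on $\mathbb{R}$ let $M(E+i\varepsilon)=\int\frac{d\mu(E')}{E'-(E+i\varepsilon)}$ be its Borel transform. For $0<\gamma<1$, $\mu$ is $\gamma$-spectral continuous if for $\mu$-a.e. $E$, $\liminf_{\varepsilon\downarrow0}\varepsilon^{1-\gamma}|M(E+i\varepsilon)|<\infty$.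 *)

theory Defs
  imports "HOL-Analysis.Analysis"
begin

definition ell2 :: "(int \<Rightarrow> complex) set" where
  "ell2 = {u. (\<lambda>n. (cmod (u n))\<^sup>2) summable_on UNIV}"

definition ell2_inner :: "(int \<Rightarrow> complex) \<Rightarrow> (int \<Rightarrow> complex) \<Rightarrow> complex" where
  "ell2_inner u v = (\<Sum>\<^sub>\<infinity>n. cnj (u n) * v n)"

definition ell2_norm :: "(int \<Rightarrow> complex) \<Rightarrow> real" where
  "ell2_norm u = sqrt (\<Sum>\<^sub>\<infinity>n. (cmod (u n))\<^sup>2)"

definition delta :: "int \<Rightarrow> int \<Rightarrow> complex" where
  "delta j = (\<lambda>n. if n = j then 1 else 0)"

definition schrodinger :: "(int \<Rightarrow> real) \<Rightarrow> (int \<Rightarrow> complex) \<Rightarrow> (int \<Rightarrow> complex)" where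
  "schrodinger V u = (\<lambda>n. u (n + 1) + u (n - 1) + complex_of_real (V n) * u n)"

text \<open>Operators on \<open>\<ell>\<^sup>2(\<int>)\<close> are functions on all sequences, of which only the restriction
  to \<^const>\<open>ell2\<close> matters.\<close>

definition orthogonal_projection :: "((int \<Rightarrow> complex) \<Rightarrow> (int \<Rightarrow> complex)) \<Rightarrow> bool" where
  "orthogonal_projection Q \<longleftrightarrow>
     (\<forall>u\<in>ell2. Q u \<in> ell2) \<and>
     (\<forall>u\<in>ell2. \<forall>v\<in>ell2. \<forall>a b. Q (\<lambda>n. a * u n + b * v n) = (\<lambda>n. a * Q u n + b * Q v n)) \<and>
     (\<forall>u\<in>ell2. Q (Q u) = Q u) \<and>
     (\<forall>u\<in>ell2. \<forall>v\<in>ell2. ell2_inner (Q u) v = ell2_inner u (Q v))"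

text \<open>Countable additivity is in the strong operator topology.\<close>

definition projection_valued_measure ::
    "(real set \<Rightarrow> (int \<Rightarrow> complex) \<Rightarrow> (int \<Rightarrow> complex)) \<Rightarrow> bool" where
  "projection_valued_measure P \<longleftrightarrow>
     (\<forall>B\<in>sets borel. orthogonal_projection (P B)) \<and>
     (\<forall>u\<in>ell2. P UNIV u = u) \<and>
     (\<forall>A\<in>sets borel. \<forall>B\<in>sets borel. \<forall>u\<in>ell2. P (A \<inter> B) u = P A (P B u)) \<and>
     (\<forall>B :: nat \<Rightarrow> real set. range B \<subseteq> sets borel \<longrightarrow> disjoint_family B \<longrightarrow>
        (\<forall>u\<in>ell2. (\<lambda>N. ell2_norm (\<lambda>n. P (\<Union>i. B i) u n - (\<Sum>i<N. P (B i) u n)))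
           \<longlonglongrightarrow> 0))"

text \<open>The measure \<open>\<mu>\<^sub>u(B) = \<langle>u, P(B) u\<rangle>\<close>; the inner product is real and nonnegative
  when \<open>P(B)\<close> is an orthogonal projection.\<close>

definition vector_measure ::
    "(real set \<Rightarrow> (int \<Rightarrow> complex) \<Rightarrow> (int \<Rightarrow> complex)) \<Rightarrow> (int \<Rightarrow> complex) \<Rightarrow> real measure" where
  "vector_measure P u =
     measure_of UNIV (sets borel) (\<lambda>B. ennreal (Re (ell2_inner u (P B u))))"

text \<open>\<open>T = \<integral> x dP(x)\<close> as an everywhere defined operator, that is, \<open>P(B) = \<chi>\<^sub>B(T)\<close>. The second
  moments are finite exactly on the domain of \<open>\<integral> x dP(x)\<close>, and the quadratic form
  determines an everywhere defined operator by polarization. By the spectral theorem every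
  bounded self-adjoint \<open>T\<close> has such a \<open>P\<close>, unique on Borel sets and \<^const>\<open>ell2\<close>.\<close>

definition spectral_resolution ::
    "((int \<Rightarrow> complex) \<Rightarrow> (int \<Rightarrow> complex)) \<Rightarrow>
     (real set \<Rightarrow> (int \<Rightarrow> complex) \<Rightarrow> (int \<Rightarrow> complex)) \<Rightarrow> bool" where
  "spectral_resolution T P \<longleftrightarrow>
     projection_valued_measure P \<and>
     (\<forall>u\<in>ell2. integrable (vector_measure P u) (\<lambda>x. x\<^sup>2) \<and>
        ell2_inner u (T u) = complex_of_real (\<integral>x. x \<partial>vector_measure P u))"

definition spectral_measure ::
    "(real set \<Rightarrow> (int \<Rightarrow> complex) \<Rightarrow> (int \<Rightarrow> complex)) \<Rightarrow> real measure" where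
  "spectral_measure P =
     measure_of UNIV (sets borel)
       (\<lambda>B. emeasure (vector_measure P (delta 0)) B + emeasure (vector_measure P (delta 1)) B)"

definition borel_transform :: "real measure \<Rightarrow> complex \<Rightarrow> complex" where
  "borel_transform \<mu> z = (\<integral>x. 1 / (complex_of_real x - z) \<partial>\<mu>)"

definition spectral_continuous :: "real \<Rightarrow> real measure \<Rightarrow> bool" where
  "spectral_continuous \<gamma> \<mu> \<longleftrightarrow>
     (AE E in \<mu>.
        Liminf (at_right 0)
          (\<lambda>e::real. ereal (e powr (1 - \<gamma>) * cmod (borel_transform \<mu> (Complex E e)))) < \<infinity>)"

definition almost_periodic :: "real \<Rightarrow> real \<Rightarrow> (int \<Rightarrow> real) \<Rightarrow> bool" where
  "almost_periodic \<beta> \<epsilon> V \<longleftrightarrow>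
     (\<exists>q :: nat \<Rightarrow> nat.
        (\<forall>n. 0 < q n) \<and> filterlim q at_top sequentially \<and>
        (\<forall>n. \<forall>j\<in>{1..int (q n)}. \<forall>k :: int.
           real_of_int \<bar>k\<bar> \<le> exp (\<epsilon> * \<beta> * real (q n)) / real (q n) \<longrightarrow>
             \<bar>V (j + k * int (q n)) - V (j + (k + 1) * int (q n))\<bar> \<le> exp (- \<beta> * real (q n)) \<and>
             \<bar>V (j + k * int (q n)) - V (j + (k - 1) * int (q n))\<bar> \<le> exp (- \<beta> * real (q n))))"

end

theory Submission
  imports Defs "HOL-Computational_Algebra.Fundamental_Theorem_Algebra" "HOL-Real_Asymp.Real_Asymp"
begin

text \<open>
  The proof compares the resolvent of \<open>H\<close> with solutions for periodic potentials. Let \<open>F\<close> be the Borel transform of the spectral measure of \<open>\<delta>\<^sub>j\<close> at \<open>z = E + \<i> \<eta>\<close> and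
  \<open>\<phi> = (H - z)\<inverse> \<delta>\<^sub>j\<close>. Then \<open>\<phi>(j) = F\<close>, and the squared norm of \<open>\<phi>\<close> is \<open>Im F / \<eta> \<le> \<bar>F\<bar> / \<eta>\<close>
  (\<open>approximate_resolvent_vector\<close>, up to arbitrarily small errors). So \<open>\<phi> / F\<close> has value \<open>1\<close> at \<open>j\<close> and
  squared norm at most \<open>1 / (\<eta> \<bar>F\<bar>)\<close>, and it solves the eigenvalue equation except for a source of
  strength \<open>1 / \<bar>F\<bar>\<close> at \<open>j\<close>. A large \<open>\<bar>F\<bar>\<close> thus means an almost exact solution with little mass.

  Near-periodicity forbids this. For a \<open>q\<close>-periodic potential with transfer matrix \<open>S\<close> over one
  period, exact solutions satisfy \<open>w(j + k q) + w(j - k q) = tr(S\<^sup>k) w(j)\<close>, and one of \<open>tr(S\<^sup>k)\<close>,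
  \<open>tr(S\<^sup>2\<^sup>k)\<close> has modulus at least \<open>1\<close>. A two-sided solution therefore has mass proportional to the
  number of periods, in bands and in gaps alike. The source at \<open>j\<close> perturbs this by the norm of \<open>S\<^sup>k\<close>
  divided by \<open>\<bar>F\<bar>\<close>, so the conclusion persists once \<open>\<bar>F\<bar>\<close> exceeds the ratio of the norm of \<open>S\<^sup>k\<close> to
  its trace. With about \<open>1 / \<eta>\<close> periods in the window, \<open>\<bar>F\<bar>\<close> is at most of the order of this ratio
  (\<open>window_mass_lower_bound\<close>, \<open>borel_transform_bound_from_window\<close>). Since \<open>V\<close> agrees with a \<open>q\<close>-periodic
  potential up to \<open>exp (- \<beta> q)\<close> over \<open>exp (\<epsilon> \<beta> q)\<close> sites, this applies at the height
  \<open>\<eta> = exp (- c \<beta> q)\<close> with \<open>c\<close> depending only on \<open>\<epsilon>\<close>.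

  The ratio is at most \<open>exp (K q)\<close>, with \<open>K\<close> depending only on a bound for \<open>V\<close>, as long as the trace
  \<open>t\<close> of \<open>S\<close> is not too close to a band edge, that is, \<open>\<bar>t\<^sup>2 - 4\<bar> > \<delta> = exp (- (4 l + 4) q)\<close>; this follows
  from \<open>cheb_pell\<close>. There \<open>\<eta>\<^sup>1\<^sup>-\<^sup>\<gamma> \<bar>F\<bar>\<close> is bounded as soon as \<open>(1 - \<gamma>) c \<beta> \<ge> K\<close>, which the condition
  \<open>\<gamma> < 1 - C / \<beta>\<close> ensures for \<open>C = K / c\<close>.

  The energies near a band edge have to be discarded. As a function of the energy, \<open>t\<close> is a monic
  polynomial of degree \<open>q\<close> with real roots (\<open>discriminant_factorization\<close>). Such a polynomial is strictly
  logarithmically concave between its roots, so \<open>\<bar>t\<^sup>2 - 4\<bar> \<le> \<delta>\<close> confines the energy to at most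
  \<open>2 (q + 1)\<close> sets of diameter \<open>O(sqrt \<delta>)\<close> (\<open>near_edge_class_diameter\<close>). At the larger height
  \<open>\<rho> = 7 sqrt \<delta>\<close> the argument above still works near the edges with fewer periods, because parabolic
  transfer matrices grow only linearly (\<open>cheb_u_parabolic_bound\<close>). It gives \<open>\<bar>F\<bar> \<le> exp (l q) O(\<rho>\<^sup>-\<^sup>1\<^sup>/\<^sup>2)\<close>, so the
  spectral mass of these intervals is \<open>O(q exp (l q) \<rho>\<^sup>1\<^sup>/\<^sup>2)\<close> and tends to \<open>0\<close>. Almost every energy is
  therefore outside the exceptional set at infinitely many scales.
\<close>

section \<open>Square summable sequences and the Schroedinger operator\<close>

lemma ell2_norm_power2: "(ell2_norm u)\<^sup>2 = (\<Sum>\<^sub>\<infinity>n. (cmod (u n))\<^sup>2)"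
  unfolding ell2_norm_def by (simp add: infsum_nonneg)

lemma ell2_norm_nonneg [simp]: "ell2_norm u \<ge> 0"
  unfolding ell2_norm_def by (simp add: infsum_nonneg)

lemma ell2_finite_sum_le: "u \<in> ell2 \<Longrightarrow> finite F \<Longrightarrow> (\<Sum>n\<in>F. (cmod (u n))\<^sup>2) \<le> (ell2_norm u)\<^sup>2"
  unfolding ell2_norm_power2 ell2_def by (intro finite_sum_le_infsum) auto

lemma ell2_norm_eq_0D: "u \<in> ell2 \<Longrightarrow> ell2_norm u = 0 \<Longrightarrow> u n = 0"
  using ell2_finite_sum_le[of u "{n}"] by simp

lemma ell2_finite_cauchy_schwarz:
  assumes "u \<in> ell2" "v \<in> ell2" "finite F"
  shows "(\<Sum>n\<in>F. cmod (cnj (u n) * v n)) \<le> ell2_norm u * ell2_norm v"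
proof -
  have "(\<Sum>n\<in>F. cmod (cnj (u n) * v n)) = (\<Sum>n\<in>F. \<bar>cmod (u n)\<bar> * \<bar>cmod (v n)\<bar>)"
    by (simp add: norm_mult)
  also have "\<dots> \<le> L2_set (\<lambda>n. cmod (u n)) F * L2_set (\<lambda>n. cmod (v n)) F"
    by (rule L2_set_mult_ineq)
  also have "\<dots> \<le> ell2_norm u * ell2_norm v"
    unfolding L2_set_def
    by (intro mult_mono real_le_lsqrt ell2_finite_sum_le assms real_sqrt_ge_zero sum_nonneg) auto
  finally show ?thesis .
qed

lemma ell2_prod_abs_summable:
  assumes "u \<in> ell2" "v \<in> ell2" shows "(\<lambda>n. cmod (cnj (u n) * v n)) summable_on UNIV"
  by (rule nonneg_bdd_above_summable_on)
     (auto intro!: bdd_aboveI2[where M = "ell2_norm u * ell2_norm v"] ell2_finite_cauchy_schwarz[OF assms])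

lemma ell2_prod_summable:
  assumes "u \<in> ell2" "v \<in> ell2" shows "(\<lambda>n. cnj (u n) * v n) summable_on UNIV"
  by (rule abs_summable_summable[OF ell2_prod_abs_summable[OF assms]])

lemma ell2_cauchy_schwarz:
  assumes "u \<in> ell2" "v \<in> ell2" shows "cmod (ell2_inner u v) \<le> ell2_norm u * ell2_norm v"
proof -
  have "cmod (ell2_inner u v) \<le> (\<Sum>\<^sub>\<infinity>n. cmod (cnj (u n) * v n))"
    unfolding ell2_inner_def by (rule norm_infsum_bound[OF ell2_prod_abs_summable[OF assms]])
  also have "\<dots> \<le> ell2_norm u * ell2_norm v"
    by (rule infsum_le_finite_sums[OF ell2_prod_abs_summable[OF assms] ell2_finite_cauchy_schwarz[OF assms]])
  finally show ?thesis .
qed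

lemma ell2_lincomb [intro]:
  assumes "u \<in> ell2" "v \<in> ell2" shows "(\<lambda>n. a * u n + b * v n) \<in> ell2"
proof -
  have "(\<lambda>n. 2 * (cmod a)\<^sup>2 * (cmod (u n))\<^sup>2 + 2 * (cmod b)\<^sup>2 * (cmod (v n))\<^sup>2) summable_on UNIV"
    using assms unfolding ell2_def by (intro summable_on_add summable_on_cmult_right) auto
  then have "(\<lambda>n. (cmod (a * u n + b * v n))\<^sup>2) summable_on UNIV"
  proof (rule summable_on_comparison_test)
    fix n
    have "(cmod (a * u n + b * v n))\<^sup>2 \<le> (cmod (a * u n) + cmod (b * v n))\<^sup>2"
      by (intro power_mono norm_triangle_ineq) auto
    also have "\<dots> \<le> 2 * (cmod (a * u n))\<^sup>2 + 2 * (cmod (b * v n))\<^sup>2"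
      using sum_squares_bound[of "cmod (a * u n)" "cmod (b * v n)"] by (simp add: power2_sum)
    finally show "(cmod (a * u n + b * v n))\<^sup>2 \<le> 2 * (cmod a)\<^sup>2 * (cmod (u n))\<^sup>2 + 2 * (cmod b)\<^sup>2 * (cmod (v n))\<^sup>2"
      by (simp add: norm_mult power_mult_distrib)
  qed auto
  then show ?thesis by (simp add: ell2_def)
qed

lemma ell2_inner_lincomb_right:
  assumes "u \<in> ell2" "v \<in> ell2" "w \<in> ell2"
  shows "ell2_inner u (\<lambda>n. a * v n + b * w n) = a * ell2_inner u v + b * ell2_inner u w"
proof -
  have "ell2_inner u (\<lambda>n. a * v n + b * w n) = (\<Sum>\<^sub>\<infinity>n. a * (cnj (u n) * v n) + b * (cnj (u n) * w n))"
    unfolding ell2_inner_def by (simp add: algebra_simps)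
  also have "\<dots> = (\<Sum>\<^sub>\<infinity>n. a * (cnj (u n) * v n)) + (\<Sum>\<^sub>\<infinity>n. b * (cnj (u n) * w n))"
    by (intro infsum_add summable_on_cmult_right ell2_prod_summable assms)
  finally show ?thesis unfolding ell2_inner_def by (simp add: infsum_cmult_right')
qed

lemma ell2_inner_commute: "ell2_inner v u = cnj (ell2_inner u v)"
  unfolding ell2_inner_def infsum_cnj[symmetric] by (simp add: mult.commute)

lemma ell2_inner_lincomb_left:
  assumes "u \<in> ell2" "v \<in> ell2" "w \<in> ell2"
  shows "ell2_inner (\<lambda>n. a * v n + b * w n) u = cnj a * ell2_inner v u + cnj b * ell2_inner w u"
  by (subst (1 2 3) ell2_inner_commute) (simp add: ell2_inner_lincomb_right assms)

lemma ell2_inner_self: "ell2_inner u u = of_real ((ell2_norm u)\<^sup>2)"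
proof -
  have "ell2_inner u u = (\<Sum>\<^sub>\<infinity>n. of_real ((cmod (u n))\<^sup>2))"
    unfolding ell2_inner_def by (intro infsum_cong) (metis complex_norm_square mult.commute)
  also have "\<dots> = of_real ((ell2_norm u)\<^sup>2)"
    unfolding ell2_norm_power2
    by (rule infsum_bounded_linear_strong[OF _ bounded_linear_of_real])
       (metis summable_on_of_real Re_complex_of_real summable_on_Re summable_on_cong)
  finally show ?thesis .
qed

lemma ell2_zero [simp]: "(\<lambda>n. 0) \<in> ell2" by (simp add: ell2_def)

lemma ell2_inner_zero [simp]: "ell2_inner u (\<lambda>n. 0) = 0" by (simp add: ell2_inner_def)

lemma ell2_sum [intro]:
  assumes "finite K" "\<And>k. k \<in> K \<Longrightarrow> f k \<in> ell2" shows "(\<lambda>n. \<Sum>k\<in>K. c k * f k n) \<in> ell2"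
  using assms
proof (induction K rule: finite_induct)
  case (insert k K)
  then show ?case using ell2_lincomb[of "f k" "\<lambda>n. \<Sum>k\<in>K. c k * f k n" "c k" 1] by simp
qed simp

lemma ell2_inner_sum_right:
  assumes "finite K" "\<And>k. k \<in> K \<Longrightarrow> f k \<in> ell2" "u \<in> ell2"
  shows "ell2_inner u (\<lambda>n. \<Sum>k\<in>K. c k * f k n) = (\<Sum>k\<in>K. c k * ell2_inner u (f k))"
  using assms
proof (induction K rule: finite_induct)
  case (insert k K)
  then show ?case
    using ell2_inner_lincomb_right[of u "f k" "\<lambda>n. \<Sum>k\<in>K. c k * f k n" "c k" 1] ell2_sum[of K f c] by simp
qed simp

lemma delta_ell2 [simp]: "delta j \<in> ell2"
proof -
  have "(\<lambda>n. (cmod (delta j n))\<^sup>2) summable_on {j}" by simp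
  then have "(\<lambda>n. (cmod (delta j n))\<^sup>2) summable_on UNIV"
    by (subst summable_on_cong_neutral[where T = "{j}" and g = "\<lambda>n. (cmod (delta j n))\<^sup>2"]) (auto simp: delta_def)
  then show ?thesis by (simp add: ell2_def)
qed

lemma ell2_inner_delta: "ell2_inner (delta j) v = v j"
proof -
  have "ell2_inner (delta j) v = (\<Sum>\<^sub>\<infinity>n\<in>{j}. cnj (delta j n) * v n)"
    unfolding ell2_inner_def by (rule infsum_cong_neutral) (auto simp: delta_def)
  then show ?thesis by (simp add: delta_def)
qed

lemma ell2_norm_delta [simp]: "ell2_norm (delta j) = 1"
proof -
  have "complex_of_real ((ell2_norm (delta j))\<^sup>2) = 1"
    unfolding ell2_inner_self[symmetric] ell2_inner_delta by (simp add: delta_def)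
  then have "(ell2_norm (delta j))\<^sup>2 = 1" using of_real_eq_1_iff by blast
  then show ?thesis by (simp add: power2_eq_1_iff) (use ell2_norm_nonneg[of "delta j"] in linarith)
qed

lemma ell2_shift:
  assumes "u \<in> ell2" shows "(\<lambda>n. u (n + k)) \<in> ell2" "ell2_norm (\<lambda>n. u (n + k)) = ell2_norm u"
proof -
  have b: "bij_betw (\<lambda>n::int. n + k) UNIV UNIV" by (rule bij_betwI[where g = "\<lambda>n. n - k"]) auto
  show "(\<lambda>n. u (n + k)) \<in> ell2"
    using assms summable_on_reindex_bij_betw[OF b, of "\<lambda>n. (cmod (u n))\<^sup>2"] by (simp add: ell2_def)
  show "ell2_norm (\<lambda>n. u (n + k)) = ell2_norm u"
    unfolding ell2_norm_def using infsum_reindex_bij_betw[OF b, of "\<lambda>n. (cmod (u n))\<^sup>2"] by simp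
qed

lemma ell2_bounded_mult:
  assumes u: "u \<in> ell2" and b: "\<And>n. cmod (b n) \<le> B"
  shows "(\<lambda>n. b n * u n) \<in> ell2" "ell2_norm (\<lambda>n. b n * u n) \<le> B * ell2_norm u"
proof -
  have B0: "B \<ge> 0" using b[of 0] norm_ge_zero order_trans by blast
  have s: "(\<lambda>n. B\<^sup>2 * (cmod (u n))\<^sup>2) summable_on UNIV"
    using u unfolding ell2_def by (intro summable_on_cmult_right) auto
  have le: "(cmod (b n * u n))\<^sup>2 \<le> B\<^sup>2 * (cmod (u n))\<^sup>2" for n
    using b[of n] by (simp add: norm_mult power_mult_distrib mult_right_mono power_mono)
  have s': "(\<lambda>n. (cmod (b n * u n))\<^sup>2) summable_on UNIV"
    by (rule summable_on_comparison_test[OF s]) (use le in auto)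
  then show "(\<lambda>n. b n * u n) \<in> ell2" by (simp add: ell2_def)
  have "(ell2_norm (\<lambda>n. b n * u n))\<^sup>2 \<le> (\<Sum>\<^sub>\<infinity>n. B\<^sup>2 * (cmod (u n))\<^sup>2)"
    unfolding ell2_norm_power2 by (rule infsum_mono[OF s' s]) (use le in auto)
  also have "\<dots> = (B * ell2_norm u)\<^sup>2"
    by (simp add: infsum_cmult_right' ell2_norm_power2 power_mult_distrib)
  finally show "ell2_norm (\<lambda>n. b n * u n) \<le> B * ell2_norm u"
    by (rule power2_le_imp_le) (use B0 in simp)
qed

lemma schrodinger_lincomb:
  "schrodinger V (\<lambda>n. a * u n + b * v n) = (\<lambda>n. a * schrodinger V u n + b * schrodinger V v n)"
  unfolding schrodinger_def by (rule ext) (simp add: algebra_simps)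

lemma schrodinger_ell2:
  assumes V: "\<And>n. \<bar>V n\<bar> \<le> v" and u: "u \<in> ell2"
  shows "schrodinger V u \<in> ell2" and "cmod (ell2_inner u (schrodinger V u)) \<le> (2 + v) * (ell2_norm u)\<^sup>2"
proof -
  have V': "cmod (complex_of_real (V n)) \<le> v" for n using V[of n] by simp
  note m = ell2_bounded_mult[OF u, of "\<lambda>n. complex_of_real (V n)", OF V']
  have p: "(\<lambda>n. u (n + 1)) \<in> ell2" "(\<lambda>n. u (n - 1)) \<in> ell2"
    "ell2_norm (\<lambda>n. u (n + 1)) = ell2_norm u" "ell2_norm (\<lambda>n. u (n - 1)) = ell2_norm u"
    using ell2_shift[OF u, of 1] ell2_shift[OF u, of "-1"] by simp_all
  have pq: "(\<lambda>n. u (n + 1) + u (n - 1)) \<in> ell2"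
    using ell2_lincomb[OF p(1,2), of 1 1] by simp
  show "schrodinger V u \<in> ell2"
    unfolding schrodinger_def using ell2_lincomb[OF pq m(1), of 1 1] by simp
  have "ell2_inner u (schrodinger V u) = ell2_inner u (\<lambda>n. u (n + 1)) + ell2_inner u (\<lambda>n. u (n - 1)) + ell2_inner u (\<lambda>n. of_real (V n) * u n)"
    using ell2_inner_lincomb_right[OF u p(1,2), of 1 1] ell2_inner_lincomb_right[OF u pq m(1), of 1 1]
    by (simp add: schrodinger_def)
  then have "cmod (ell2_inner u (schrodinger V u)) \<le> cmod (ell2_inner u (\<lambda>n. u (n + 1))) + cmod (ell2_inner u (\<lambda>n. u (n - 1))) + cmod (ell2_inner u (\<lambda>n. of_real (V n) * u n))"
    by (simp only:) (rule order_trans[OF norm_triangle_ineq add_right_mono[OF norm_triangle_ineq]])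
  also have "\<dots> \<le> ell2_norm u * ell2_norm u + ell2_norm u * ell2_norm u + ell2_norm u * (v * ell2_norm u)"
    using ell2_cauchy_schwarz[OF u p(1)] ell2_cauchy_schwarz[OF u p(2)] ell2_cauchy_schwarz[OF u m(1)]
      mult_left_mono[OF m(2), of "ell2_norm u"] p(3,4) by simp
  also have "\<dots> = (2 + v) * (ell2_norm u)\<^sup>2" by (simp add: power2_eq_square algebra_simps)
  finally show "cmod (ell2_inner u (schrodinger V u)) \<le> (2 + v) * (ell2_norm u)\<^sup>2" .
qed

section \<open>Projection-valued measures\<close>

lemma pvm_orthogonal_projection:
  "projection_valued_measure P \<Longrightarrow> A \<in> sets borel \<Longrightarrow> orthogonal_projection (P A)"
  by (simp add: projection_valued_measure_def)

lemma pvm_ell2: "projection_valued_measure P \<Longrightarrow> A \<in> sets borel \<Longrightarrow> u \<in> ell2 \<Longrightarrow> P A u \<in> ell2"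
  by (drule (1) pvm_orthogonal_projection) (simp add: orthogonal_projection_def)

lemma pvm_lincomb: "projection_valued_measure P \<Longrightarrow> A \<in> sets borel \<Longrightarrow> u \<in> ell2 \<Longrightarrow> v \<in> ell2 \<Longrightarrow>
    P A (\<lambda>n. a * u n + b * v n) = (\<lambda>n. a * P A u n + b * P A v n)"
  by (drule (1) pvm_orthogonal_projection) (simp add: orthogonal_projection_def)

lemma pvm_UNIV: "projection_valued_measure P \<Longrightarrow> u \<in> ell2 \<Longrightarrow> P UNIV u = u"
  by (simp add: projection_valued_measure_def)

lemma pvm_Int: "projection_valued_measure P \<Longrightarrow> A \<in> sets borel \<Longrightarrow> B \<in> sets borel \<Longrightarrow> u \<in> ell2 \<Longrightarrow>
    P A (P B u) = P (A \<inter> B) u"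
  by (simp add: projection_valued_measure_def)

lemma pvm_inner:
  assumes P: "projection_valued_measure P" "A \<in> sets borel" "B \<in> sets borel" "u \<in> ell2" "v \<in> ell2"
  shows "ell2_inner (P A u) (P B v) = ell2_inner u (P (A \<inter> B) v)"
proof -
  have "ell2_inner (P A u) (P B v) = ell2_inner u (P A (P B v))"
    using pvm_orthogonal_projection[OF P(1,2)] P(4) pvm_ell2[OF P(1,3,5)]
    by (simp add: orthogonal_projection_def)
  then show ?thesis using pvm_Int[OF P(1,2,3,5)] by simp
qed

lemma pvm_form:
  assumes P: "projection_valued_measure P" "A \<in> sets borel" "u \<in> ell2"
  shows "ell2_inner u (P A u) = of_real ((ell2_norm (P A u))\<^sup>2)"
  using pvm_inner[OF P(1,2,2,3,3)] ell2_inner_self[of "P A u"] by simp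

lemma pvm_countably_additive:
  assumes "projection_valued_measure P" "range B \<subseteq> sets borel" "disjoint_family B" "u \<in> ell2"
  shows "(\<lambda>N. ell2_norm (\<lambda>n. P (\<Union>i. B i) u n - (\<Sum>i<N. P (B i) u n))) \<longlonglongrightarrow> 0"
  using assms by (simp add: projection_valued_measure_def)

lemma ell2_norm_scale: "ell2_norm (\<lambda>n. a * u n) = cmod a * ell2_norm u"
  unfolding ell2_norm_def by (simp add: norm_mult power_mult_distrib infsum_cmult_right' real_sqrt_mult)

lemma pvm_empty:
  assumes P: "projection_valued_measure P" "u \<in> ell2" shows "P {} u = (\<lambda>n. 0)"
proof -
  have "(\<lambda>N. ell2_norm (\<lambda>n. P {} u n - (\<Sum>i<N. P {} u n))) \<longlonglongrightarrow> 0"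
    using pvm_countably_additive[OF P(1) _ _ P(2), of "\<lambda>_. {}"] by (simp add: disjoint_family_on_def)
  moreover have "ell2_norm (\<lambda>n. P {} u n - (\<Sum>i<N. P {} u n)) = cmod (1 - of_nat N) * ell2_norm (P {} u)" for N
    unfolding ell2_norm_scale[symmetric] by (simp add: left_diff_distrib)
  ultimately have lim: "(\<lambda>N. cmod (1 - of_nat N) * ell2_norm (P {} u)) \<longlonglongrightarrow> 0" by simp
  have "ell2_norm (P {} u) \<le> 0"
  proof (rule LIMSEQ_le_const[OF lim], intro exI allI impI)
    fix N :: nat assume "2 \<le> N"
    then have "cmod (1 - of_nat N) = real N - 1"
      using norm_of_real[of "1 - real N", where 'a = complex] by simp
    then show "ell2_norm (P {} u) \<le> cmod (1 - of_nat N) * ell2_norm (P {} u)"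
      using \<open>2 \<le> N\<close> mult_right_mono[of 1 "real N - 1" "ell2_norm (P {} u)"] by simp
  qed
  then have "ell2_norm (P {} u) = 0" using ell2_norm_nonneg[of "P {} u"] by linarith
  then show ?thesis using ell2_norm_eq_0D[OF pvm_ell2[OF P(1) _ P(2)], of "{}"] by auto
qed

lemma sets_vector_measure [simp, measurable_cong]: "sets (vector_measure P u) = sets borel"
  and space_vector_measure [simp]: "space (vector_measure P u) = UNIV"
  unfolding vector_measure_def
  using sets.sigma_sets_eq[of "borel :: real measure"] by (simp_all add: sets_measure_of_conv space_measure_of_conv)

lemma emeasure_vector_measure:
  assumes P: "projection_valued_measure P" "u \<in> ell2" and A: "A \<in> sets borel"
  shows "emeasure (vector_measure P u) A = ennreal ((ell2_norm (P A u))\<^sup>2)"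
proof -
  define f where "f B = ennreal (Re (ell2_inner u (P B u)))" for B
  have fe: "f B = ennreal ((ell2_norm (P B u))\<^sup>2)" if "B \<in> sets borel" for B
    unfolding f_def using pvm_form[OF P(1) that P(2)] by simp
  have "emeasure (vector_measure P u) A = f A"
  proof (rule emeasure_measure_of[of "vector_measure P u" UNIV "sets borel" f])
    show "vector_measure P u = measure_of UNIV (sets borel) f" by (simp add: vector_measure_def f_def[abs_def])
    show "positive (sets (vector_measure P u)) f"
      using fe[of "{}"] pvm_empty[OF P] by (simp add: positive_def ell2_norm_def)
    show "countably_additive (sets (vector_measure P u)) f"
    proof (rule countably_additiveI)
      fix B :: "nat \<Rightarrow> real set"
      assume B: "range B \<subseteq> sets (vector_measure P u)" "disjoint_family B" "(\<Union>i. B i) \<in> sets (vector_measure P u)"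
      then have Bi: "B i \<in> sets borel" for i by auto
      have Bu: "(\<Union>i. B i) \<in> sets borel" using B by simp
      define y where "y N = (\<lambda>n. P (\<Union>i. B i) u n - (\<Sum>i<N. P (B i) u n))" for N
      have sum2: "(\<lambda>n. \<Sum>i<N. 1 * P (B i) u n) \<in> ell2" for N
        by (intro ell2_sum pvm_ell2[OF P(1) Bi P(2)]) auto
      have y: "y N \<in> ell2" "ell2_inner u (y N) = ell2_inner u (P (\<Union>i. B i) u) - (\<Sum>i<N. ell2_inner u (P (B i) u))" for N
      proof -
        have e: "y N = (\<lambda>n. 1 * P (\<Union>i. B i) u n + (-1) * (\<Sum>i<N. 1 * P (B i) u n))" by (simp add: y_def)
        show "y N \<in> ell2" unfolding e by (intro ell2_lincomb pvm_ell2[OF P(1) Bu P(2)] sum2)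
        show "ell2_inner u (y N) = ell2_inner u (P (\<Union>i. B i) u) - (\<Sum>i<N. ell2_inner u (P (B i) u))"
          unfolding e using ell2_inner_lincomb_right[OF P(2) pvm_ell2[OF P(1) Bu P(2)] sum2, of 1 "-1" N]
            ell2_inner_sum_right[of "{..<N}" "\<lambda>i. P (B i) u" u "\<lambda>_. 1"] pvm_ell2[OF P(1) Bi P(2)] P(2) by simp
      qed
      have "(\<lambda>N. ell2_norm u * ell2_norm (y N)) \<longlonglongrightarrow> ell2_norm u * 0"
        using pvm_countably_additive[OF P(1) _ B(2) P(2)] Bi unfolding y_def by (intro tendsto_mult_left) auto
      then have "(\<lambda>N. ell2_inner u (y N)) \<longlonglongrightarrow> 0"
        using Lim_null_comparison[of "\<lambda>N. ell2_inner u (y N)" "\<lambda>N. ell2_norm u * ell2_norm (y N)" sequentially]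
          ell2_cauchy_schwarz[OF P(2) y(1)] by simp
      then have "(\<lambda>N. ell2_inner u (P (\<Union>i. B i) u) - ell2_inner u (y N)) \<longlonglongrightarrow> ell2_inner u (P (\<Union>i. B i) u) - 0"
        by (intro tendsto_intros)
      then have "(\<lambda>N. (\<Sum>i<N. ell2_inner u (P (B i) u))) \<longlonglongrightarrow> ell2_inner u (P (\<Union>i. B i) u)"
        unfolding y(2) by simp
      then have "(\<lambda>N. Re (\<Sum>i<N. ell2_inner u (P (B i) u))) \<longlonglongrightarrow> Re (ell2_inner u (P (\<Union>i. B i) u))"
        by (rule tendsto_Re)
      then have "(\<lambda>i. Re (ell2_inner u (P (B i) u))) sums Re (ell2_inner u (P (\<Union>i. B i) u))"
        by (simp add: sums_def)
      then show "(\<Sum>i. f (B i)) = f (\<Union> (range B))"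
        unfolding f_def using pvm_form[OF P(1) Bi P(2)]
        by (intro sums_unique[symmetric] sums_ennreal[THEN iffD2]) (auto simp: pvm_form[OF P(1) Bu P(2)])
    qed
  qed (use A in \<open>auto simp: \<close>)
  then show ?thesis using fe[OF A] by simp
qed

lemma finite_measure_vector_measure:
  assumes P: "projection_valued_measure P" "u \<in> ell2"
  shows "finite_measure (vector_measure P u)"
  by (rule finite_measureI) (simp add: emeasure_vector_measure[OF P])

lemma measure_vector_measure:
  assumes P: "projection_valued_measure P" "u \<in> ell2" and A: "A \<in> sets borel"
  shows "measure (vector_measure P u) A = (ell2_norm (P A u))\<^sup>2"
  unfolding measure_def emeasure_vector_measure[OF P A] by simp

section \<open>Riemann sums for functions of the operator\<close>

text \<open>The cells of mesh \<open>h\<close> discretise the spectral axis: functions of the operator are replaced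
  by finite sums of spectral projections onto cells.\<close>

definition cell :: "real \<Rightarrow> int \<Rightarrow> real set" where "cell h k = {x. \<lfloor>x / h\<rfloor> = k}"

text \<open>One index more than necessary at either end keeps every point of \<open>[-R, R]\<close> covered without
  case distinctions about rounding.\<close>

definition cells :: "real \<Rightarrow> real \<Rightarrow> int set" where "cells R h = {- \<lceil>R / h\<rceil> - 1..\<lceil>R / h\<rceil> + 1}"

lemma cell_measurable [measurable, simp]: "cell h k \<in> sets borel"
proof -
  have "{x \<in> space borel. \<lfloor>x / h\<rfloor> = k} \<in> sets borel" by measurable
  then show ?thesis by (simp add: cell_def)
qed

lemma cell_Int: "cell h k \<inter> cell h l = (if k = l then cell h k else {})"
  by (auto simp: cell_def)

lemma finite_cells [simp]: "finite (cells R h)" by (simp add: cells_def)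

lemma cell_index: 
  assumes "h > 0" "\<bar>x\<bar> \<le> R" shows "\<lfloor>x / h\<rfloor> \<in> cells R h"
proof -
  have "x / h \<le> R / h" "- (R / h) \<le> x / h" using assms by (auto simp: field_simps abs_le_iff)
  then have "\<lfloor>x / h\<rfloor> \<le> \<lceil>R / h\<rceil> + 1" "- \<lceil>R / h\<rceil> - 1 \<le> \<lfloor>x / h\<rfloor>" by linarith+
  then show ?thesis by (simp add: cells_def)
qed

lemma cell_dist: "h > 0 \<Longrightarrow> \<bar>x - of_int \<lfloor>x / h\<rfloor> * h\<bar> \<le> h"
proof -
  assume h: "h > 0"
  have "of_int \<lfloor>x / h\<rfloor> * h \<le> x" "x < (of_int \<lfloor>x / h\<rfloor> + 1) * h"
    by (rule floor_divide_lower[OF h], rule floor_divide_upper[OF h])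
  then show ?thesis unfolding distrib_right abs_le_iff using h by linarith
qed

text \<open>The Lipschitz constant controls a Riemann sum uniformly over all finite measures supported in
  \<open>[-R, R]\<close>, whatever their nature; this uniformity is what carries the scalar estimate over to
  spectral measures of arbitrary vectors.\<close>

lemma riemann_sum_bound:
  fixes f :: "real \<Rightarrow> complex"
  assumes M: "finite_measure M" "sets M = sets borel" and supp: "AE x in M. \<bar>x\<bar> \<le> R" and h: "h > 0"
    and lip: "\<And>x y. cmod (f x - f y) \<le> L * \<bar>x - y\<bar>"
  shows "integrable M f"
    and "cmod ((\<integral>x. f x \<partial>M) - (\<Sum>k\<in>cells R h. f (of_int k * h) * of_real (measure M (cell h k)))) \<le> L * h * measure M UNIV"
proof -
  interpret finite_measure M by (rule M)
  have sp: "space M = UNIV" using sets_eq_imp_space_eq[OF M(2)] by simp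
  have L0: "L \<ge> 0" using order_trans[OF norm_ge_zero lip[of 1 0]] by simp
  have "L-lipschitz_on UNIV f" using lip L0 by (auto simp: lipschitz_on_def dist_norm)
  then have "continuous_on UNIV f" by (rule lipschitz_on_continuous_on)
  then have fm: "f \<in> borel_measurable M"
    using borel_measurable_continuous_onI measurable_cong_sets[OF M(2) refl] by blast
  have cm [measurable]: "cell h k \<in> sets M" for k by (simp add: M)
  show intf: "integrable M f"
  proof (rule integrable_const_bound[where B = "cmod (f 0) + L * R", OF _ fm], use supp in \<open>rule AE_mp\<close>, intro AE_I2 impI)
    fix x assume "\<bar>x\<bar> \<le> R"
    then have "cmod (f x - f 0) \<le> L * R" using lip[of x 0] mult_left_mono[of "\<bar>x\<bar>" R L] L0 by simp
    then show "cmod (f x) \<le> cmod (f 0) + L * R" using norm_triangle_sub[of "f x" "f 0"] by linarith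
  qed
  define g where "g x = (\<Sum>k\<in>cells R h. indicator (cell h k) x *\<^sub>R f (of_int k * h))" for x
  have gi: "integrable M (\<lambda>x. indicator (cell h k) x *\<^sub>R f (of_int k * h))" for k
    by (intro integrable_scaleR_left integrable_real_indicator cm) (simp add: less_top[symmetric])
  have intg: "integrable M g" unfolding g_def by (intro Bochner_Integration.integrable_sum gi)
  have Ig: "(\<integral>x. g x \<partial>M) = (\<Sum>k\<in>cells R h. f (of_int k * h) * of_real (measure M (cell h k)))"
    unfolding g_def using gi
    by (subst Bochner_Integration.integral_sum) (auto simp: sp scaleR_conv_of_real mult.commute intro!: sum.cong)
  have pt: "AE x in M. cmod (f x - g x) \<le> L * h"
    using supp
  proof (rule AE_mp, intro AE_I2 impI)
    fix x assume x: "\<bar>x\<bar> \<le> R"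
    have "g x = (\<Sum>k\<in>cells R h. if k = \<lfloor>x / h\<rfloor> then f (of_int k * h) else 0)"
      unfolding g_def by (intro sum.cong) (auto simp: cell_def)
    then have "g x = f (of_int \<lfloor>x / h\<rfloor> * h)" using cell_index[OF h x] by simp
    then have "cmod (f x - g x) \<le> L * \<bar>x - of_int \<lfloor>x / h\<rfloor> * h\<bar>" using lip by simp
    also have "\<dots> \<le> L * h" using cell_dist[OF h] L0 by (intro mult_left_mono) auto
    finally show "cmod (f x - g x) \<le> L * h" .
  qed
  have "cmod ((\<integral>x. f x \<partial>M) - (\<integral>x. g x \<partial>M)) = cmod (\<integral>x. f x - g x \<partial>M)"
    using intf intg by simp
  also have "\<dots> \<le> (\<integral>x. cmod (f x - g x) \<partial>M)" by (rule integral_norm_bound)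
  also have "\<dots> \<le> (\<integral>x. L * h \<partial>M)"
    by (rule integral_mono_AE) (use intf intg pt in auto)
  also have "\<dots> = L * h * measure M UNIV" by (simp add: sp)
  finally show "cmod ((\<integral>x. f x \<partial>M) - (\<Sum>k\<in>cells R h. f (of_int k * h) * of_real (measure M (cell h k)))) \<le> L * h * measure M UNIV"
    unfolding Ig .
qed

lemma resolution_pvm: "spectral_resolution T P \<Longrightarrow> projection_valued_measure P"
  by (simp add: spectral_resolution_def)

lemma resolution_form:
  assumes "spectral_resolution T P" "u \<in> ell2"
  shows "ell2_inner u (T u) = of_real (\<integral>x. x \<partial>vector_measure P u)"
    and "integrable (vector_measure P u) (\<lambda>x. x)"
proof -
  have "integrable (vector_measure P u) (\<lambda>x. x\<^sup>2) \<and> ell2_inner u (T u) = of_real (\<integral>x. x \<partial>vector_measure P u)"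
    using assms unfolding spectral_resolution_def by blast
  then show "ell2_inner u (T u) = of_real (\<integral>x. x \<partial>vector_measure P u)" and i: "integrable (vector_measure P u) (\<lambda>x. x)"
  proof (safe)
    assume i: "integrable (vector_measure P u) (\<lambda>x. x\<^sup>2)"
    interpret finite_measure "vector_measure P u"
      by (rule finite_measure_vector_measure[OF resolution_pvm[OF assms(1)] assms(2)])
    have "integrable (vector_measure P u) (\<lambda>x. 1 + x\<^sup>2)" using i by simp
    moreover have "\<bar>x\<bar> \<le> 1 + x\<^sup>2" for x :: real
    proof -
      have "0 \<le> (\<bar>x\<bar> - 1)\<^sup>2" by simp
      then have "2 * \<bar>x\<bar> \<le> 1 + x\<^sup>2" by (simp add: power2_diff)
      then show ?thesis by simp
    qed
    ultimately show "integrable (vector_measure P u) (\<lambda>x. x)"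
      by (elim Bochner_Integration.integrable_bound) auto
  qed
qed

text \<open>A vector in the range of \<open>P B\<close> would have Rayleigh quotient at least \<open>R\<close> in absolute value,
  while the quadratic form is bounded by \<open>2 + v\<close>.\<close>

lemma resolution_no_mass_outside:
  assumes sr: "spectral_resolution (schrodinger V) P" and V: "\<And>n. \<bar>V n\<bar> \<le> v" and R: "R > 2 + v"
    and w: "w \<in> ell2" and B: "B \<in> sets borel" and s: "s \<in> {-1, 1}" "\<And>x. x \<in> B \<Longrightarrow> s * x \<ge> R"
  shows "emeasure (vector_measure P w) B = 0"
proof -
  note pvm = resolution_pvm[OF sr]
  define w' where "w' = P B w"
  have w': "w' \<in> ell2" unfolding w'_def by (rule pvm_ell2[OF pvm B w])
  interpret finite_measure "vector_measure P w'" by (rule finite_measure_vector_measure[OF pvm w'])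
  have B': "- B \<in> sets borel" using B by simp
  have "emeasure (vector_measure P w') (- B) = 0"
    using emeasure_vector_measure[OF pvm w' B'] pvm_Int[OF pvm B' B w] pvm_empty[OF pvm w]
    by (simp add: w'_def ell2_norm_def)
  then have "AE x in vector_measure P w'. x \<in> B"
    using B' by (intro AE_I'[of "- B"]) (auto simp: null_sets_def)
  then have ae: "AE x in vector_measure P w'. R \<le> s * x" by (rule AE_mp) (use s in auto)
  have "R * (ell2_norm w')\<^sup>2 = (\<integral>x. R \<partial>vector_measure P w')"
    using measure_vector_measure[OF pvm w', of UNIV] pvm_UNIV[OF pvm w'] by simp
  also have "\<dots> \<le> (\<integral>x. s * x \<partial>vector_measure P w')"
    using resolution_form(2)[OF sr w'] by (intro integral_mono_AE ae) auto
  also have "\<dots> = s * (\<integral>x. x \<partial>vector_measure P w')" by simp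
  also have "\<dots> \<le> \<bar>\<integral>x. x \<partial>vector_measure P w'\<bar>" using s(1) by auto
  also have "\<dots> = cmod (ell2_inner w' (schrodinger V w'))" unfolding resolution_form(1)[OF sr w'] by simp
  also have "\<dots> \<le> (2 + v) * (ell2_norm w')\<^sup>2" by (rule schrodinger_ell2(2)[OF V w'])
  finally have "(R - (2 + v)) * (ell2_norm w')\<^sup>2 \<le> 0" by (simp add: left_diff_distrib)
  then have "ell2_norm w' = 0" using R by (simp add: mult_le_0_iff)
  then show ?thesis unfolding emeasure_vector_measure[OF pvm w B] w'_def by simp
qed

lemma resolution_support:
  assumes sr: "spectral_resolution (schrodinger V) P" and V: "\<And>n. \<bar>V n\<bar> \<le> v" and R: "R > 2 + v"
    and w: "w \<in> ell2"
  shows "AE x in vector_measure P w. \<bar>x\<bar> \<le> R"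
proof -
  have "{R<..} \<in> null_sets (vector_measure P w)" "{..<-R} \<in> null_sets (vector_measure P w)"
    using resolution_no_mass_outside[OF sr V R w, of "{R<..}" 1] resolution_no_mass_outside[OF sr V R w, of "{..<-R}" "-1"]
    by (auto simp: null_sets_def)
  then have "{R<..} \<union> {..<-R} \<in> null_sets (vector_measure P w)" by (rule null_sets.Un)
  then show ?thesis by (rule AE_I') auto
qed

text \<open>Only the quadratic form of the operator is known, so an off-diagonal bound has to come from
  polarization over the four unit directions \<open>1, -1, \<i>, -\<i>\<close>; summing the four squared norms
  produces the parallelogram identity and hence the constant \<open>1\<close> here.\<close>

lemma quadratic_form_polarization_bound:
  assumes D: "\<And>u. u \<in> ell2 \<Longrightarrow> D u \<in> ell2"
    "\<And>u v a b. u \<in> ell2 \<Longrightarrow> v \<in> ell2 \<Longrightarrow> D (\<lambda>n. a * u n + b * v n) = (\<lambda>n. a * D u n + b * D v n)"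
    and form: "\<And>w. w \<in> ell2 \<Longrightarrow> cmod (ell2_inner w (D w)) \<le> h * (ell2_norm w)\<^sup>2"
    and a: "a \<in> ell2" and b: "b \<in> ell2"
  shows "cmod (ell2_inner a (D b)) \<le> h * ((ell2_norm a)\<^sup>2 + (ell2_norm b)\<^sup>2)"
proof -
  define w where "w \<zeta> = (\<lambda>n. 1 * a n + \<zeta> * b n)" for \<zeta>
  have w: "w \<zeta> \<in> ell2" for \<zeta> unfolding w_def using a b by blast
  have Dw: "D (w \<zeta>) = (\<lambda>n. 1 * D a n + \<zeta> * D b n)" for \<zeta> unfolding w_def by (rule D(2)[OF a b])
  have Q: "ell2_inner (w \<zeta>) (D (w \<zeta>)) =
     (ell2_inner a (D a) + \<zeta> * ell2_inner a (D b)) + cnj \<zeta> * (ell2_inner b (D a) + \<zeta> * ell2_inner b (D b))" for \<zeta>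
    unfolding Dw unfolding ell2_inner_lincomb_right[OF w D(1)[OF a] D(1)[OF b]] unfolding w_def
      ell2_inner_lincomb_left[OF D(1)[OF a] a b] ell2_inner_lincomb_left[OF D(1)[OF b] a b]
    by (simp add: algebra_simps)
  have N: "complex_of_real ((ell2_norm (w \<zeta>))\<^sup>2) =
     (ell2_inner a a + \<zeta> * ell2_inner a b) + cnj \<zeta> * (ell2_inner b a + \<zeta> * ell2_inner b b)" for \<zeta>
    unfolding ell2_inner_self[symmetric] unfolding w_def
    unfolding ell2_inner_lincomb_right[OF w[unfolded w_def] a b]
      ell2_inner_lincomb_left[OF a a b] ell2_inner_lincomb_left[OF b a b]
    by (simp add: algebra_simps)
  have "complex_of_real ((ell2_norm (w 1))\<^sup>2 + (ell2_norm (w (-1)))\<^sup>2 + (ell2_norm (w \<i>))\<^sup>2 + (ell2_norm (w (-\<i>)))\<^sup>2)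
    = complex_of_real (4 * ((ell2_norm a)\<^sup>2 + (ell2_norm b)\<^sup>2))"
    unfolding of_real_add N by (simp add: ell2_inner_self algebra_simps)
  then have Ns: "(ell2_norm (w 1))\<^sup>2 + (ell2_norm (w (-1)))\<^sup>2 + (ell2_norm (w \<i>))\<^sup>2 + (ell2_norm (w (-\<i>)))\<^sup>2
      = 4 * ((ell2_norm a)\<^sup>2 + (ell2_norm b)\<^sup>2)" using of_real_eq_iff by blast
  define q where "q \<zeta> = ell2_inner (w \<zeta>) (D (w \<zeta>))" for \<zeta>
  have "4 * ell2_inner a (D b) = q 1 - q (-1) - \<i> * q \<i> + \<i> * q (-\<i>)"
    unfolding q_def Q by (simp add: algebra_simps)
  then have "4 * cmod (ell2_inner a (D b)) = cmod (q 1 - q (-1) - \<i> * q \<i> + \<i> * q (-\<i>))"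
    by (metis norm_mult norm_numeral)
  also have "\<dots> \<le> cmod (q 1) + cmod (q (-1)) + cmod (q \<i>) + cmod (q (-\<i>))"
    using norm_triangle_ineq[of "q 1 - q (-1) - \<i> * q \<i>" "\<i> * q (-\<i>)"]
      norm_triangle_ineq4[of "q 1 - q (-1)" "\<i> * q \<i>"] norm_triangle_ineq4[of "q 1" "q (-1)"]
    by (simp add: norm_mult)
  also have "\<dots> \<le> h * (ell2_norm (w 1))\<^sup>2 + h * (ell2_norm (w (-1)))\<^sup>2 + h * (ell2_norm (w \<i>))\<^sup>2 + h * (ell2_norm (w (-\<i>)))\<^sup>2"
    unfolding q_def by (intro add_mono form w)
  also have "\<dots> = 4 * (h * ((ell2_norm a)\<^sup>2 + (ell2_norm b)\<^sup>2))"
    unfolding distrib_left[symmetric] Ns by simp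
  finally show ?thesis by simp
qed

lemma inverse_shift_lipschitz:
  fixes x y :: real and z :: complex
  assumes "Im z > 0"
  shows "cmod (1 / (of_real x - z)) \<le> 1 / Im z"
    and "cmod (1 / (of_real x - z) - 1 / (of_real y - z)) \<le> 1 / (Im z)\<^sup>2 * \<bar>x - y\<bar>"
proof -
  have im: "cmod (of_real x - z) \<ge> Im z" for x :: real
    using abs_Im_le_cmod[of "of_real x - z"] by simp
  show b: "cmod (1 / (of_real x - z)) \<le> 1 / Im z" for x :: real
    using im[of x] assms by (simp add: norm_divide frac_le)
  have nz: "of_real x - z \<noteq> 0" for x :: real using im[of x] assms by auto
  have "1 / (of_real x - z) - 1 / (of_real y - z) = (1 / (of_real x - z)) * (1 / (of_real y - z)) * of_real (y - x)"
    using nz[of x] nz[of y] by (simp add: field_simps)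
  then have "cmod (1 / (of_real x - z) - 1 / (of_real y - z)) = cmod (1 / (of_real x - z)) * cmod (1 / (of_real y - z)) * \<bar>x - y\<bar>"
    by (simp only: norm_mult norm_of_real abs_minus_commute)
  also have "\<dots> \<le> (1 / Im z) * (1 / Im z) * \<bar>x - y\<bar>"
    by (intro mult_right_mono mult_mono b) (use assms in auto)
  finally show "cmod (1 / (of_real x - z) - 1 / (of_real y - z)) \<le> 1 / (Im z)\<^sup>2 * \<bar>x - y\<bar>"
    by (simp add: power2_eq_square)
qed

lemma Im_borel_transform:
  assumes M: "finite_measure M" "sets M = sets borel" and supp: "AE x in M. \<bar>x\<bar> \<le> R" and z: "Im z > 0"
  shows "Im (borel_transform M z) = Im z * (\<integral>x. (cmod (1 / (of_real x - z)))\<^sup>2 \<partial>M)"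
proof -
  have i: "integrable M (\<lambda>x. 1 / (of_real x - z))"
    by (rule riemann_sum_bound(1)[OF M supp zero_less_one inverse_shift_lipschitz(2)[OF z]])
  have "Im (1 / (of_real x - z)) = Im z * (cmod (1 / (of_real x - z)))\<^sup>2" for x :: real
    by (simp add: Im_divide norm_divide cmod_power2 power_divide)
  then show ?thesis
    unfolding borel_transform_def integral_Im[OF i, symmetric] by (simp del: norm_divide)
qed

text \<open>The vector \<open>\<phi>\<close> stands for \<open>(H - z)\<inverse> \<delta>\<^sub>j\<close>. It is the sum of \<open>(x\<^sub>k - z)\<inverse> P(I\<^sub>k) \<delta>\<^sub>j\<close> over a fine
  partition into cells \<open>I\<^sub>k\<close> with left end points \<open>x\<^sub>k\<close>. The difference between \<open>H\<close> and
  \<open>\<Sum>\<^sub>k x\<^sub>k P(I\<^sub>k)\<close> has a small quadratic form because the identity function is close to its step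
  function, so polarization makes the residual of the resolvent equation small at every site.
  The other two estimates are Riemann sums for \<open>F\<close> and for \<open>\<integral> \<bar>x - z\<bar>\<^sup>-\<^sup>2 = Im F / Im z\<close>; the last
  identity is the reason why the squared norm of \<open>\<phi>\<close> is controlled by \<open>\<bar>F\<bar> / Im z\<close>. The residual
  will be absorbed in the error made by replacing the potential by a periodic one.\<close>

lemma approximate_resolvent_vector:
  assumes sr: "spectral_resolution (schrodinger V) P" and V: "\<And>n. \<bar>V n\<bar> \<le> v"
    and z: "Im z > 0" and \<tau>: "\<tau> > 0"
    and F_def: "F = borel_transform (vector_measure P (delta j)) z"
  obtains \<phi> where "\<And>n. cmod (schrodinger V \<phi> n - z * \<phi> n - delta j n) \<le> \<tau>"
    and "\<And>S. finite S \<Longrightarrow> (\<Sum>n\<in>S. (cmod (\<phi> n))\<^sup>2) \<le> cmod F / Im z + \<tau>"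
    and "cmod (\<phi> j - F) \<le> \<tau>"
proof -
  note pvm = resolution_pvm[OF sr]
  define e where "e = Im z"
  define R where "R = 3 + v"
  \<comment> \<open>The denominator adds up the three error terms of the claim, each linear in the mesh.\<close>
  define h where "h = \<tau> / (1 + 1 / e\<^sup>2 + 2 / e ^ 3)"
  have e0: "e > 0" using z by (simp add: e_def)
  have den: "1 + 1 / e\<^sup>2 + 2 / e ^ 3 > 0" using e0 by (intro add_pos_pos) auto
  have h0: "h > 0" using den \<tau> by (simp add: h_def)
  have hden: "h * (1 + 1 / e\<^sup>2 + 2 / e ^ 3) = \<tau>" using den by (simp add: h_def)
  have h1: "h * (1 + 1 / e\<^sup>2) \<le> \<tau>" "1 / e\<^sup>2 * h \<le> \<tau>" "2 / e ^ 3 * h \<le> \<tau>"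
  proof -
    have "h * (1 / e\<^sup>2) \<ge> 0" "h * (2 / e ^ 3) \<ge> 0" using h0 e0 by simp_all
    then show "h * (1 + 1 / e\<^sup>2) \<le> \<tau>" "1 / e\<^sup>2 * h \<le> \<tau>" "2 / e ^ 3 * h \<le> \<tau>"
      using hden h0 unfolding distrib_left mult.commute[of _ h] by linarith+
  qed
  define K where "K = cells R h"
  define x where "x k = of_int k * h" for k
  define c where "c k = 1 / (complex_of_real (x k) - z)" for k
  define p where "p k = P (cell h k) (delta j)" for k
  define \<mu> where "\<mu> = vector_measure P (delta j)"
  have K: "finite K" by (simp add: K_def)
  have \<mu>: "finite_measure \<mu>" "sets \<mu> = sets borel" "AE x in \<mu>. \<bar>x\<bar> \<le> R" "measure \<mu> UNIV = 1"
    unfolding \<mu>_def using finite_measure_vector_measure[OF pvm delta_ell2] resolution_support[OF sr V _ delta_ell2, of R]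
      measure_vector_measure[OF pvm delta_ell2, of UNIV] pvm_UNIV[OF pvm delta_ell2] by (auto simp: R_def)
  have pell: "p k \<in> ell2" for k unfolding p_def by (rule pvm_ell2[OF pvm _ delta_ell2]) simp
  have pP: "P (cell h k) (p l) = (if k = l then p l else (\<lambda>n. 0))" for k l
    unfolding p_def using pvm_Int[OF pvm _ _ delta_ell2, of "cell h k" "cell h l" j] pvm_empty[OF pvm delta_ell2, of j]
    by (simp add: cell_Int)
  have pin: "ell2_inner (p k) (p l) = (if k = l then of_real (measure \<mu> (cell h k)) else 0)" for k l
    using pvm_inner[OF pvm _ _ delta_ell2 delta_ell2, of "cell h k" "cell h l" j j] pvm_empty[OF pvm delta_ell2, of j]
      pvm_form[OF pvm _ delta_ell2, of "cell h k" j] measure_vector_measure[OF pvm delta_ell2, of "cell h k" j]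
    unfolding p_def \<mu>_def by (auto simp: cell_Int)
  have pj: "ell2_inner (delta j) (p k) = of_real (measure \<mu> (cell h k))" for k
    using pvm_form[OF pvm _ delta_ell2, of "cell h k" j] measure_vector_measure[OF pvm delta_ell2, of "cell h k" j]
    unfolding p_def \<mu>_def by simp
  have mass: "(\<Sum>k\<in>K. measure \<mu> (cell h k)) = 1"
  proof -
    have "cmod ((\<integral>x. 1 \<partial>\<mu>) - (\<Sum>k\<in>K. 1 * complex_of_real (measure \<mu> (cell h k)))) \<le> 0 * h * measure \<mu> UNIV"
      unfolding K_def by (rule riemann_sum_bound(2)[OF \<mu>(1-3) h0, of "\<lambda>_. 1"]) simp
    moreover have "(\<integral>x. (1::complex) \<partial>\<mu>) = 1" using \<mu>(2,4) sets_eq_imp_space_eq[OF \<mu>(2)] by simp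
    ultimately have "complex_of_real (\<Sum>k\<in>K. measure \<mu> (cell h k)) = 1" by simp
    then show ?thesis using of_real_eq_1_iff by blast
  qed
  \<comment> \<open>Pythagoras for the mutually orthogonal vectors \<open>p k\<close>.\<close>
  have comb_norm: "(ell2_norm (\<lambda>n. \<Sum>k\<in>K. a k * p k n))\<^sup>2 = (\<Sum>k\<in>K. (cmod (a k))\<^sup>2 * measure \<mu> (cell h k))" for a
  proof -
    let ?y = "\<lambda>n. \<Sum>k\<in>K. a k * p k n"
    have y: "?y \<in> ell2" by (intro ell2_sum K pell)
    have "ell2_inner (p l) ?y = (if l \<in> K then a l * of_real (measure \<mu> (cell h l)) else 0)" for l
      using K by (simp add: ell2_inner_sum_right[OF K pell pell] pin if_distrib cong: if_cong)
    then have "ell2_inner ?y (p l) = (if l \<in> K then cnj (a l) * of_real (measure \<mu> (cell h l)) else 0)" for l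
      by (subst ell2_inner_commute) simp
    then have "ell2_inner ?y ?y = (\<Sum>k\<in>K. a k * (cnj (a k) * of_real (measure \<mu> (cell h k))))"
      unfolding ell2_inner_sum_right[OF K pell y] by simp
    also have "\<dots> = of_real (\<Sum>k\<in>K. (cmod (a k))\<^sup>2 * measure \<mu> (cell h k))"
      unfolding of_real_sum of_real_mult complex_norm_square by (simp add: mult.assoc)
    finally show ?thesis unfolding ell2_inner_self using of_real_eq_iff by blast
  qed
  have resolve: "(\<Sum>k\<in>K. p k n) = delta j n" for n
  proof -
    let ?y = "\<lambda>n. \<Sum>k\<in>K. 1 * p k n"
    have y: "?y \<in> ell2" by (intro ell2_sum K pell)
    have yy: "ell2_inner ?y ?y = 1"
      unfolding ell2_inner_self comb_norm using mass by simp
    have dy: "ell2_inner (delta j) ?y = 1"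
      unfolding ell2_inner_sum_right[OF K pell delta_ell2] pj
      using arg_cong[OF mass, of complex_of_real] by simp
    have yd: "ell2_inner ?y (delta j) = 1" by (subst ell2_inner_commute) (simp only: dy complex_cnj_one)
    have dd: "ell2_inner (delta j) (delta j) = 1" by (simp add: ell2_inner_self)
    define d where "d = (\<lambda>n. 1 * delta j n + (-1) * ?y n)"
    have d: "d \<in> ell2" unfolding d_def by (rule ell2_lincomb[OF delta_ell2 y])
    have "ell2_inner d d = 0"
      unfolding d_def ell2_inner_lincomb_right[OF d[unfolded d_def] delta_ell2 y]
        ell2_inner_lincomb_left[OF delta_ell2 delta_ell2 y] ell2_inner_lincomb_left[OF y delta_ell2 y]
      unfolding yy dy yd dd by simp
    then have "ell2_norm d = 0" unfolding ell2_inner_self by simp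
    then have "d n = 0" by (rule ell2_norm_eq_0D[OF d])
    then show ?thesis by (simp add: d_def)
  qed
  define \<phi> where "\<phi> = (\<lambda>n. \<Sum>k\<in>K. c k * p k n)"
  have \<phi>: "\<phi> \<in> ell2" unfolding \<phi>_def by (intro ell2_sum K pell)
  have P\<phi>: "P (cell h k) \<phi> = (\<lambda>n. c k * p k n)" if "k \<in> K" for k
  proof -
    have "P (cell h k) (\<lambda>n. \<Sum>l\<in>L. c l * p l n) = (\<lambda>n. if k \<in> L then c k * p k n else 0)" if "finite L" for L
      using that
    proof (induction L rule: finite_induct)
      case empty
      have "P (cell h k) (\<lambda>n. 0 * delta j n + 0 * delta j n) = (\<lambda>n. 0 * P (cell h k) (delta j) n + 0 * P (cell h k) (delta j) n)"
        by (rule pvm_lincomb[OF pvm _ delta_ell2 delta_ell2]) simp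
      then show ?case by simp
    next
      case (insert l L)
      have "P (cell h k) (\<lambda>n. c l * p l n + 1 * (\<Sum>l\<in>L. c l * p l n)) = (\<lambda>n. c l * P (cell h k) (p l) n + 1 * P (cell h k) (\<lambda>n. \<Sum>l\<in>L. c l * p l n) n)"
        by (rule pvm_lincomb[OF pvm _ pell ell2_sum[OF insert(1) pell]]) simp
      then show ?case using insert by (auto simp: pP fun_eq_iff)
    qed
    from this[OF K] that show ?thesis by (simp add: \<phi>_def)
  qed
  \<comment> \<open>The error made by replacing the operator by its step function.\<close>
  define D where "D u = (\<lambda>n. 1 * schrodinger V u n + (-1) * (\<Sum>k\<in>K. of_real (x k) * P (cell h k) u n))" for u
  have Pk: "u \<in> ell2 \<Longrightarrow> P (cell h k) u \<in> ell2" for u k by (rule pvm_ell2[OF pvm]) auto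
  have sumell: "u \<in> ell2 \<Longrightarrow> (\<lambda>n. \<Sum>k\<in>K. of_real (x k) * P (cell h k) u n) \<in> ell2" for u
    by (intro ell2_sum K Pk)
  have D1: "D u \<in> ell2" if "u \<in> ell2" for u
    unfolding D_def by (intro ell2_lincomb schrodinger_ell2(1)[OF V] sumell that)
  have D2: "D (\<lambda>n. a * u n + b * w n) = (\<lambda>n. a * D u n + b * D w n)" if "u \<in> ell2" "w \<in> ell2" for u w a b
    unfolding D_def schrodinger_lincomb pvm_lincomb[OF pvm cell_measurable that]
    by (simp add: algebra_simps sum.distrib sum_distrib_left)
  have D3: "cmod (ell2_inner w (D w)) \<le> h * (ell2_norm w)\<^sup>2" if w: "w \<in> ell2" for w
  proof -
    have "ell2_inner w (D w) = ell2_inner w (schrodinger V w) - (\<Sum>k\<in>K. of_real (x k) * ell2_inner w (P (cell h k) w))"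
      unfolding D_def ell2_inner_lincomb_right[OF w schrodinger_ell2(1)[OF V w] sumell[OF w]]
        ell2_inner_sum_right[OF K Pk[OF w] w] by simp
    also have "ell2_inner w (schrodinger V w) = (\<integral>x. complex_of_real x \<partial>vector_measure P w)"
      unfolding resolution_form(1)[OF sr w] by simp
    also have "(\<Sum>k\<in>K. of_real (x k) * ell2_inner w (P (cell h k) w)) =
       (\<Sum>k\<in>K. complex_of_real (of_int k * h) * of_real (measure (vector_measure P w) (cell h k)))"
      unfolding x_def using pvm_form[OF pvm cell_measurable w] measure_vector_measure[OF pvm w cell_measurable] by simp
    finally have e: "ell2_inner w (D w) = (\<integral>x. complex_of_real x \<partial>vector_measure P w) -
        (\<Sum>k\<in>K. complex_of_real (of_int k * h) * of_real (measure (vector_measure P w) (cell h k)))" .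
    have "cmod (ell2_inner w (D w)) \<le> 1 * h * measure (vector_measure P w) UNIV"
      unfolding e K_def
    proof (rule riemann_sum_bound(2)[OF finite_measure_vector_measure[OF pvm w] _ _ h0])
      show "AE x in vector_measure P w. \<bar>x\<bar> \<le> R" by (rule resolution_support[OF sr V _ w]) (simp add: R_def)
      show "cmod (complex_of_real x - complex_of_real y) \<le> 1 * \<bar>x - y\<bar>" for x y
        unfolding of_real_diff[symmetric] norm_of_real by simp
    qed simp
    then show ?thesis using measure_vector_measure[OF pvm w, of UNIV] pvm_UNIV[OF pvm w] by simp
  qed
  have xz: "(of_real (x k) - z) * c k = 1" for k
  proof -
    have "of_real (x k) - z \<noteq> 0" using z by (auto simp: complex_eq_iff)
    then show ?thesis by (simp add: c_def)
  qed
  have norm\<phi>: "(ell2_norm \<phi>)\<^sup>2 = (\<Sum>k\<in>K. (cmod (c k))\<^sup>2 * measure \<mu> (cell h k))"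
    unfolding \<phi>_def by (rule comb_norm)
  have norm\<phi>1: "(ell2_norm \<phi>)\<^sup>2 \<le> 1 / e\<^sup>2"
  proof -
    have "(cmod (c k))\<^sup>2 \<le> (1 / e)\<^sup>2" for k
      unfolding c_def e_def by (intro power_mono inverse_shift_lipschitz(1) z) auto
    then have "(ell2_norm \<phi>)\<^sup>2 \<le> (\<Sum>k\<in>K. (1 / e)\<^sup>2 * measure \<mu> (cell h k))"
      unfolding norm\<phi> by (intro sum_mono mult_right_mono) auto
    also have "\<dots> = 1 / e\<^sup>2" unfolding sum_distrib_left[symmetric] mass by (simp add: power_divide)
    finally show ?thesis .
  qed
  show ?thesis
  proof (rule that[of \<phi>])
    fix n
    have "D \<phi> n = schrodinger V \<phi> n - (\<Sum>k\<in>K. of_real (x k) * (c k * p k n))"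
      unfolding D_def using P\<phi> by simp
    moreover have "(\<Sum>k\<in>K. of_real (x k) * (c k * p k n)) - z * \<phi> n = (\<Sum>k\<in>K. ((of_real (x k) - z) * c k) * p k n)"
      unfolding \<phi>_def sum_distrib_left sum_subtractf[symmetric] by (simp add: algebra_simps)
    ultimately have "schrodinger V \<phi> n - z * \<phi> n - delta j n = D \<phi> n"
      unfolding xz using resolve[of n] by (simp add: algebra_simps)
    also have "\<dots> = ell2_inner (delta n) (D \<phi>)" by (simp add: ell2_inner_delta)
    finally have eq: "schrodinger V \<phi> n - z * \<phi> n - delta j n = ell2_inner (delta n) (D \<phi>)" .
    have "cmod (schrodinger V \<phi> n - z * \<phi> n - delta j n) \<le> h * ((ell2_norm (delta n))\<^sup>2 + (ell2_norm \<phi>)\<^sup>2)"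
      unfolding eq
    proof (rule quadratic_form_polarization_bound)
      show "D u \<in> ell2" if "u \<in> ell2" for u by (rule D1[OF that])
      show "D (\<lambda>n. a * u n + b * w n) = (\<lambda>n. a * D u n + b * D w n)" if "u \<in> ell2" "w \<in> ell2" for u w a b
        by (rule D2[OF that])
      show "cmod (ell2_inner w (D w)) \<le> h * (ell2_norm w)\<^sup>2" if "w \<in> ell2" for w by (rule D3[OF that])
    qed (rule delta_ell2 \<phi>)+
    also have "\<dots> \<le> h * (1 + 1 / e\<^sup>2)" using norm\<phi>1 h0 by (intro mult_left_mono) auto
    also have "\<dots> \<le> \<tau>" by (rule h1)
    finally show "cmod (schrodinger V \<phi> n - z * \<phi> n - delta j n) \<le> \<tau>" .
  next
    fix S :: "int set" assume "finite S"
    then have "(\<Sum>n\<in>S. (cmod (\<phi> n))\<^sup>2) \<le> (ell2_norm \<phi>)\<^sup>2" by (rule ell2_finite_sum_le[OF \<phi>])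
    also have "\<dots> \<le> (\<integral>x. (cmod (1 / (of_real x - z)))\<^sup>2 \<partial>\<mu>) + \<tau>"
    proof -
      let ?f = "\<lambda>x. (cmod (1 / (complex_of_real x - z)))\<^sup>2"
      have lip: "cmod (complex_of_real (?f x) - complex_of_real (?f y)) \<le> 2 / e ^ 3 * \<bar>x - y\<bar>" for x y
      proof -
        let ?a = "1 / (complex_of_real x - z)" and ?b = "1 / (complex_of_real y - z)"
        have "\<bar>?f x - ?f y\<bar> = \<bar>cmod ?a - cmod ?b\<bar> * (cmod ?a + cmod ?b)"
          unfolding power2_eq_square square_diff_square_factored abs_mult by (simp del: norm_divide add: mult.commute)
        also have "\<dots> \<le> (1 / e\<^sup>2 * \<bar>x - y\<bar>) * (1 / e + 1 / e)"
          unfolding e_def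
          by (intro mult_mono add_mono inverse_shift_lipschitz(1)[OF z] order_trans[OF norm_triangle_ineq3 inverse_shift_lipschitz(2)[OF z]]) auto
        also have "\<dots> = 2 / e ^ 3 * \<bar>x - y\<bar>" by (simp add: power2_eq_square power3_eq_cube)
        finally show ?thesis unfolding of_real_diff[symmetric] norm_of_real .
      qed
      have "cmod ((\<integral>x. complex_of_real (?f x) \<partial>\<mu>) - (\<Sum>k\<in>K. complex_of_real (?f (of_int k * h)) * of_real (measure \<mu> (cell h k)))) \<le> 2 / e ^ 3 * h * measure \<mu> UNIV"
        unfolding K_def by (rule riemann_sum_bound(2)[OF \<mu>(1-3) h0 lip])
      also have "(\<integral>x. complex_of_real (?f x) \<partial>\<mu>) - (\<Sum>k\<in>K. complex_of_real (?f (of_int k * h)) * of_real (measure \<mu> (cell h k)))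
        = complex_of_real ((\<integral>x. ?f x \<partial>\<mu>) - (ell2_norm \<phi>)\<^sup>2)"
        by (simp only: integral_complex_of_real of_real_diff of_real_sum of_real_mult norm\<phi> c_def x_def)
      finally have "\<bar>(\<integral>x. ?f x \<partial>\<mu>) - (ell2_norm \<phi>)\<^sup>2\<bar> \<le> \<tau>"
        unfolding norm_of_real \<mu>(4) using h1(3) by linarith
      then show ?thesis by linarith
    qed
    also have "(\<integral>x. (cmod (1 / (of_real x - z)))\<^sup>2 \<partial>\<mu>) = Im F / Im z"
      unfolding F_def \<mu>_def[symmetric] Im_borel_transform[OF \<mu>(1-3) z] using z by simp
    also have "\<dots> \<le> cmod F / Im z" using abs_Im_le_cmod[of F] z by (intro divide_right_mono) auto
    finally show "(\<Sum>n\<in>S. (cmod (\<phi> n))\<^sup>2) \<le> cmod F / Im z + \<tau>" by simp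
  next
    have "\<phi> j = ell2_inner (delta j) \<phi>" by (simp add: ell2_inner_delta)
    also have "\<dots> = (\<Sum>k\<in>K. c k * of_real (measure \<mu> (cell h k)))"
      unfolding \<phi>_def ell2_inner_sum_right[OF K pell delta_ell2] pj ..
    finally have "cmod (F - \<phi> j) \<le> 1 / e\<^sup>2 * h * measure \<mu> UNIV"
      using riemann_sum_bound(2)[OF \<mu>(1-3) h0 inverse_shift_lipschitz(2)[OF z]]
      unfolding F_def borel_transform_def \<mu>_def[symmetric] K_def c_def x_def e_def by simp
    then show "cmod (\<phi> j - F) \<le> \<tau>" using h1(2) by (simp add: \<mu>(4) norm_minus_commute)
  qed
qed

section \<open>The spectral measure and its Borel transform\<close>

lemma spectral_measure_sets [simp, measurable_cong]: "sets (spectral_measure P) = sets borel"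
  and spectral_measure_space [simp]: "space (spectral_measure P) = UNIV"
  unfolding spectral_measure_def
  using sets.sigma_sets_eq[of "borel :: real measure"] by (simp_all add: sets_measure_of_conv space_measure_of_conv)

lemma emeasure_spectral_measure:
  assumes A: "A \<in> sets borel"
  shows "emeasure (spectral_measure P) A = emeasure (vector_measure P (delta 0)) A + emeasure (vector_measure P (delta 1)) A"
proof -
  let ?f = "\<lambda>B. emeasure (vector_measure P (delta 0)) B + emeasure (vector_measure P (delta 1)) B"
  show ?thesis
  proof (rule emeasure_measure_of[of "spectral_measure P" UNIV "sets borel" ?f])
    show "spectral_measure P = measure_of UNIV (sets borel) ?f" by (simp add: spectral_measure_def)
    show "positive (sets (spectral_measure P)) ?f" by (simp add: positive_def)
    show "countably_additive (sets (spectral_measure P)) ?f"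
    proof (rule countably_additiveI)
      fix B :: "nat \<Rightarrow> real set"
      assume B: "range B \<subseteq> sets (spectral_measure P)" "disjoint_family B"
      show "(\<Sum>i. ?f (B i)) = ?f (\<Union> (range B))"
        using B by (subst suminf_add[symmetric]) (auto simp: suminf_emeasure)
    qed
  qed (use A in auto)
qed

lemma spectral_measure_properties:
  assumes sr: "spectral_resolution (schrodinger V) P" and V: "\<And>n. \<bar>V n\<bar> \<le> v" and R: "R > 2 + v"
  shows "finite_measure (spectral_measure P)" and "AE x in spectral_measure P. \<bar>x\<bar> \<le> R"
    and "A \<in> sets borel \<Longrightarrow> measure (spectral_measure P) A =
       measure (vector_measure P (delta 0)) A + measure (vector_measure P (delta 1)) A"
proof -
  note fin = finite_measure_vector_measure[OF resolution_pvm[OF sr] delta_ell2]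
  interpret m0: finite_measure "vector_measure P (delta 0)" by (rule fin)
  interpret m1: finite_measure "vector_measure P (delta 1)" by (rule fin)
  show "finite_measure (spectral_measure P)"
    by (rule finite_measureI) (simp add: emeasure_spectral_measure)
  show "measure (spectral_measure P) A =
       measure (vector_measure P (delta 0)) A + measure (vector_measure P (delta 1)) A" if "A \<in> sets borel"
    using emeasure_spectral_measure[OF that, of P] unfolding measure_def
    by (simp add: enn2real_plus less_top[symmetric])
  have "{x. \<not> \<bar>x\<bar> \<le> R} = {..<-R} \<union> {R<..}" by auto
  then have B: "{x. \<not> \<bar>x\<bar> \<le> R} \<in> sets borel" by simp
  have "emeasure (vector_measure P (delta j)) {x. \<not> \<bar>x\<bar> \<le> R} = 0" for j
    using resolution_support[OF sr V R delta_ell2[of j]] B by (subst (asm) AE_iff_measurable[OF _ refl]) auto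
  then show "AE x in spectral_measure P. \<bar>x\<bar> \<le> R"
    by (subst AE_iff_measurable[OF _ refl]) (auto simp: emeasure_spectral_measure B)
qed

text \<open>Compare both sides with Riemann sums, which are additive in the measure, and let the mesh tend
  to \<open>0\<close>.\<close>

lemma borel_transform_spectral_measure:
  assumes sr: "spectral_resolution (schrodinger V) P" and V: "\<And>n. \<bar>V n\<bar> \<le> v" and z: "Im z > 0"
  shows "borel_transform (spectral_measure P) z =
    borel_transform (vector_measure P (delta 0)) z + borel_transform (vector_measure P (delta 1)) z"
proof -
  note pvm = resolution_pvm[OF sr]
  define R where "R = 3 + v"
  have R: "R > 2 + v" by (simp add: R_def)
  note sm = spectral_measure_properties[OF sr V R]
  let ?s = "spectral_measure P" and ?u = "vector_measure P (delta 0)" and ?v = "vector_measure P (delta 1)"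
  define T where "T = measure ?s UNIV"
  have T: "T = measure ?u UNIV + measure ?v UNIV" unfolding T_def using sm(3)[of UNIV] by simp
  have T0: "T \<ge> 0" by (simp add: T_def)
  let ?d = "borel_transform ?s z - (borel_transform ?u z + borel_transform ?v z)"
  have bound: "cmod ?d \<le> 2 * (1 / (Im z)\<^sup>2 * T) * h" if h: "h > 0" for h
  proof -
    define S where "S M = (\<Sum>k\<in>cells R h. 1 / (complex_of_real (of_int k * h) - z) * of_real (measure M (cell h k)))" for M
    have a: "cmod (borel_transform M z - S M) \<le> 1 / (Im z)\<^sup>2 * h * measure M UNIV"
      if "finite_measure M" "sets M = sets borel" "AE x in M. \<bar>x\<bar> \<le> R" for M
      unfolding S_def borel_transform_def by (rule riemann_sum_bound(2)[OF that h inverse_shift_lipschitz(2)[OF z]])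
    have av: "cmod (borel_transform (vector_measure P (delta j)) z - S (vector_measure P (delta j)))
        \<le> 1 / (Im z)\<^sup>2 * h * measure (vector_measure P (delta j)) UNIV" for j
      by (rule a[OF finite_measure_vector_measure[OF pvm delta_ell2] sets_vector_measure resolution_support[OF sr V R delta_ell2]])
    \<comment> \<open>The Riemann sums, unlike the integrals, are visibly additive.\<close>
    have "S ?s = S ?u + S ?v"
      unfolding S_def sum.distrib[symmetric] by (intro sum.cong refl) (simp add: sm(3) distrib_left)
    then have "cmod ?d = cmod ((borel_transform ?s z - S ?s) - (borel_transform ?u z - S ?u) - (borel_transform ?v z - S ?v))"
      by (intro arg_cong[where f = cmod]) (simp add: algebra_simps)
    also have "\<dots> \<le> cmod (borel_transform ?s z - S ?s) + cmod (borel_transform ?u z - S ?u) + cmod (borel_transform ?v z - S ?v)"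
      by (rule order_trans[OF norm_triangle_ineq4 add_right_mono[OF norm_triangle_ineq4]])
    also have "\<dots> \<le> 1 / (Im z)\<^sup>2 * h * T + 1 / (Im z)\<^sup>2 * h * measure ?u UNIV + 1 / (Im z)\<^sup>2 * h * measure ?v UNIV"
      using add_mono[OF add_mono[OF a[OF sm(1) spectral_measure_sets sm(2)] av[of 0]] av[of 1]]
      unfolding T_def .
    also have "\<dots> = 2 * (1 / (Im z)\<^sup>2 * T) * h" unfolding T by (simp add: algebra_simps)
    finally show ?thesis .
  qed
  have "cmod ?d \<le> 0"
  proof (rule field_le_epsilon)
    fix e :: real assume e: "e > 0"
    define c where "c = 2 * (1 / (Im z)\<^sup>2 * T)"
    have c0: "c \<ge> 0" using T0 by (simp add: c_def)
    have "cmod ?d \<le> c * (e / (c + 1))" unfolding c_def[symmetric] using bound[of "e / (c + 1)"] e c0 by (simp add: c_def)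
    also have "\<dots> \<le> e" using e c0 by (simp add: field_simps)
    finally show "cmod ?d \<le> 0 + e" by simp
  qed
  then show ?thesis by simp
qed

text \<open>The Poisson kernel at height \<open>r\<close> is at least \<open>1 / (2 r)\<close> on the interval of radius \<open>r\<close>.\<close>

lemma measure_ball_le_borel_transform:
  assumes M: "finite_measure M" "sets M = sets borel" and supp: "AE x in M. \<bar>x\<bar> \<le> R" and r: "r > 0"
  shows "measure M {a - r..a + r} \<le> 2 * r * cmod (borel_transform M (Complex a r))"
proof -
  interpret finite_measure M by (rule M)
  have sp: "space M = UNIV" using sets_eq_imp_space_eq[OF M(2)] by simp
  let ?f = "\<lambda>x. (cmod (1 / (complex_of_real x - Complex a r)))\<^sup>2"
  have z: "Im (Complex a r) > 0" using r by simp
  have m: "{a - r..a + r} \<in> sets M" by (simp add: M)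
  have meas: "(\<lambda>x. 1 / (complex_of_real x - Complex a r)) \<in> borel_measurable M"
    by (rule borel_measurable_integrable[OF riemann_sum_bound(1)[OF M supp zero_less_one inverse_shift_lipschitz(2)[OF z]]])
  have fi: "integrable M ?f"
  proof (rule integrable_const_bound[where B = "(1 / r)\<^sup>2"])
    show "AE x in M. norm (?f x) \<le> (1 / r)\<^sup>2"
      using inverse_shift_lipschitz(1)[OF z] by (intro AE_I2) (auto intro!: power_mono simp del: norm_divide)
    show "?f \<in> borel_measurable M" by (intro borel_measurable_power measurable_compose[OF meas] borel_measurable_norm)
  qed
  have "measure M {a - r..a + r} / (2 * r\<^sup>2) = (\<integral>x. indicator {a - r..a + r} x * (1 / (2 * r\<^sup>2)) \<partial>M)"
    using m by (simp add: sp)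
  also have "\<dots> \<le> (\<integral>x. ?f x \<partial>M)"
  proof (rule integral_mono[OF _ fi])
    show "integrable M (\<lambda>x. indicator {a - r..a + r} x * (1 / (2 * r\<^sup>2)))"
      by (intro integrable_mult_left integrable_real_indicator m) (simp add: less_top[symmetric])
    fix x
    have e: "?f x = 1 / ((x - a)\<^sup>2 + r\<^sup>2)"
      by (simp add: norm_divide power_divide cmod_power2)
    show "indicator {a - r..a + r} x * (1 / (2 * r\<^sup>2)) \<le> ?f x"
    proof (cases "x \<in> {a - r..a + r}")
      case True
      then have "\<bar>x - a\<bar> \<le> \<bar>r\<bar>" by auto
      then have "(x - a)\<^sup>2 \<le> r\<^sup>2" by (rule abs_le_square_iff[THEN iffD1])
      then show ?thesis unfolding e using True r by (auto intro!: divide_left_mono mult_pos_pos add_nonneg_pos)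
    qed auto
  qed
  also have "\<dots> = Im (borel_transform M (Complex a r)) / r"
    using Im_borel_transform[OF M supp z] r by simp
  also have "\<dots> \<le> cmod (borel_transform M (Complex a r)) / r"
    using abs_Im_le_cmod[of "borel_transform M (Complex a r)"] r by (intro divide_right_mono) auto
  finally show ?thesis using r by (simp add: field_simps power2_eq_square)
qed

section \<open>Solutions for periodic potentials\<close>

text \<open>The recursion is stated over an arbitrary commutative ring so that the same function gives
  solutions of the difference equation, Chebyshev polynomials, and, over a polynomial ring,
  transfer polynomials in the energy.\<close>

fun three_term :: "(nat \<Rightarrow> 'a::comm_ring_1) \<Rightarrow> 'a \<Rightarrow> 'a \<Rightarrow> nat \<Rightarrow> 'a" where
  "three_term c a b 0 = a"
| "three_term c a b (Suc 0) = b"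
| "three_term c a b (Suc (Suc k)) = c k * three_term c a b (Suc k) - three_term c a b k"

definition solves :: "(int \<Rightarrow> real) \<Rightarrow> complex \<Rightarrow> (int \<Rightarrow> complex) \<Rightarrow> bool" where
  "solves W z w \<longleftrightarrow> (\<forall>n. schrodinger W w n = z * w n)"

text \<open>\<open>fundamental W z l k\<close> is the value at site \<open>l + k\<close> of the solution with values \<open>0\<close> and \<open>1\<close> at the sites
  \<open>l\<close> and \<open>l + 1\<close>. It serves as Green kernel on a half line.\<close>

definition fundamental :: "(int \<Rightarrow> real) \<Rightarrow> complex \<Rightarrow> int \<Rightarrow> nat \<Rightarrow> complex" where
  "fundamental W z l = three_term (\<lambda>k. z - of_real (W (l + 1 + int k))) 0 1"

text \<open>The trace of the transfer matrix over one period: the first term is the entry describing how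
  the datum at site \<open>1\<close> moves to site \<open>q + 1\<close>, the second how the datum at site \<open>0\<close> moves to \<open>q\<close>.\<close>

definition discriminant :: "(int \<Rightarrow> real) \<Rightarrow> nat \<Rightarrow> complex \<Rightarrow> complex" where
  "discriminant W q z = fundamental W z 0 (Suc q) - fundamental W z 1 (q - 1)"

lemma fundamental_simps [simp]:
  "fundamental W z l 0 = 0"
  "fundamental W z l (Suc 0) = 1"
  "fundamental W z l (Suc (Suc k)) =
     (z - of_real (W (l + 1 + int k))) * fundamental W z l (Suc k) - fundamental W z l k"
  by (simp_all add: fundamental_def)

lemma solves_step: "solves W z w \<Longrightarrow> w (n + 1) = (z - of_real (W n)) * w n - w (n - 1)"
proof -
  assume "solves W z w"
  then have "w (n + 1) + w (n - 1) + of_real (W n) * w n = z * w n"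
    by (simp add: solves_def schrodinger_def)
  then have "w (n + 1) = z * w n - w (n - 1) - of_real (W n) * w n"
    by (simp add: eq_diff_eq add.commute add.left_commute)
  then show ?thesis by (simp add: left_diff_distrib)
qed

lemma solves_step_down: "solves W z w \<Longrightarrow> w (n - 1) = (z - of_real (W n)) * w n - w (n + 1)"
  using solves_step[of W z w n] by simp

lemma solves_shift:
  assumes "solves W z w" "\<And>n. W (n + p) = W n"
  shows "solves W z (\<lambda>n. w (n + p))"
  unfolding solves_def schrodinger_def
proof
  fix n
  show "w (n + 1 + p) + w (n - 1 + p) + complex_of_real (W n) * w (n + p) = z * w (n + p)"
    using assms(1)[unfolded solves_def schrodinger_def, rule_format, of "n + p"] assms(2)[of n]
    by (simp add: algebra_simps)
qed

lemma solves_lincomb: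
  assumes "solves W z w" "solves W z w'"
  shows "solves W z (\<lambda>n. a * w n + b * w' n)"
  unfolding solves_def schrodinger_def
proof
  fix n
  have 1: "w (n + 1) = (z - of_real (W n)) * w n - w (n - 1)" "w' (n + 1) = (z - of_real (W n)) * w' n - w' (n - 1)"
    using assms solves_step by blast+
  show "a * w (n + 1) + b * w' (n + 1) + (a * w (n - 1) + b * w' (n - 1)) +
         complex_of_real (W n) * (a * w n + b * w' n) =
         z * (a * w n + b * w' n)"
    unfolding 1 by (simp add: algebra_simps)
qed

lemma solves_reflect:
  assumes "solves W z w" shows "solves (\<lambda>n. W (- n)) z (\<lambda>n. w (- n))"
  unfolding solves_def schrodinger_def
proof
  fix n
  show "w (- (n + 1)) + w (- (n - 1)) + complex_of_real (W (- n)) * w (- n) = z * w (- n)"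
    using assms[unfolded solves_def schrodinger_def, rule_format, of "- n"]
    by (simp add: algebra_simps minus_diff_commute)
qed

lemma solves_unique_zero:
  assumes s: "solves W z w" and "w 0 = 0" "w 1 = 0"
  shows "w n = 0"
proof -
  have up: "w (int k) = 0 \<and> w (int k + 1) = 0" for k
  proof (induction k)
    case (Suc k)
    then show ?case using solves_step[OF s, of "int k + 1"] by (simp add: algebra_simps)
  qed (use assms in auto)
  have down: "w (- int k) = 0 \<and> w (1 - int k) = 0" for k
  proof (induction k)
    case (Suc k)
    then show ?case using solves_step_down[OF s, of "- int k"]
      by (simp add: algebra_simps minus_diff_commute)
  qed (use assms in auto)
  show ?thesis
  proof (cases "n \<ge> 0")
    case True then show ?thesis using up[of "nat n"] by simp
  next
    case False then show ?thesis using down[of "nat (-n)"] by simp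
  qed
qed

lemma solution_exists:
  obtains w where "solves W z w" "w l = a" "w (l + 1) = b"
proof -
  define f where "f = three_term (\<lambda>k. z - of_real (W (l + 1 + int k))) a b"
  define g where "g = three_term (\<lambda>k. z - of_real (W (l - int k))) b a"
  define w where "w n = (if n \<ge> l then f (nat (n - l)) else g (nat (l + 1 - n)))" for n
  \<comment> \<open>Both one-sided recursions start from the sites \<open>l\<close> and \<open>l + 1\<close>, where they agree.\<close>
  have gl: "w n = g (nat (l + 1 - n))" if "n \<le> l + 1" for n
  proof (cases "n \<ge> l")
    case True
    then have "n = l \<or> n = l + 1" using that by auto
    then show ?thesis by (auto simp: w_def f_def g_def)
  qed (auto simp: w_def)
  have step: "w (n + 1) + w (n - 1) + of_real (W n) * w n = z * w n" for n
  proof (cases "n > l")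
    case True
    then obtain k where k: "n = l + 1 + int k" using zle_iff_zadd[of "l+1" n] by auto
    have e: "nat (n + 1 - l) = Suc (Suc k)" "nat (n - l) = Suc k" "nat (n - 1 - l) = k" using k by auto
    have "w (n + 1) = f (Suc (Suc k))" "w n = f (Suc k)" "w (n - 1) = f k"
      using True unfolding w_def e by auto
    then show ?thesis by (simp add: f_def k algebra_simps)
  next
    case False
    then obtain k where k: "n = l - int k" using zle_iff_zadd[of n l] by (metis add_diff_cancel_right' linorder_not_less)
    have e: "nat (l + 1 - (n + 1)) = k" "nat (l + 1 - n) = Suc k" "nat (l + 1 - (n - 1)) = Suc (Suc k)"
      using k by auto
    have "w (n + 1) = g k" "w n = g (Suc k)" "w (n - 1) = g (Suc (Suc k))"
      using False gl[of "n+1"] gl[of n] gl[of "n-1"] unfolding e by auto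
    then show ?thesis by (simp add: g_def k algebra_simps)
  qed
  show ?thesis
  proof
    show "solves W z w" unfolding solves_def schrodinger_def using step by blast
    show "w l = a" by (simp add: w_def f_def)
    show "w (l + 1) = b" by (simp add: w_def f_def)
  qed
qed

lemma solves_fundamental_expand:
  assumes s: "solves W z w"
  shows "w (l + 1 + int k) = w (l + 1) * fundamental W z l (Suc k) - w l * fundamental W z (l + 1) k"
proof (induction k rule: induct_nat_012)
  case 0 show ?case by simp
next
  case 1
  show ?case using solves_step[OF s, of "l+1"] by (simp add: algebra_simps)
next
  case (ge2 k)
  have e: "l + 1 + int (Suc (Suc k)) = (l + 1 + int (Suc k)) + 1"
          "(l + 1 + int (Suc k)) - 1 = l + 1 + int k" by simp_all
  have "w (l + 1 + int (Suc (Suc k))) = (z - of_real (W (l + 1 + int (Suc k)))) * w (l + 1 + int (Suc k)) - w (l + 1 + int k)"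
    unfolding e(1) using solves_step[OF s, of "l + 1 + int (Suc k)"] unfolding e(2) .
  then show ?case unfolding ge2 by (simp add: algebra_simps)
qed

text \<open>The transfer matrix has determinant \<open>1\<close>.\<close>

lemma fundamental_wronskian:
  "fundamental W z l (Suc k) * fundamental W z (l + 1) (Suc k)
     - fundamental W z l (Suc (Suc k)) * fundamental W z (l + 1) k = 1"
proof (induction k)
  case (Suc k)
  show ?case using Suc by (simp add: algebra_simps)
qed simp

text \<open>This is the Cayley-Hamilton theorem for the transfer matrix \<open>S\<close> over one period, in the form
  \<open>S + S\<inverse> = t\<close>. It holds at the sites \<open>0\<close> and \<open>1\<close>, and its defect is again a solution.\<close>

lemma solution_period_recurrence:
  assumes per: "\<And>n. W (n + int q) = W n" and q: "q > 0" and s: "solves W z w"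
  shows "w (n + int q) + w (n - int q) = discriminant W q z * w n"
proof -
  obtain p where p: "q = Suc p" using q by (metis Suc_pred)
  define t where "t = discriminant W q z"
  have two: "v (2 * int q) - t * v (int q) + v 0 = 0 \<and>
        v (2 * int q + 1) - t * v (int q + 1) + v 1 = 0" if v: "solves W z v" for v
  proof -
    \<comment> \<open>The entries of the transfer matrix from the sites \<open>0, 1\<close> to the sites \<open>q, q + 1\<close>.\<close>
    define S11 where "S11 = - fundamental W z 1 p"
    define S12 where "S12 = fundamental W z 0 (Suc p)"
    define S21 where "S21 = - fundamental W z 1 (Suc p)"
    define S22 where "S22 = fundamental W z 0 (Suc (Suc p))"
    have det: "S11 * S22 - S12 * S21 = 1"
      using fundamental_wronskian[of W z 0 p] unfolding S11_def S12_def S21_def S22_def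
      by (simp del: fundamental_simps add: algebra_simps)
    have t: "t = S11 + S22" by (simp add: t_def discriminant_def S11_def S22_def p del: fundamental_simps)
    have one: "y (int q) = S11 * y 0 + S12 * y 1 \<and> y (int q + 1) = S21 * y 0 + S22 * y 1"
      if y: "solves W z y" for y
      using solves_fundamental_expand[OF y, of 0 p] solves_fundamental_expand[OF y, of 0 "Suc p"]
      by (simp del: fundamental_simps add: p S11_def S12_def S21_def S22_def algebra_simps)
    have a: "v (int q) = S11 * v 0 + S12 * v 1" "v (int q + 1) = S21 * v 0 + S22 * v 1"
      using one[OF v] by auto
    have b: "v (2 * int q) = S11 * v (int q) + S12 * v (int q + 1)"
       "v (2 * int q + 1) = S21 * v (int q) + S22 * v (int q + 1)"
      using one[OF solves_shift[OF v per]] by (auto simp: algebra_simps)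
    have "v (2 * int q) - t * v (int q) + v 0 = (1 - (S11 * S22 - S12 * S21)) * v 0"
      unfolding b t a by (simp add: algebra_simps)
    moreover have "v (2 * int q + 1) - t * v (int q + 1) + v 1 = (1 - (S11 * S22 - S12 * S21)) * v 1"
      unfolding b t a by (simp add: algebra_simps)
    ultimately show ?thesis unfolding det by simp
  qed
  have per': "W (n + - int q) = W n" for n using per[of "n - int q"] by simp
  define d where "d n = 1 * (1 * w (n + int q) + 1 * w (n + - int q)) + (-t) * w n" for n
  have ds: "solves W z d"
    unfolding d_def
    by (intro solves_lincomb s solves_shift[OF s per] solves_shift[OF s per'])
  have "d 0 = 0" "d 1 = 0"
    using two[OF solves_shift[OF s per']] by (auto simp: d_def algebra_simps)
  then have "d n = 0" using solves_unique_zero[OF ds] by blast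
  then show ?thesis by (simp add: d_def t_def)
qed

section \<open>Powers of the transfer matrix\<close>

text \<open>For \<open>t = x + 1/x\<close> these are \<open>(x\<^sup>k - x\<^sup>-\<^sup>k) / (x - 1/x)\<close> and \<open>x\<^sup>k + x\<^sup>-\<^sup>k\<close>. If \<open>S\<close> has determinant \<open>1\<close> and trace \<open>t\<close>,
  then \<open>cheb_t t k\<close> is the trace of \<open>S\<^sup>k\<close> and \<open>S\<^sup>k = cheb_u t k S - cheb_u t (k - 1)\<close>.\<close>

abbreviation cheb_u :: "complex \<Rightarrow> nat \<Rightarrow> complex" where "cheb_u t \<equiv> three_term (\<lambda>_. t) 0 1"
abbreviation cheb_t :: "complex \<Rightarrow> nat \<Rightarrow> complex" where "cheb_t t \<equiv> three_term (\<lambda>_. t) 2 t"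

lemma joukowski_root:
  fixes t :: complex obtains x where "x \<noteq> 0" "t = x + inverse x" "norm x \<ge> 1"
proof -
  define s where "s = csqrt (t\<^sup>2 - 4)"
  have s2: "s\<^sup>2 = t\<^sup>2 - 4" by (simp add: s_def)
  define x where "x = (t + s) / 2"
  define y where "y = (t - s) / 2"
  have xy: "x * y = 1" using s2 by (simp add: x_def y_def field_simps power2_eq_square)
  have sum: "x + y = t" by (simp add: x_def y_def field_simps)
  have nz: "x \<noteq> 0" "y \<noteq> 0" using xy by auto
  have iy: "y = inverse x" "x = inverse y" using xy nz by (auto simp: field_simps)
  have "norm x * norm y = 1" using xy by (metis norm_mult norm_one)
  then have "norm x \<ge> 1 \<or> norm y \<ge> 1"
    by (metis linorder_not_le mult_left_le nle_le norm_ge_zero order_le_less_trans)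
  then show ?thesis
    using that[of x] that[of y] nz iy sum by (metis add.commute)
qed

lemma cheb_t_joukowski:
  assumes "x \<noteq> 0" shows "cheb_t (x + inverse x) k = x ^ k + inverse x ^ k"
proof (induction k rule: induct_nat_012)
  case (ge2 k) show ?case using ge2 assms by (simp add: field_simps)
qed auto

lemma cheb_u_joukowski:
  assumes "x \<noteq> 0" shows "(x - inverse x) * cheb_u (x + inverse x) k = x ^ k - inverse x ^ k"
proof (induction k rule: induct_nat_012)
  case (ge2 k)
  have "(x - inverse x) * cheb_u (x + inverse x) (Suc (Suc k)) =
     (x + inverse x) * ((x - inverse x) * cheb_u (x + inverse x) (Suc k)) - (x - inverse x) * cheb_u (x + inverse x) k"
    by (simp add: algebra_simps)
  also have "\<dots> = x ^ Suc (Suc k) - inverse x ^ Suc (Suc k)"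
    unfolding ge2 using assms by (simp add: field_simps)
  finally show ?case .
qed auto

text \<open>The discriminant of the characteristic polynomial of \<open>S\<^sup>k\<close> is that of \<open>S\<close> times a square. Off the
  band edges \<open>t = 2\<close> and \<open>t = -2\<close> this bounds the norm of the powers of \<open>S\<close> by their traces,
  with no distinction between elliptic and hyperbolic \<open>S\<close>.\<close>

lemma cheb_pell: "(cheb_u t k)\<^sup>2 * (t\<^sup>2 - 4) = (cheb_t t k)\<^sup>2 - 4"
proof -
  obtain x where x: "x \<noteq> 0" "t = x + inverse x" using joukowski_root by metis
  have "t\<^sup>2 - 4 = (x - inverse x)\<^sup>2" unfolding x(2) using x(1) by (simp add: power2_eq_square field_simps)
  then have "(cheb_u t k)\<^sup>2 * (t\<^sup>2 - 4) = ((x - inverse x) * cheb_u t k)\<^sup>2" by (simp add: power_mult_distrib)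
  also have "\<dots> = (x ^ k - inverse x ^ k)\<^sup>2" unfolding x(2) cheb_u_joukowski[OF x(1)] ..
  also have "\<dots> = (x ^ k + inverse x ^ k)\<^sup>2 - 4"
    using x(1) by (simp add: power2_eq_square field_simps)
  also have "\<dots> = (cheb_t t k)\<^sup>2 - 4" unfolding x(2) cheb_t_joukowski[OF x(1)] ..
  finally show ?thesis .
qed

lemma cheb_t_double: "cheb_t t (2 * k) = (cheb_t t k)\<^sup>2 - 2"
proof -
  obtain x where x: "x \<noteq> 0" "t = x + inverse x" using joukowski_root by metis
  show ?thesis unfolding x(2) cheb_t_joukowski[OF x(1)]
    using x(1) by (simp add: power2_eq_square field_simps power_mult power_add)
qed

text \<open>The reason behind Gordon type arguments: the trace of a power and of its square cannot both
  be small, since \<open>cheb_t t (2 k) = (cheb_t t k)\<^sup>2 - 2\<close>.\<close>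

lemma cheb_t_ge1_or_double: "norm (cheb_t t k) \<ge> 1 \<or> norm (cheb_t t (2 * k)) \<ge> 1"
proof (rule disjCI)
  assume "\<not> 1 \<le> norm (cheb_t t (2 * k))"
  then have "norm ((cheb_t t k)\<^sup>2 - 2) < 1" by (simp add: cheb_t_double)
  moreover have "norm (2::complex) \<le> norm ((cheb_t t k)\<^sup>2) + norm ((cheb_t t k)\<^sup>2 - 2)"
    by (metis add_diff_cancel_left' diff_add_cancel norm_minus_commute norm_triangle_sub)
  ultimately have "norm (cheb_t t k) ^ 2 > 1" by (simp add: norm_power)
  then show "1 \<le> norm (cheb_t t k)"
    by (metis norm_ge_zero linorder_not_less one_less_power order_less_imp_le power2_eq_square abs_norm_cancel abs_square_le_1 less_imp_le)
qed

lemma cheb_t_almost_mono: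
  assumes "i \<le> k" shows "norm (cheb_t t i) \<le> norm (cheb_t t k) + 2"
proof -
  obtain x where x: "x \<noteq> 0" "t = x + inverse x" "norm x \<ge> 1" using joukowski_root by metis
  have inv: "norm (inverse x ^ m) \<le> 1" for m
    using x(3) by (simp add: norm_power norm_inverse power_le_one inverse_le_1_iff)
  have "norm (cheb_t t i) \<le> norm (x ^ i) + 1"
    unfolding x(2) cheb_t_joukowski[OF x(1)] using inv[of i] norm_triangle_ineq[of "x^i" "inverse x ^ i"] by linarith
  also have "norm (x ^ i) \<le> norm (x ^ k)" using assms x(3) by (simp add: norm_power power_increasing)
  also have "norm (x ^ k) \<le> norm (cheb_t t k) + 1"
    unfolding x(2) cheb_t_joukowski[OF x(1)] using inv[of k] norm_diff_ineq[of "x^k" "inverse x ^ k"] by linarith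
  finally show ?thesis by simp
qed

lemma cheb_half_step:
  "cheb_u t (Suc k) = t / 2 * cheb_u t k + cheb_t t k / 2 \<and>
   cheb_t t (Suc k) = t / 2 * cheb_t t k + (t\<^sup>2 - 4) / 2 * cheb_u t k"
proof (induction k)
  case 0 then show ?case by (simp add: power2_eq_square)
next
  case (Suc k)
  note u = conjunct1[OF Suc] and t = conjunct2[OF Suc]
  show ?case
    unfolding three_term.simps(3) u t by (simp add: field_simps power2_eq_square)
qed

text \<open>Used away from the band edges: the powers of the transfer matrix are no larger than the
  trace times \<open>d\<^sup>-\<^sup>1\<^sup>/\<^sup>2\<close>, for elliptic as well as for hyperbolic \<open>t\<close>.\<close>

lemma cheb_u_hyperbolic_bound:
  assumes d: "norm (t\<^sup>2 - 4) \<ge> d" "d > 0" and i: "i \<le> k" and k: "norm (cheb_t t k) \<ge> 1"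
  shows "norm (cheb_u t i) \<le> 5 / sqrt d * norm (cheb_t t k)"
proof -
  define T where "T = norm (cheb_t t k)"
  have "norm (cheb_t t i) \<le> 3 * T" using cheb_t_almost_mono[OF i, of t] k unfolding T_def by linarith
  then have "norm (cheb_t t i) ^ 2 \<le> (3 * T) ^ 2" by (intro power_mono) auto
  moreover have "norm ((cheb_t t i)\<^sup>2 - 4) \<le> norm (cheb_t t i) ^ 2 + 4"
    using norm_triangle_ineq4[of "(cheb_t t i)\<^sup>2" 4] by (simp add: norm_power)
  moreover have "T ^ 2 \<ge> 1" using k unfolding T_def by (simp add: one_le_power)
  ultimately have 1: "norm ((cheb_t t i)\<^sup>2 - 4) \<le> 25 * T^2" by (simp add: power_mult_distrib)
  have "norm (cheb_u t i) ^ 2 * d \<le> norm (cheb_u t i) ^ 2 * norm (t\<^sup>2 - 4)"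
    using d by (intro mult_left_mono) auto
  also have "\<dots> = norm ((cheb_t t i)\<^sup>2 - 4)"
    using cheb_pell[of t i] by (metis norm_mult norm_power)
  finally have "norm (cheb_u t i) ^ 2 \<le> 25 * T^2 / d" using 1 d(2) by (simp add: field_simps)
  also have "\<dots> = (5 / sqrt d * T) ^ 2" using d(2) by (simp add: power_mult_distrib power_divide)
  finally show ?thesis unfolding T_def[symmetric]
    by (rule power2_le_imp_le) (use d k T_def in auto)
qed

text \<open>Used close to a band edge: as long as \<open>n\<^sup>2 d\<close> stays small, the powers grow no faster than in
  the parabolic case \<open>t = 2\<close>, where \<open>cheb_u t i = i\<close>.\<close>

lemma cheb_u_parabolic_bound:
  assumes d: "norm (t\<^sup>2 - 4) \<le> d" "real n ^ 2 * d \<le> 1 / 4" and i: "i \<le> n"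
  shows "norm (cheb_u t i) \<le> 2 * real i"
  using i
proof (induction i)
  case 0 then show ?case by simp
next
  case (Suc i)
  have d0: "d \<ge> 0" using d(1) norm_ge_zero order_trans by blast
  have IH: "norm (cheb_u t i) \<le> 2 * real i" using Suc by simp
  have id: "real (Suc i) ^ 2 * d \<le> 1 / 4"
    using Suc.prems d(2) d0 by (meson mult_right_mono of_nat_0_le_iff of_nat_mono order_trans power_mono)
  have "real i ^ 2 * d \<le> real (Suc i) ^ 2 * d" using d0 by (intro mult_right_mono power_mono) auto
  then have i2: "real i ^ 2 * d \<le> 1/4" using id by linarith
  have "real i \<le> real (Suc i) ^ 2" "1 \<le> real (Suc i) ^ 2" by (auto simp: power2_eq_square field_simps)
  then have "real i * d \<le> real (Suc i) ^ 2 * d" "1 * d \<le> real (Suc i) ^ 2 * d" using d0 by (meson mult_right_mono)+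
  then have i1: "real i * d \<le> 1/4" and d14: "d \<le> 1/4" using id by linarith+
  have "norm (cheb_t t i) ^ 2 = norm (4 + (cheb_u t i)\<^sup>2 * (t\<^sup>2 - 4))"
    unfolding cheb_pell by (simp add: norm_power)
  also have "\<dots> \<le> 4 + norm (cheb_u t i) ^ 2 * norm (t\<^sup>2 - 4)"
    by (rule order_trans[OF norm_triangle_ineq]) (simp add: norm_mult norm_power)
  also have "\<dots> \<le> 4 + (2 * real i) ^ 2 * d"
    using IH d by (intro add_left_mono mult_mono power_mono) auto
  also have "\<dots> \<le> 5" using i2 by (simp add: power_mult_distrib)
  also have "\<dots> \<le> (9/4::real) ^ 2" by (simp add: power2_eq_square)
  finally have T: "norm (cheb_t t i) \<le> 9/4" by (rule power2_le_imp_le) simp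
  have "norm t ^ 2 = norm (4 + (t\<^sup>2 - 4))" by (simp add: norm_power)
  also have "\<dots> \<le> 4 + d" by (rule order_trans[OF norm_triangle_ineq]) (use d in simp)
  also have "\<dots> \<le> (2 + d) ^ 2" using d0 by (simp add: power2_eq_square algebra_simps)
  finally have t: "norm t \<le> 2 + d" by (rule power2_le_imp_le) (use d0 in simp)
  have "norm (cheb_u t (Suc i)) \<le> norm t / 2 * norm (cheb_u t i) + norm (cheb_t t i) / 2"
    using cheb_half_step[of t i]
    by (metis (no_types, lifting) norm_divide norm_mult norm_numeral norm_triangle_ineq)
  also have "\<dots> \<le> (2 + d) / 2 * (2 * real i) + (9/4) / 2"
    using t T IH d0 by (intro add_mono mult_mono divide_right_mono) auto
  also have "\<dots> = 2 * real i + real i * d + 9/8" by (simp add: field_simps)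
  also have "\<dots> \<le> 2 * real (Suc i)" using i1 by simp
  finally show ?case .
qed

lemma period_recurrence_iterate:
  assumes rec: "\<And>n. w (n + p) + w (n - p) = t * w n"
  shows "w (n + int (Suc k) * p) = cheb_u t (Suc k) * w (n + p) - cheb_u t k * w n"
    and "w (n + int k * p) + w (n - int k * p) = cheb_t t k * w (n::int)"
proof -
  show "w (n + int (Suc k) * p) = cheb_u t (Suc k) * w (n + p) - cheb_u t k * w n"
  proof (induction k rule: induct_nat_012)
    case 1 show ?case using rec[of "n + p"] by (simp add: algebra_simps)
  next
    case (ge2 k)
    have "w (n + int (Suc (Suc (Suc k))) * p) = t * w (n + int (Suc (Suc k)) * p) - w (n + int (Suc k) * p)"
      using rec[of "n + int (Suc (Suc k)) * p"] by (simp add: algebra_simps)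
    then show ?case unfolding ge2 by (simp add: algebra_simps)
  qed simp
  show "w (n + int k * p) + w (n - int k * p) = cheb_t t k * w n"
  proof (induction k rule: induct_nat_012)
    case (ge2 k)
    have "w (n + int (Suc (Suc k)) * p) = t * w (n + int (Suc k) * p) - w (n + int k * p)"
      using rec[of "n + int (Suc k) * p"] by (simp add: algebra_simps)
    moreover have "w (n - int (Suc (Suc k)) * p) = t * w (n - int (Suc k) * p) - w (n - int k * p)"
      using rec[of "n - int (Suc k) * p"] by (simp add: algebra_simps)
    ultimately have "w (n + int (Suc (Suc k)) * p) + w (n - int (Suc (Suc k)) * p)
       = t * (w (n + int (Suc k) * p) + w (n - int (Suc k) * p)) - (w (n + int k * p) + w (n - int k * p))"
      by (simp add: algebra_simps)
    then show ?case unfolding ge2 by (simp add: algebra_simps)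
  qed (use rec in auto)
qed

section \<open>The discriminant as a function of the energy\<close>

lemma fundamental_bound:
  assumes D: "\<And>n. norm (z - of_real (W n)) + 1 \<le> D"
  shows "norm (fundamental W z l k) \<le> D ^ k"
proof (induction k rule: induct_nat_012)
  case 0 show ?case by simp
next
  case 1 show ?case using D[of 0] norm_ge_zero[of "z - of_real (W 0)"] by (simp del: norm_ge_zero)
next
  case (ge2 k)
  have D1: "D \<ge> 1" using D[of 0] norm_ge_zero[of "z - of_real (W 0)"] by linarith
  have "norm (fundamental W z l (Suc (Suc k))) \<le>
      norm (z - of_real (W (l + 1 + int k))) * norm (fundamental W z l (Suc k)) + norm (fundamental W z l k)"
    unfolding fundamental_simps by (rule order_trans[OF norm_triangle_ineq4]) (simp add: norm_mult)
  also have "\<dots> \<le> (D - 1) * D ^ Suc k + D ^ k"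
    using D[of "l + 1 + int k"] ge2 D1 by (intro add_mono mult_mono) auto
  also have "\<dots> \<le> D ^ Suc (Suc k)"
    using D1 power_increasing[of k "Suc k" D] by (simp add: algebra_simps)
  finally show ?case .
qed

lemma fundamental_lipschitz:
  assumes D: "\<And>n. norm (z - of_real (W n)) + 2 \<le> D" "\<And>n. norm (z' - of_real (W n)) + 2 \<le> D"
  shows "norm (fundamental W z l k - fundamental W z' l k) \<le> norm (z - z') * D ^ k"
proof (induction k rule: induct_nat_012)
  case 0 show ?case by simp
next
  case 1
  have "D \<ge> 0" using D(1)[of 0] norm_ge_zero[of "z - of_real (W 0)"] by linarith
  then show ?case by simp
next
  case (ge2 k)
  define a where "a = z - of_real (W (l + 1 + int k))"
  have D2: "D \<ge> 2" using D(1)[of 0] norm_ge_zero[of "z - of_real (W 0)"] by linarith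
  have D1': "norm (z' - of_real (W n)) + 1 \<le> D" for n using D(2)[of n] by simp
  have tri: "norm (A * B + C * E - F) \<le> norm A * norm B + norm C * norm E + norm F" for A B C E F :: complex
    using norm_triangle_ineq4[of "A * B + C * E" F] norm_triangle_ineq[of "A * B" "C * E"]
    by (simp add: norm_mult)
  have "fundamental W z l (Suc (Suc k)) - fundamental W z' l (Suc (Suc k)) =
     a * (fundamental W z l (Suc k) - fundamental W z' l (Suc k)) + (z - z') * fundamental W z' l (Suc k)
     - (fundamental W z l k - fundamental W z' l k)"
    by (simp add: a_def algebra_simps)
  then have "norm (fundamental W z l (Suc (Suc k)) - fundamental W z' l (Suc (Suc k))) \<le>
     norm a * norm (fundamental W z l (Suc k) - fundamental W z' l (Suc k)) + norm (z - z') * norm (fundamental W z' l (Suc k))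
     + norm (fundamental W z l k - fundamental W z' l k)"
    using tri by metis
  also have "\<dots> \<le> (D - 2) * (norm (z - z') * D ^ Suc k) + norm (z - z') * D ^ Suc k + norm (z - z') * D ^ k"
    using D(1)[of "l + 1 + int k"] ge2 D2 fundamental_bound[where W = W and l = l and k = "Suc k", OF D1']
    by (intro add_mono mult_mono mult_left_mono) (auto simp: a_def)
  also have "\<dots> = norm (z - z') * (D ^ Suc (Suc k) - D ^ Suc k + D ^ k)"
    by (simp add: algebra_simps)
  also have "\<dots> \<le> norm (z - z') * D ^ Suc (Suc k)"
    using D2 power_increasing[of k "Suc k" D] by (intro mult_left_mono) auto
  finally show ?case .
qed

lemma discriminant_bound:
  assumes D: "\<And>n. norm (z - of_real (W n)) + 2 \<le> D" and q: "q > 0"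
  shows "norm (discriminant W q z) \<le> 2 * D ^ (2 * q)"
proof -
  have D2: "D \<ge> 1" using D[of 0] norm_ge_zero[of "z - of_real (W 0)"] by linarith
  have D': "norm (z - of_real (W n)) + 1 \<le> D" for n using D[of n] by simp
  have "norm (fundamental W z l k) \<le> D ^ (2 * q)" if "k \<le> 2 * q" for l k
    using fundamental_bound[where W = W and l = l and k = k, OF D'] power_increasing[OF that D2] by linarith
  from this[of "Suc q" 0] this[of "q - 1" 1] q
  have "norm (fundamental W z 0 (Suc q)) \<le> D ^ (2 * q)" "norm (fundamental W z 1 (q - 1)) \<le> D ^ (2 * q)" by auto
  then show ?thesis
    unfolding discriminant_def
    using norm_triangle_ineq4[of "fundamental W z 0 (Suc q)" "fundamental W z 1 (q - 1)"] by linarith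
qed

lemma discriminant_square_lipschitz:
  assumes D: "\<And>n. norm (z - of_real (W n)) + 2 \<le> D" "\<And>n. norm (z' - of_real (W n)) + 2 \<le> D"
    and q: "q > 0"
  shows "norm ((discriminant W q z)\<^sup>2 - (discriminant W q z')\<^sup>2) \<le> 8 * norm (z - z') * (D ^ (2 * q))\<^sup>2"
proof -
  define L where "L = D ^ (2 * q)"
  have D2: "D \<ge> 1" using D(1)[of 0] norm_ge_zero[of "z - of_real (W 0)"] by linarith
  have "norm (fundamental W z l k - fundamental W z' l k) \<le> norm (z - z') * L" if "k \<le> 2 * q" for l k
    using fundamental_lipschitz[where W = W and l = l and k = k, OF D] mult_left_mono[OF power_increasing[OF that D2], of "norm (z - z')"]
    unfolding L_def by simp
  from this[of "Suc q" 0] this[of "q - 1" 1] q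
  have *: "norm (fundamental W z 0 (Suc q) - fundamental W z' 0 (Suc q)) \<le> norm (z - z') * L"
     "norm (fundamental W z 1 (q - 1) - fundamental W z' 1 (q - 1)) \<le> norm (z - z') * L" by auto
  have "discriminant W q z - discriminant W q z' =
    (fundamental W z 0 (Suc q) - fundamental W z' 0 (Suc q)) - (fundamental W z 1 (q - 1) - fundamental W z' 1 (q - 1))"
    by (simp add: discriminant_def del: fundamental_simps)
  then have d: "norm (discriminant W q z - discriminant W q z') \<le> 2 * norm (z - z') * L"
    using * norm_triangle_ineq4[of "fundamental W z 0 (Suc q) - fundamental W z' 0 (Suc q)" "fundamental W z 1 (q - 1) - fundamental W z' 1 (q - 1)"]
    by simp
  have s: "norm (discriminant W q z + discriminant W q z') \<le> 4 * L"
    using discriminant_bound[where W = W, OF D(1) q] discriminant_bound[where W = W, OF D(2) q] norm_triangle_ineq[of "discriminant W q z" "discriminant W q z'"]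
    unfolding L_def by simp
  have "(discriminant W q z)\<^sup>2 - (discriminant W q z')\<^sup>2 = (discriminant W q z - discriminant W q z') * (discriminant W q z + discriminant W q z')"
    by (simp add: power2_eq_square algebra_simps)
  then have "norm ((discriminant W q z)\<^sup>2 - (discriminant W q z')\<^sup>2) \<le> (2 * norm (z - z') * L) * (4 * L)"
    using mult_mono[OF d s order_trans[OF norm_ge_zero d] norm_ge_zero] by (simp only: norm_mult)
  then show ?thesis unfolding L_def by (simp add: power2_eq_square mult.assoc mult.left_commute mult.commute)
qed

lemma poly_three_term:
  "poly (three_term c a b k) x = three_term (\<lambda>k. poly (c k) x) (poly a x) (poly b x) k"
  by (induction k rule: induct_nat_012) auto

lemma three_term_monic:
  fixes v :: "nat \<Rightarrow> 'a::{idom}"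
  defines "p \<equiv> three_term (\<lambda>k. [:v k, 1:]) 0 1"
  shows "degree (p (Suc k)) = k \<and> coeff (p (Suc k)) k = 1"
proof (induction k rule: induct_nat_012)
  case 0 show ?case by (simp add: p_def)
next
  case 1 show ?case by (simp add: p_def)
next
  case (ge2 k)
  have nz: "p (Suc (Suc k)) \<noteq> 0" using ge2 by auto
  have e: "p (Suc (Suc (Suc k))) = [:v (Suc k), 1:] * p (Suc (Suc k)) + - p (Suc k)" by (simp add: p_def)
  have d: "degree ([:v (Suc k), 1:] * p (Suc (Suc k))) = Suc (Suc k)"
    using ge2 nz by (subst degree_mult_eq) auto
  have l: "lead_coeff ([:v (Suc k), 1:] * p (Suc (Suc k))) = 1"
    unfolding lead_coeff_mult using ge2 by simp
  have lt: "degree (- p (Suc k)) < degree ([:v (Suc k), 1:] * p (Suc (Suc k)))"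
    unfolding d using ge2 by simp
  show ?case unfolding e degree_add_eq_left[OF lt] d
    using l lt unfolding d by (simp add: coeff_eq_0)
qed

text \<open>At a zero of the trace \<open>t\<close> every solution satisfies \<open>w(n + 2 q) = - w(n)\<close>. Hence the current
  \<open>Im (cnj (w n) w(n + 1))\<close> is \<open>2 q\<close>-periodic, whereas its increment at each site is
  \<open>Im z \<bar>w\<bar>\<^sup>2\<close>.\<close>

lemma discriminant_zero_real:
  assumes per: "\<And>n. W (n + int q) = W n" and q: "q > 0" and z: "discriminant W q z = 0"
  shows "Im z = 0"
proof -
  obtain w where w: "solves W z w" "w 0 = 0" "w (0 + 1) = 1" using solution_exists by blast
  have anti: "w (n + 2 * int q) = - w n" for n
    using solution_period_recurrence[OF per q w(1), of "n + int q"] z by (simp add: add_eq_0_iff algebra_simps)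
  define j where "j n = Im (cnj (w n) * w (n + 1))" for n
  have jd: "j (int k + 1) - j (int k) = Im z * (norm (w (int k + 1)))\<^sup>2" for k
  proof -
    let ?n = "int k + 1"
    have "cnj (w ?n) * w (?n + 1) = (z - of_real (W ?n)) * (w ?n * cnj (w ?n)) - cnj (w ?n) * w (int k)"
      unfolding solves_step[OF w(1), of ?n] by (simp add: algebra_simps)
    then have "j ?n = Im ((z - of_real (W ?n)) * of_real ((norm (w ?n))\<^sup>2)) - Im (cnj (w ?n) * w (int k))"
      unfolding j_def by (simp only: complex_norm_square minus_complex.sel)
    then show ?thesis by (simp add: j_def algebra_simps)
  qed
  have "(\<Sum>k<2 * q. j (int (Suc k)) - j (int k)) = j (int (2 * q)) - j 0"
    using sum_lessThan_telescope[of "\<lambda>k. j (int k)" "2 * q"] by simp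
  also have "j (int (2 * q)) = j 0"
    using anti[of 0] anti[of 1] by (simp add: j_def algebra_simps)
  finally have "Im z * (\<Sum>k<2 * q. (norm (w (int k + 1)))\<^sup>2) = 0"
    using jd by (simp add: sum_distrib_left add.commute)
  moreover have "(\<Sum>k<2 * q. (norm (w (int k + 1)))\<^sup>2) > 0"
    by (rule sum_pos2[of _ 0]) (use q w in auto)
  ultimately show ?thesis by simp
qed

lemma discriminant_factorization:
  assumes per: "\<And>n. W (n + int q) = W n" and q: "q > 0"
  obtains r :: "nat \<Rightarrow> real" where "\<And>z. discriminant W q z = (\<Prod>i<q. z - of_real (r i))"
proof -
  define F :: "int \<Rightarrow> nat \<Rightarrow> complex poly"
    where "F l = three_term (\<lambda>k. [:- of_real (W (l + 1 + int k)), 1:]) 0 1" for l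
  define p where "p = F 0 (Suc q) + - F 1 (q - 1)"
  have F: "poly (F l k) z = fundamental W z l k" for l k z
    unfolding F_def fundamental_def poly_three_term by simp
  have pz: "poly p z = discriminant W q z" for z
    by (simp add: p_def discriminant_def F del: fundamental_simps)
  have a: "degree (F l (Suc k)) = k \<and> coeff (F l (Suc k)) k = 1" for l k
    unfolding F_def by (rule three_term_monic)
  have "degree (- F 1 (q - 1)) < q"
    using q a[of 1] by (cases "q - 1") (auto simp: F_def)
  then have lt: "degree (- F 1 (q - 1)) < degree (F 0 (Suc q))" using a by simp
  have deg: "degree p = q" unfolding p_def degree_add_eq_left[OF lt] using a by blast
  have lc: "lead_coeff p = 1" unfolding deg unfolding p_def using a[of 0 q] lt by (simp add: coeff_eq_0)
  obtain root where root: "smult (lead_coeff p) (\<Prod>i<degree p. [:-root i, 1:]) = p"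
    using complex_poly_decompose' by blast
  have prod: "discriminant W q z = (\<Prod>i<q. z - root i)" for z
    using root unfolding deg pz[symmetric] using lc[unfolded deg] by (auto simp: poly_prod dest!: arg_cong[where f = "\<lambda>p. poly p z"])
  have "Im (root i) = 0" if "i < q" for i
    by (rule discriminant_zero_real[where W = W, OF per q]) (use that in \<open>auto simp: prod\<close>)
  then have "root i = of_real (Re (root i))" if "i < q" for i
    using that by (simp add: complex_eq_iff)
  then show ?thesis using that[of "\<lambda>i. Re (root i)"] prod by simp
qed

section \<open>Perturbed solutions in a window of many periods\<close>

lemma variation_of_constants:
  assumes r0: "r b = 0" "r (b - 1) = 0"
    and eq: "\<And>n. schrodinger W r n - z * r n = h n"
  shows "r (b + int m) = (\<Sum>i<m. fundamental W z (b + int i) (m - i) * h (b + int i))"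
proof (induction m rule: induct_nat_012)
  case 0 show ?case using r0 by simp
next
  case 1 show ?case using r0 eq[of b] by (simp add: schrodinger_def)
next
  case (ge2 m)
  let ?f = "\<lambda>i m. fundamental W z (b + int i) m" and ?w = "z - of_real (W (b + int (Suc m)))"
  have "r (b + int (Suc (Suc m))) = ?w * r (b + int (Suc m)) - r (b + int m) + h (b + int (Suc m))"
    using eq[of "b + int (Suc m)"] by (simp add: schrodinger_def algebra_simps)
  also have "r (b + int m) = (\<Sum>i<Suc m. ?f i (m - i) * h (b + int i))"
    unfolding ge2 by simp
  also have "?w * r (b + int (Suc m)) = (\<Sum>i<Suc m. ?w * ?f i (Suc m - i) * h (b + int i))"
    unfolding ge2 sum_distrib_left by (simp add: mult.assoc)
  also have "(\<Sum>i<Suc m. ?w * ?f i (Suc m - i) * h (b + int i)) - (\<Sum>i<Suc m. ?f i (m - i) * h (b + int i))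
     = (\<Sum>i<Suc m. ?f i (Suc (Suc m) - i) * h (b + int i))"
    unfolding sum_subtractf[symmetric]
  proof (rule sum.cong[OF refl])
    fix i assume "i \<in> {..<Suc m}"
    then obtain d where d: "m = i + d" using le_Suc_ex[of i m] by auto
    have "Suc m - i = Suc d" "m - i = d" "Suc (Suc m) - i = Suc (Suc d)" using d by auto
    then show "?w * ?f i (Suc m - i) * h (b + int i) - ?f i (m - i) * h (b + int i)
       = ?f i (Suc (Suc m) - i) * h (b + int i)"
      by (simp add: d algebra_simps)
  qed
  finally show ?case by simp
qed

lemma fundamental_solution:
  obtains v where "solves W z v" "\<And>m. v (l + int m) = fundamental W z l m"
proof -
  obtain v where v: "solves W z v" "v l = 0" "v (l + 1) = 1" using solution_exists by blast
  have "v (l + int m) = fundamental W z l m" for m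
    using solves_fundamental_expand[OF v(1), of l "m - 1"] v by (cases m) (auto simp: algebra_simps)
  then show ?thesis using that v(1) by blast
qed

text \<open>Since the kernel vanishes at its base point, after \<open>k\<close> whole periods it is exactly
  \<open>cheb_u t k\<close> times its value after one period; at all other sites two such terms occur.\<close>

lemma fundamental_over_periods:
  assumes rec: "\<And>v n. solves W z v \<Longrightarrow> v (n + int q) + v (n - int q) = t * v n" and q: "q > 0"
    and D: "\<And>n. norm (z - of_real (W n)) + 1 \<le> D"
    and Y: "\<And>i. i \<le> k \<Longrightarrow> norm (cheb_u t i) \<le> Y" and k: "k \<ge> 1"
  shows "norm (fundamental W z l (k * q)) \<le> Y * D ^ (2 * q)"
    and "m \<le> k * q \<Longrightarrow> norm (fundamental W z l m) \<le> 2 * Y * D ^ (2 * q)"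
proof -
  define L where "L = D ^ (2 * q)"
  obtain v where v: "solves W z v" "\<And>m. v (l + int m) = fundamental W z l m"
    using fundamental_solution[where W = W and z = z and l = l] by blast
  have D1: "D \<ge> 1" using D[of 0] norm_ge_zero[of "z - of_real (W 0)"] by linarith
  have L1: "L \<ge> 1" using D1 by (simp add: L_def one_le_power)
  have short: "norm (fundamental W z l i) \<le> L" if "i \<le> 2 * q" for i
    using fundamental_bound[where W = W and l = l and k = i, OF D] power_increasing[OF that D1] by (simp add: L_def)
  have Y1: "Y \<ge> 1" using Y[of 1] k by simp
  have step: "fundamental W z l (i + Suc j * q) = cheb_u t (Suc j) * fundamental W z l (i + q) - cheb_u t j * fundamental W z l i" for i j
    using period_recurrence_iterate(1)[where w = v and p = "int q" and t = t and n = "l + int i" and k = j, OF rec[OF v(1)]]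
      v(2)[of "i + Suc j * q"] v(2)[of "i + q"] v(2)[of i]
    by (simp only: of_nat_add of_nat_mult add.assoc)
  obtain k' where k': "k = Suc k'" using k by (cases k) auto
  have "fundamental W z l (k * q) = cheb_u t k * fundamental W z l q"
    using step[of 0 k'] unfolding k' by simp
  then show "norm (fundamental W z l (k * q)) \<le> Y * D ^ (2 * q)"
    using Y[of k] short[of q] Y1 by (simp add: norm_mult L_def mult_mono)
  assume m: "m \<le> k * q"
  show "norm (fundamental W z l m) \<le> 2 * Y * D ^ (2 * q)"
  proof (cases "m div q")
    case 0
    then have "m < q" using q by (simp add: div_eq_0_iff)
    then have "norm (fundamental W z l m) \<le> 1 * L" using short[of m] by simp
    also have "\<dots> \<le> 2 * Y * L" using Y1 L1 by (intro mult_right_mono) auto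
    finally show ?thesis by (simp add: L_def)
  next
    case (Suc j)
    have m': "m = m mod q + Suc j * q" using Suc by (metis mod_div_mult_eq)
    have "Suc j \<le> k" using m Suc q by (metis div_le_mono nonzero_mult_div_cancel_right not_gr0 order_less_irrefl)
    then have "norm (cheb_u t (Suc j)) \<le> Y" "norm (cheb_u t j) \<le> Y" using Y by auto
    moreover have "norm (fundamental W z l (m mod q + q)) \<le> L" "norm (fundamental W z l (m mod q)) \<le> L"
      using q mod_less_divisor[OF q, of m] by (intro short; simp)+
    ultimately have "norm (cheb_u t (Suc j) * fundamental W z l (m mod q + q)) \<le> Y * L"
      "norm (cheb_u t j * fundamental W z l (m mod q)) \<le> Y * L"
      using Y1 by (auto simp: norm_mult simp del: three_term.simps intro!: mult_mono)
    then have "norm (fundamental W z l m) \<le> Y * L + Y * L"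
      by (subst m', unfold step) (rule order_trans[OF norm_triangle_ineq4 add_mono])
    then show ?thesis by (simp add: L_def)
  qed
qed

text \<open>Let \<open>w\<close> be the exact two-sided solution with the data of \<open>\<phi>\<close> at \<open>j\<close> and \<open>j + 1\<close>. Then
  \<open>w(j + k q) + w(j - k q) = cheb_t t k \<phi>(j)\<close>. To the right, \<open>\<phi>\<close> differs from \<open>w\<close> only through small
  sources; to the left, through these and the unit source at \<open>j\<close>, which contributes at most
  \<open>Y D\<^sup>2\<^sup>q\<close> times the trace. If \<open>\<phi>(j)\<close> is large compared with \<open>Y D\<^sup>2\<^sup>q\<close>, the unit source is negligible,
  and \<open>\<phi>\<close> behaves like a two-sided solution, which cannot decay in both directions.\<close>

lemma two_sided_value_lower_bound:
  assumes per: "\<And>n. W (n + int q) = W n" and q: "q > 0" and t: "t = discriminant W q z"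
    and D: "\<And>n. norm (z - of_real (W n)) + 1 \<le> D"
    and k: "k \<ge> 1" and T1: "norm (cheb_t t k) \<ge> 1"
    and Y: "\<And>i. i \<le> k \<Longrightarrow> norm (cheb_u t i) \<le> Y * norm (cheb_t t k)"
    and src: "\<And>n. \<bar>n - j\<bar> \<le> int (k * q) \<Longrightarrow>
       norm (schrodinger W \<phi> n - z * \<phi> n - (if n = j then 1 else 0)) \<le> \<kappa>"
    and kap: "4 * real k * real q * \<kappa> \<le> 1"
    and X: "norm (\<phi> j) \<ge> 4 * Y * D ^ (2 * q)"
  shows "norm (\<phi> (j + int k * int q)) + norm (\<phi> (j - int k * int q)) \<ge> norm (\<phi> j) / 2"
proof -
  define T where "T = norm (cheb_t t k)"
  define L where "L = D ^ (2 * q)"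
  define M where "M = 2 * (Y * T) * L"
  obtain w where w: "solves W z w" "w j = \<phi> j" "w (j + 1) = \<phi> (j + 1)" using solution_exists by blast
  define r where "r n = \<phi> n - w n" for n
  define h where "h n = schrodinger W \<phi> n - z * \<phi> n" for n
  have req: "schrodinger W r n - z * r n = h n" for n
    using w(1)[unfolded solves_def, rule_format, of n] by (simp add: h_def r_def schrodinger_def algebra_simps)
  have req': "schrodinger (\<lambda>n. W (- n)) (\<lambda>n. r (- n)) n - z * r (- n) = h (- n)" for n
    using req[of "- n"] by (simp add: schrodinger_def algebra_simps minus_diff_commute)
  have kap0: "\<kappa> \<ge> 0" using order_trans[OF norm_ge_zero src[of j]] by simp
  have rec: "v (n + int q) + v (n - int q) = t * v n" if "solves W z v" for v n
    using solution_period_recurrence[OF per q that] t by simp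
  have rec': "v (n + int q) + v (n - int q) = t * v n" if "solves (\<lambda>n. W (- n)) z v" for v n
    using rec[of "\<lambda>n. v (- n)" "- n"] solves_reflect[OF that] by (simp add: algebra_simps)
  have Yk: "norm (cheb_u t i) \<le> Y * T" if "i \<le> k" for i using Y[OF that] by (simp add: T_def)
  note f1 = fundamental_over_periods[OF rec q D Yk k, folded L_def, folded M_def]
  note f2 = fundamental_over_periods[where W = "\<lambda>n. W (- n)", OF rec' q D Yk k, folded L_def, folded M_def]
  have D1: "D \<ge> 1" using D[of 0] norm_ge_zero[of "z - of_real (W 0)"] by linarith
  have L1: "L \<ge> 1" using D1 by (simp add: L_def one_le_power)
  have YT: "Y * T \<ge> 1" using Yk[of 1] k by simp
  have M0: "M \<ge> 0" using YT L1 by (simp add: M_def)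
  have kq: "k * q \<ge> 1" using k q by simp
  define m where "m = k * q - 1"
  have km: "k * q = Suc m" using kq by (simp add: m_def)
  have right: "norm (r (j + int (k * q))) \<le> real (k * q) * (M * \<kappa>)"
  proof -
    have "r (j + int (k * q)) = r ((j + 1) + int m)" unfolding km by (simp add: add.assoc)
    also have "\<dots> = (\<Sum>i<m. fundamental W z (j + 1 + int i) (m - i) * h (j + 1 + int i))"
      by (rule variation_of_constants[OF _ _ req]) (use w in \<open>auto simp: r_def\<close>)
    finally have e: "r (j + int (k * q)) = \<dots>" .
    have "norm (r (j + int (k * q))) \<le> (\<Sum>i<m. M * \<kappa>)"
      unfolding e
    proof (rule sum_norm_le)
      fix i assume i: "i \<in> {..<m}"
      have "norm (fundamental W z (j + 1 + int i) (m - i)) \<le> M" by (rule f1(2)) (use km in auto)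
      moreover have "norm (h (j + 1 + int i)) \<le> \<kappa>"
        using src[of "j + 1 + int i"] i km by (simp add: h_def)
      ultimately show "norm (fundamental W z (j + 1 + int i) (m - i) * h (j + 1 + int i)) \<le> M * \<kappa>"
        unfolding norm_mult using M0 by (intro mult_mono) auto
    qed
    also have "\<dots> \<le> real (k * q) * (M * \<kappa>)" using M0 kap0 km by (simp add: mult_right_mono)
    finally show ?thesis .
  qed
  \<comment> \<open>After reflection the expansion starts one site earlier, and its term \<open>i = 0\<close> carries the unit source.\<close>
  have left: "norm (r (j - int (k * q))) \<le> Y * T * L + real (k * q) * (M * \<kappa>)"
  proof -
    define f where "f i = fundamental (\<lambda>n. W (- n)) z (- j + int i) (k * q - i)" for i
    have "r (j - int (k * q)) = (\<lambda>n. r (- n)) (- j + int (k * q))" by simp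
    also have "\<dots> = (\<Sum>i<k * q. f i * h (- (- j + int i)))"
      unfolding f_def
      by (rule variation_of_constants[where r = "\<lambda>n. r (- n)" and h = "\<lambda>n. h (- n)", OF _ _ req']) (use w in \<open>auto simp: r_def add.commute\<close>)
    also have "\<dots> = f 0 * 1 + (\<Sum>i<k * q. f i * (h (- (- j + int i)) - (if i = 0 then 1 else 0)))"
    proof -
      have "(\<Sum>i<k * q. f i * (if i = 0 then 1 else 0)) = f 0" using kq by (simp add: if_distrib cong: if_cong)
      then show ?thesis by (simp only: right_diff_distrib sum_subtractf) simp
    qed
    finally have e: "r (j - int (k * q)) = \<dots>" .
    have "norm (\<Sum>i<k * q. f i * (h (- (- j + int i)) - (if i = 0 then 1 else 0))) \<le> (\<Sum>i<k * q. M * \<kappa>)"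
    proof (rule sum_norm_le)
      fix i assume i: "i \<in> {..<k * q}"
      have "norm (f i) \<le> M" unfolding f_def by (rule f2(2)) auto
      moreover have "norm (h (- (- j + int i)) - (if i = 0 then 1 else 0)) \<le> \<kappa>"
        using src[of "j - int i"] i by (simp add: h_def del: of_nat_mult)
      ultimately show "norm (f i * (h (- (- j + int i)) - (if i = 0 then 1 else 0))) \<le> M * \<kappa>"
        unfolding norm_mult using M0 by (intro mult_mono) auto
    qed
    moreover have "norm (f 0 * 1) \<le> Y * T * L" unfolding f_def using f2(1)[of "- j"] by simp
    ultimately show ?thesis unfolding e using norm_triangle_mono by fastforce
  qed
  have "real (k * q) * (M * \<kappa>) * 2 = (4 * real k * real q * \<kappa>) * (Y * T * L)"
    by (simp add: M_def)
  also have "\<dots> \<le> 1 * (Y * T * L)" using kap YT L1 by (intro mult_right_mono) auto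
  finally have err: "norm (r (j + int (k * q))) + norm (r (j - int (k * q))) \<le> 2 * (Y * T * L)"
    using left right by linarith
  have "w (j + int k * int q) + w (j - int k * int q) = cheb_t t k * \<phi> j"
    using period_recurrence_iterate(2)[where w = w and p = "int q" and t = t, OF rec[OF w(1)]] w(2) by simp
  then have "cheb_t t k * \<phi> j = (\<phi> (j + int k * int q) + \<phi> (j - int k * int q)) - (r (j + int (k * q)) + r (j - int (k * q)))"
    by (simp add: r_def)
  then have "norm (cheb_t t k * \<phi> j) \<le> norm (\<phi> (j + int k * int q) + \<phi> (j - int k * int q)) + norm (r (j + int (k * q)) + r (j - int (k * q)))"
    by (simp only: norm_triangle_ineq4)
  also have "\<dots> \<le> (norm (\<phi> (j + int k * int q)) + norm (\<phi> (j - int k * int q))) + (norm (r (j + int (k * q))) + norm (r (j - int (k * q))))"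
    by (intro add_mono norm_triangle_ineq)
  finally have "T * norm (\<phi> j) \<le> (norm (\<phi> (j + int k * int q)) + norm (\<phi> (j - int k * int q))) + 2 * (Y * T * L)"
    unfolding norm_mult T_def[symmetric] using err by linarith
  moreover have "2 * (Y * T * L) \<le> T * norm (\<phi> j) / 2"
    using mult_left_mono[OF X, of T] T1 by (simp add: T_def[symmetric] L_def algebra_simps)
  moreover have "T * norm (\<phi> j) \<ge> 1 * norm (\<phi> j)" using T1 unfolding T_def by (intro mult_right_mono) auto
  ultimately show ?thesis by linarith
qed

text \<open>For each \<open>k \<le> N\<close> one of \<open>k\<close> and \<open>2 k\<close> has trace at least \<open>1\<close> in modulus, so that summing the
  pointwise bound over \<open>k\<close> gives mass proportional to \<open>N\<close>. The factor \<open>32\<close> is \<open>8\<close> from squaring half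
  of the value at \<open>j\<close>, times the four sums over \<open>j + k q\<close>, \<open>j - k q\<close>, \<open>j + 2 k q\<close>, \<open>j - 2 k q\<close>.\<close>

lemma window_mass_lower_bound:
  assumes per: "\<And>n. W (n + int q) = W n" and q: "q > 0" and t: "t = discriminant W q z"
    and D: "\<And>n. norm (z - of_real (W n)) + 1 \<le> D"
    and Y: "\<And>k i. k \<le> 2 * N \<Longrightarrow> norm (cheb_t t k) \<ge> 1 \<Longrightarrow> i \<le> k \<Longrightarrow>
       norm (cheb_u t i) \<le> Y * norm (cheb_t t k)"
    and src: "\<And>n. \<bar>n - j\<bar> \<le> int (2 * N * q) \<Longrightarrow>
       norm (schrodinger W \<phi> n - z * \<phi> n - (if n = j then 1 else 0)) \<le> \<kappa>"
    and kap: "8 * real N * real q * \<kappa> \<le> 1"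
    and Q: "\<And>F. finite F \<Longrightarrow> (\<Sum>n\<in>F. (norm (\<phi> n))\<^sup>2) \<le> Q"
    and X: "norm (\<phi> j) \<ge> 4 * Y * D ^ (2 * q)"
  shows "real N * (norm (\<phi> j))\<^sup>2 \<le> 32 * Q"
proof -
  define a where "a k = (norm (\<phi> (j + int k * int q)))\<^sup>2 + (norm (\<phi> (j - int k * int q)))\<^sup>2" for k
  define X where "X = norm (\<phi> j)"
  have kap0: "\<kappa> \<ge> 0" using order_trans[OF norm_ge_zero src[of j]] by simp
  have good: "a k \<ge> X\<^sup>2 / 8" if "1 \<le> k" "k \<le> 2 * N" "norm (cheb_t t k) \<ge> 1" for k
  proof -
    have "real k * real q * \<kappa> \<le> real (2 * N) * real q * \<kappa>"
      using that kap0 by (intro mult_right_mono) (auto simp flip: of_nat_mult)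
    then have kk: "4 * real k * real q * \<kappa> \<le> 1" using kap by simp
    have "int (k * q) \<le> int (2 * N * q)" using that by (simp only: of_nat_le_iff mult_le_mono1)
    then have sk: "norm (schrodinger W \<phi> n - z * \<phi> n - (if n = j then 1 else 0)) \<le> \<kappa>"
      if "\<bar>n - j\<bar> \<le> int (k * q)" for n
      by (rule src[OF order_trans[OF that]])
    have "norm (\<phi> (j + int k * int q)) + norm (\<phi> (j - int k * int q)) \<ge> X / 2"
      unfolding X_def
      by (rule two_sided_value_lower_bound[where W = W and z = z and t = t and Y = Y and D = D and \<kappa> = \<kappa>,
            OF per q t D that(1,3) Y[OF that(2,3)] sk kk assms(9)])
    then have "(X / 2)\<^sup>2 \<le> (norm (\<phi> (j + int k * int q)) + norm (\<phi> (j - int k * int q)))\<^sup>2"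
      by (intro power_mono) (auto simp: X_def)
    also have "\<dots> \<le> 2 * a k"
      unfolding a_def using sum_squares_bound[of "norm (\<phi> (j + int k * int q))" "norm (\<phi> (j - int k * int q))"] by (simp add: power2_sum)
    finally show ?thesis by (simp add: power_divide)
  qed
  have a0: "a k \<ge> 0" for k by (simp add: a_def)
  have "real N * (X\<^sup>2 / 8) = (\<Sum>k\<in>{1..N}. X\<^sup>2 / 8)" by simp
  also have "\<dots> \<le> (\<Sum>k\<in>{1..N}. a k + a (2 * k))"
  proof (rule sum_mono)
    fix k assume k: "k \<in> {1..N}"
    show "X\<^sup>2 / 8 \<le> a k + a (2 * k)"
      using cheb_t_ge1_or_double[of t k]
    proof
      assume "1 \<le> norm (cheb_t t k)"
      then show ?thesis using good[of k] a0[of "2 * k"] k by auto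
    next
      assume "1 \<le> norm (cheb_t t (2 * k))"
      then show ?thesis using good[of "2 * k"] a0[of k] k by auto
    qed
  qed
  also have "\<dots> = (\<Sum>k\<in>{1..N}. (norm (\<phi> (j + int k * int q)))\<^sup>2) + (\<Sum>k\<in>{1..N}. (norm (\<phi> (j - int k * int q)))\<^sup>2)
     + (\<Sum>k\<in>{1..N}. (norm (\<phi> (j + int (2 * k) * int q)))\<^sup>2) + (\<Sum>k\<in>{1..N}. (norm (\<phi> (j - int (2 * k) * int q)))\<^sup>2)"
    by (simp add: a_def sum.distrib)
  also have "\<dots> \<le> Q + Q + Q + Q"
  proof (intro add_mono)
    have *: "(\<Sum>k\<in>{1..N}. (norm (\<phi> (f k)))\<^sup>2) \<le> Q" if "inj_on f {1..N}" for f
      using Q[of "f ` {1..N}"] sum.reindex[OF that, of "\<lambda>n. (norm (\<phi> n))\<^sup>2"] by simp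
    show "(\<Sum>k\<in>{1..N}. (norm (\<phi> (j + int k * int q)))\<^sup>2) \<le> Q" by (rule *) (use q in \<open>auto simp: inj_on_def\<close>)
    show "(\<Sum>k\<in>{1..N}. (norm (\<phi> (j - int k * int q)))\<^sup>2) \<le> Q" by (rule *) (use q in \<open>auto simp: inj_on_def\<close>)
    show "(\<Sum>k\<in>{1..N}. (norm (\<phi> (j + int (2 * k) * int q)))\<^sup>2) \<le> Q" by (rule *) (use q in \<open>auto simp: inj_on_def\<close>)
    show "(\<Sum>k\<in>{1..N}. (norm (\<phi> (j - int (2 * k) * int q)))\<^sup>2) \<le> Q" by (rule *) (use q in \<open>auto simp: inj_on_def\<close>)
  qed
  finally show ?thesis by (simp add: X_def)
qed

section \<open>Energies near the band edges\<close>

text \<open>A quantitative form of \<open>1 - y \<le> exp (- y)\<close>; it expresses the strict concavity of the logarithm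
  uniformly in \<open>y\<close>.\<close>

lemma one_minus_times_exp_le:
  fixes y :: real assumes "y < 1" shows "(1 - y) * exp y \<le> 1 - min (y\<^sup>2) 1 / 5"
proof (cases "y \<ge> 0")
  case True
  have y1: "y \<le> 1" using assms by simp
  \<comment> \<open>The quadratic bound for \<open>exp\<close> itself loses the term of order \<open>y\<^sup>2\<close>; halving the argument keeps part of it.\<close>
  have "exp y = (exp (y / 2))\<^sup>2" by (simp add: power2_eq_square flip: exp_add)
  also have "\<dots> \<le> (1 + y / 2 + (y / 2)\<^sup>2)\<^sup>2"
    using exp_bound[of "y / 2"] True y1 by (intro power_mono) auto
  finally have "(1 - y) * exp y \<le> (1 - y) * (1 + y / 2 + (y / 2)\<^sup>2)\<^sup>2"
    using assms by (intro mult_left_mono) auto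
  also have "\<dots> = 1 - y\<^sup>2 / 4 - y ^ 3 / 2 - 3 * y ^ 4 / 16 - y ^ 5 / 16"
    by (simp add: power2_eq_square power3_eq_cube power4_eq_xxxx algebra_simps eval_nat_numeral field_simps)
  also have "\<dots> \<le> 1 - y\<^sup>2 / 4"
    using True zero_le_power[OF True, of 3] zero_le_power[OF True, of 4] zero_le_power[OF True, of 5] by linarith
  also have "\<dots> \<le> 1 - min (y\<^sup>2) 1 / 5" by (simp add: min_def)
  finally show ?thesis .
next
  case False
  define a where "a = - y"
  have a: "a > 0" using False by (simp add: a_def)
  define d where "d = 1 + a + a\<^sup>2 / 2"
  have d0: "d > 0" using a by (simp add: d_def add_pos_nonneg)
  have "exp a \<ge> d" using exp_lower_Taylor_quadratic[of a] a by (simp add: d_def)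
  then have "(1 + a) / exp a \<le> (1 + a) / d" using a d0 by (intro frac_le) auto
  then have "(1 - y) * exp y \<le> (1 + a) / d" by (simp add: a_def exp_minus divide_inverse)
  also have "\<dots> = 1 - (a\<^sup>2 / 2) / d" using d0 by (simp add: d_def field_simps)
  also have "\<dots> \<le> 1 - min (a\<^sup>2) 1 / 5"
  proof -
    have "min (a\<^sup>2) 1 * d \<le> 5 * (a\<^sup>2 / 2)"
    proof (cases "a \<le> 1")
      case True
      then have "a\<^sup>2 \<le> 1" using a by (simp add: power_le_one)
      then have "d \<le> 5 / 2" using True by (simp add: d_def)
      then have "a\<^sup>2 * d \<le> a\<^sup>2 * (5 / 2)" by (intro mult_left_mono) auto
      then show ?thesis using \<open>a\<^sup>2 \<le> 1\<close> by simp
    next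
      case False
      then have "a \<le> a\<^sup>2" using a by (simp add: power2_eq_square)
      then have "1 \<le> a\<^sup>2" using False by linarith
      note \<open>a \<le> a\<^sup>2\<close> this
      then show ?thesis by (simp add: d_def)
    qed
    then have "min (a\<^sup>2) 1 / 5 \<le> (a\<^sup>2 / 2) / d" using d0 by (simp add: field_simps)
    then show ?thesis by simp
  qed
  finally show ?thesis by (simp add: a_def)
qed

lemma prod_one_minus_le:
  fixes y :: "'a \<Rightarrow> real"
  assumes I: "finite I" "i0 \<in> I" and y: "\<And>i. i \<in> I \<Longrightarrow> y i < 1" and s: "(\<Sum>i\<in>I. y i) \<ge> 0"
  shows "(\<Prod>i\<in>I. 1 - y i) \<le> 1 - min ((y i0)\<^sup>2) 1 / 5"
proof -
  have P0: "(\<Prod>i\<in>I. 1 - y i) \<ge> 0" using y by (intro prod_nonneg) (simp add: less_imp_le)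
  have "(\<Prod>i\<in>I. 1 - y i) \<le> (\<Prod>i\<in>I. 1 - y i) * exp (\<Sum>i\<in>I. y i)"
    using mult_left_mono[OF _ P0, of 1 "exp (\<Sum>i\<in>I. y i)"] s by simp
  also have "\<dots> = (\<Prod>i\<in>I. (1 - y i) * exp (y i))" by (simp add: exp_sum I prod.distrib)
  also have "\<dots> = ((1 - y i0) * exp (y i0)) * (\<Prod>i\<in>I - {i0}. (1 - y i) * exp (y i))"
    by (rule prod.remove[OF I])
  also have "\<dots> \<le> (1 - min ((y i0)\<^sup>2) 1 / 5) * 1"
  proof (rule mult_mono)
    have le: "(1 - y i) * exp (y i) \<le> 1" if "i \<in> I" for i
      using one_minus_times_exp_le[OF y[OF that]] by (smt (verit) min_def zero_le_power2 divide_nonneg_nonneg)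
    show "(\<Prod>i\<in>I - {i0}. (1 - y i) * exp (y i)) \<le> 1"
      using le y by (intro prod_le_1) (auto simp: less_imp_le)
    show "(\<Prod>i\<in>I - {i0}. (1 - y i) * exp (y i)) \<ge> 0"
      using y by (intro prod_nonneg) (auto simp: less_imp_le)
    show "0 \<le> 1 - min ((y i0)\<^sup>2) 1 / 5" by (simp add: min_def)
  qed (use one_minus_times_exp_le[OF y[OF I(2)]] in auto)
  finally show ?thesis by simp
qed

definition real_rooted :: "(nat \<Rightarrow> real) \<Rightarrow> nat \<Rightarrow> real \<Rightarrow> real" where
  "real_rooted r q x = (\<Prod>i<q. x - r i)"

text \<open>The logarithm of a real-rooted polynomial is strictly concave between its roots. Moving from
  \<open>x\<close> against the sign of the logarithmic derivative therefore lowers the modulus by a definite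
  amount. If the polynomial is at most \<open>3\<close> in modulus at \<open>x\<close>, then some root lies within distance \<open>4\<close>,
  and this root alone accounts for the decrease.\<close>

lemma real_rooted_ratio_le:
  assumes q: "q > 0" and nz: "real_rooted r q x \<noteq> 0" and le: "\<bar>real_rooted r q x\<bar> \<le> 3"
    and pos: "\<And>i. i < q \<Longrightarrow> h / (x - r i) < 1" and s: "h * (\<Sum>i<q. 1 / (x - r i)) \<ge> 0"
  shows "0 < real_rooted r q (x - h) / real_rooted r q x"
    and "real_rooted r q (x - h) / real_rooted r q x \<le> 1 - min (h\<^sup>2 / 16) 1 / 5"
proof -
  have ne: "x - r i \<noteq> 0" if "i < q" for i using nz that by (auto simp: real_rooted_def)
  have "real_rooted r q (x - h) / real_rooted r q x = (\<Prod>i<q. (x - h - r i) / (x - r i))"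
    by (simp add: real_rooted_def prod_dividef)
  also have "\<dots> = (\<Prod>i<q. 1 - h / (x - r i))" using ne by (intro prod.cong) (auto simp: field_simps)
  finally have e: "real_rooted r q (x - h) / real_rooted r q x = \<dots>" .
  show "0 < real_rooted r q (x - h) / real_rooted r q x" unfolding e using pos by (intro prod_pos) auto
  have "\<exists>i0<q. \<bar>x - r i0\<bar> \<le> 4"
  proof (rule ccontr)
    assume "\<not> ?thesis"
    then have "4 \<le> \<bar>x - r i\<bar>" if "i < q" for i using that by force
    \<comment> \<open>Otherwise the product would be at least \<open>4\<close>.\<close>
    then have "(\<Prod>i<q. (4::real)) \<le> (\<Prod>i<q. \<bar>x - r i\<bar>)" by (intro prod_mono) auto
    also have "\<dots> \<le> 3" using le by (simp add: real_rooted_def abs_prod)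
    finally have "(4::real) ^ q \<le> 3" by simp
    moreover have "(4::real) ^ 1 \<le> 4 ^ q" using q by (intro power_increasing) auto
    ultimately show False by simp
  qed
  then obtain i0 where i0: "i0 < q" "\<bar>x - r i0\<bar> \<le> 4" by blast
  have "real_rooted r q (x - h) / real_rooted r q x \<le> 1 - min ((h / (x - r i0))\<^sup>2) 1 / 5"
    unfolding e by (rule prod_one_minus_le) (use i0 pos s in \<open>auto simp: sum_distrib_left\<close>)
  moreover have "h\<^sup>2 / 16 \<le> (h / (x - r i0))\<^sup>2"
  proof -
    have "(x - r i0)\<^sup>2 \<le> 16" using i0(2) abs_le_square_iff[of "x - r i0" 4] by simp
    then show ?thesis using ne[OF i0(1)] unfolding power_divide
      by (intro divide_left_mono) auto
  qed
  ultimately show "real_rooted r q (x - h) / real_rooted r q x \<le> 1 - min (h\<^sup>2 / 16) 1 / 5"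
    by (smt (verit) divide_right_mono min.mono order_refl)
qed

definition near_edge :: "(nat \<Rightarrow> real) \<Rightarrow> nat \<Rightarrow> real \<Rightarrow> real \<Rightarrow> bool" where
  "near_edge r q \<delta> x \<longleftrightarrow> \<bar>(real_rooted r q x)\<^sup>2 - 4\<bar> \<le> \<delta>"

lemma near_edge_abs:
  assumes "near_edge r q \<delta> x" "\<delta> \<le> 1/4"
  shows "2 - \<delta> / 2 \<le> \<bar>real_rooted r q x\<bar>" "\<bar>real_rooted r q x\<bar> \<le> 2 + \<delta> / 2" "real_rooted r q x \<noteq> 0" "\<bar>real_rooted r q x\<bar> \<le> 3"
proof -
  define T where "T = \<bar>real_rooted r q x\<bar>"
  have T0: "T \<ge> 0" by (simp add: T_def)
  have "\<bar>T\<^sup>2 - 4\<bar> \<le> \<delta>" using assms by (simp add: near_edge_def T_def)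
  moreover have "T\<^sup>2 - 4 = (T - 2) * (T + 2)" by (simp add: power2_eq_square algebra_simps)
  then have "\<bar>T\<^sup>2 - 4\<bar> = \<bar>T - 2\<bar> * (T + 2)" using T0 by (simp add: abs_mult)
  moreover have "\<bar>T - 2\<bar> * 2 \<le> \<bar>T - 2\<bar> * (T + 2)" using T0 by (intro mult_left_mono) auto
  ultimately have "\<bar>T - 2\<bar> \<le> \<delta> / 2" by simp
  then have "2 - \<delta> / 2 \<le> T" "T \<le> 2 + \<delta> / 2" "T > 0" "T \<le> 3" using assms(2) by linarith+
  then show "2 - \<delta> / 2 \<le> \<bar>real_rooted r q x\<bar>" "\<bar>real_rooted r q x\<bar> \<le> 2 + \<delta> / 2" "real_rooted r q x \<noteq> 0" "\<bar>real_rooted r q x\<bar> \<le> 3"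
    by (auto simp: T_def)
qed

lemma near_edge_step_bound:
  assumes q: "q > 0" and d: "\<delta> \<le> 1/4"
    and e: "near_edge r q \<delta> x" "near_edge r q \<delta> (x - h)"
    and pos: "\<And>i. i < q \<Longrightarrow> h / (x - r i) < 1" and s: "h * (\<Sum>i<q. 1 / (x - r i)) \<ge> 0"
  shows "\<bar>h\<bar> \<le> 7 * sqrt \<delta>"
proof -
  note x = near_edge_abs[OF e(1) d] and y = near_edge_abs[OF e(2) d]
  have d0: "\<delta> \<ge> 0" using e(1) unfolding near_edge_def by linarith
  note rr = real_rooted_ratio_le[OF q x(3,4) pos s]
  have "1 - \<delta> / 2 \<le> (2 - \<delta> / 2) / (2 + \<delta> / 2)" using d0 by (simp add: field_simps power2_eq_square)
  also have "\<dots> \<le> \<bar>real_rooted r q (x - h)\<bar> / \<bar>real_rooted r q x\<bar>"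
    using x y d d0 by (intro frac_le) auto
  also have "\<dots> = real_rooted r q (x - h) / real_rooted r q x" using rr(1) by (metis abs_divide abs_of_pos)
  also have "\<dots> \<le> 1 - min (h\<^sup>2 / 16) 1 / 5" by (rule rr(2))
  finally have "min (h\<^sup>2 / 16) 1 \<le> 5 * \<delta> / 2" by simp
  then have "h\<^sup>2 \<le> 40 * \<delta>" using d by (auto simp: min_def split: if_splits)
  also have "\<dots> \<le> (7 * sqrt \<delta>)\<^sup>2" using d0 by (simp add: power_mult_distrib)
  finally show ?thesis using abs_le_square_iff[of h "7 * sqrt \<delta>"] d0 by simp
qed

text \<open>Two points near a band edge between the same two roots and on the same side of the maximum
  of the modulus have almost equal values there, so by strict concavity they are close. The two
  points are compared starting from the one where the modulus is larger.\<close>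

lemma near_edge_class_diameter:
  assumes q: "q > 0" and d: "\<delta> \<le> 1/4" and lt: "x < y"
    and e: "near_edge r q \<delta> x" "near_edge r q \<delta> y"
    and card: "card {i. i < q \<and> r i < x} = card {i. i < q \<and> r i < y}"
    and sign: "0 \<le> (\<Sum>i<q. 1 / (x - r i)) \<longleftrightarrow> 0 \<le> (\<Sum>i<q. 1 / (y - r i))"
  shows "y - x \<le> 7 * sqrt \<delta>"
proof -
  have "{i. i < q \<and> r i < x} = {i. i < q \<and> r i < y}"
    by (rule card_subset_eq) (use lt card in auto)
  then have eq: "r i < x \<longleftrightarrow> r i < y" if "i < q" for i using that by blast
  have ne: "r i \<noteq> x" "r i \<noteq> y" if "i < q" for i
    using near_edge_abs(3)[OF e(1) d] near_edge_abs(3)[OF e(2) d] that by (auto simp: real_rooted_def)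
  have side: "r i < x \<or> y < r i" if "i < q" for i using eq[OF that] ne[OF that] by linarith
  show ?thesis
  proof (cases "0 \<le> (\<Sum>i<q. 1 / (y - r i))")
    case True
    have "\<bar>y - x\<bar> \<le> 7 * sqrt \<delta>"
    proof (rule near_edge_step_bound[OF q d])
      show "near_edge r q \<delta> y" "near_edge r q \<delta> (y - (y - x))" using e by simp_all
      show "0 \<le> (y - x) * (\<Sum>i<q. 1 / (y - r i))" using True lt by simp
      fix i assume "i < q"
      then show "(y - x) / (y - r i) < 1" using side[of i] lt by (auto simp: divide_less_eq)
    qed
    then show ?thesis by simp
  next
    case False
    then have F: "(\<Sum>i<q. 1 / (x - r i)) < 0" using sign by simp
    have "\<bar>x - y\<bar> \<le> 7 * sqrt \<delta>"
    proof (rule near_edge_step_bound[OF q d])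
      show "near_edge r q \<delta> x" "near_edge r q \<delta> (x - (x - y))" using e by simp_all
      show "0 \<le> (x - y) * (\<Sum>i<q. 1 / (x - r i))" using F lt by (simp add: mult_nonpos_nonpos)
      fix i assume "i < q"
      then show "(x - y) / (x - r i) < 1" using side[of i] lt by (auto simp: divide_less_eq)
    qed
    then show ?thesis using lt by simp
  qed
qed

text \<open>The number of roots below a point and the sign of the logarithmic derivative distinguish at
  most \<open>2 (q + 1)\<close> classes; each is contained in one interval around any of its members.\<close>

lemma near_edge_measure_le:
  assumes M: "finite_measure M" "sets M = sets borel" and q: "q > 0" and d: "\<delta> \<le> 1/4"
    and B: "B \<in> sets borel" "\<And>x. x \<in> B \<Longrightarrow> near_edge r q \<delta> x"
    and m: "\<And>x. x \<in> B \<Longrightarrow> measure M {x - 7 * sqrt \<delta>..x + 7 * sqrt \<delta>} \<le> m" and m0: "m \<ge> 0"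
  shows "measure M B \<le> 2 * (real q + 1) * m"
proof -
  interpret finite_measure M by (rule M)
  define cls where "cls x = (card {i. i < q \<and> r i < x}, 0 \<le> (\<Sum>i<q. 1 / (x - r i)))" for x
  define J where "J = {..q} \<times> (UNIV :: bool set)"
  define e where "e k = (SOME x. x \<in> B \<and> cls x = k)" for k
  define A where "A k = (if \<exists>x\<in>B. cls x = k then {e k - 7 * sqrt \<delta>..e k + 7 * sqrt \<delta>} else {})" for k
  have ek: "e k \<in> B \<and> cls (e k) = k" if "x \<in> B" "cls x = k" for x k
    unfolding e_def by (rule someI[of _ x]) (use that in auto)
  have cover: "B \<subseteq> (\<Union>k\<in>J. A k)"
  proof
    fix x assume x: "x \<in> B"
    let ?k = "cls x"
    have "card {i. i < q \<and> r i < x} \<le> card {..<q}" by (intro card_mono) auto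
    then have kJ: "?k \<in> J" by (simp add: J_def cls_def)
    define y where "y = e ?k"
    have y: "y \<in> B" "cls y = cls x" using ek[OF x refl] by (simp_all add: y_def)
    then have c: "card {i. i < q \<and> r i < y} = card {i. i < q \<and> r i < x}"
       "0 \<le> (\<Sum>i<q. 1 / (y - r i)) \<longleftrightarrow> 0 \<le> (\<Sum>i<q. 1 / (x - r i))" unfolding cls_def by simp_all
    have "\<bar>x - y\<bar> \<le> 7 * sqrt \<delta>"
    proof (cases x y rule: linorder_cases)
      case less
      then show ?thesis using near_edge_class_diameter[OF q d less B(2)[OF x] B(2)[OF y(1)] c(1)[symmetric] c(2)[symmetric]] by simp
    next
      case equal
      have "0 \<le> \<delta>" using B(2)[OF x] unfolding near_edge_def by linarith
      then show ?thesis using equal by simp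
    next
      case greater
      then show ?thesis using near_edge_class_diameter[OF q d greater B(2)[OF y(1)] B(2)[OF x] c] by simp
    qed
    then have "x \<in> {y - 7 * sqrt \<delta>..y + 7 * sqrt \<delta>}" by (auto simp: abs_le_iff)
    then have "x \<in> A ?k" using x unfolding A_def y_def by auto
    then show "x \<in> (\<Union>k\<in>J. A k)" using kJ by blast
  qed
  have Am: "A k \<in> sets M" for k by (simp add: A_def M)
  have J: "finite J" "card J = 2 * (q + 1)" by (simp_all add: J_def card_cartesian_product card_UNIV_bool)
  have "measure M B \<le> measure M (\<Union>k\<in>J. A k)"
    by (rule finite_measure_mono[OF cover]) (use J Am in auto)
  also have "\<dots> \<le> (\<Sum>k\<in>J. measure M (A k))" by (rule measure_UNION_le[OF J(1) Am])
  also have "\<dots> \<le> (\<Sum>k\<in>J. m)"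
  proof (rule sum_mono)
    fix k
    show "measure M (A k) \<le> m"
      using ek[of _ k] m[of "e k"] m0 by (auto simp: A_def)
  qed
  also have "\<dots> = 2 * (real q + 1) * m" by (simp add: J)
  finally show ?thesis .
qed

section \<open>Bounds for the Borel transform\<close>

lemma norm_borel_transform_le:
  assumes pvm: "projection_valued_measure P" and z: "Im z > 0"
  shows "cmod (borel_transform (vector_measure P (delta j)) z) \<le> 1 / Im z"
proof -
  let ?M = "vector_measure P (delta j)"
  interpret finite_measure ?M by (rule finite_measure_vector_measure[OF pvm delta_ell2])
  have mass: "measure ?M UNIV = 1"
    using measure_vector_measure[OF pvm delta_ell2, of UNIV j] pvm_UNIV[OF pvm delta_ell2] by simp
  show ?thesis
  proof (cases "integrable ?M (\<lambda>x. 1 / (complex_of_real x - z))")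
    case True
    have "cmod (borel_transform ?M z) \<le> (\<integral>x. cmod (1 / (complex_of_real x - z)) \<partial>?M)"
      unfolding borel_transform_def by (rule integral_norm_bound)
    also have "\<dots> \<le> (\<integral>x. 1 / Im z \<partial>?M)"
      by (rule integral_mono[OF integrable_norm[OF True]]) (use inverse_shift_lipschitz(1)[OF z] in auto)
    also have "\<dots> = 1 / Im z" using mass by simp
    finally show ?thesis .
  next
    case False
    then show ?thesis using z by (simp add: borel_transform_def not_integrable_integral_eq)
  qed
qed

text \<open>Up to small errors, the resolvent vector \<open>\<phi>\<close> has \<open>\<phi>(j) = F\<close> and squared norm at most \<open>\<bar>F\<bar> / Im z\<close>. If \<open>\<bar>F\<bar>\<close> is large
  compared with \<open>Y D\<^sup>2\<^sup>q\<close>, then \<open>\<phi>\<close> carries mass of order \<open>N \<bar>F\<bar>\<^sup>2\<close> in the window of \<open>2 N\<close> periods on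
  either side; together \<open>N \<bar>F\<bar>\<^sup>2\<close> is at most a multiple of \<open>\<bar>F\<bar> / Im z\<close>.\<close>

lemma borel_transform_bound_from_window:
  assumes sr: "spectral_resolution (schrodinger V) P" and V: "\<And>n. \<bar>V n\<bar> \<le> v"
    and per: "\<And>n. W (n + int q) = W n" and q: "q > 0" and t: "t = discriminant W q z"
    and z: "0 < Im z" "Im z \<le> 1"
    and D: "\<And>n. norm (z - of_real (W n)) + 1 \<le> D"
    and Y: "\<And>k i. k \<le> 2 * N \<Longrightarrow> norm (cheb_t t k) \<ge> 1 \<Longrightarrow> i \<le> k \<Longrightarrow>
       norm (cheb_u t i) \<le> Y * norm (cheb_t t k)"
    and N: "N \<ge> 1"
    and close: "\<And>n. \<bar>n\<bar> \<le> int (2 * N * q) + 1 \<Longrightarrow> \<bar>V n - W n\<bar> \<le> \<kappa>"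
    and kap: "32 * real N * real q * \<kappa> \<le> Im z"
    and j: "j \<in> {0, 1}"
  shows "cmod (borel_transform (vector_measure P (delta j)) z) \<le> 8 * Y * D ^ (2 * q) + 256 / (real N * Im z) + 1"
proof -
  define F where "F = borel_transform (vector_measure P (delta j)) z"
  define \<eta> where "\<eta> = Im z"
  \<comment> \<open>Half of the admissible source strength; the other half is left for the error of the periodic copy.\<close>
  define \<tau> where "\<tau> = 1 / (16 * real N * real q)"
  have Nq: "real N \<ge> 1" "real q \<ge> 1" "real N * real q \<ge> 1" using N q by (auto simp flip: of_nat_mult)
  have \<tau>: "\<tau> > 0" "\<tau> \<le> 1 / 16" using Nq by (auto simp: \<tau>_def field_simps)
  obtain \<phi> where \<phi>: "\<And>n. cmod (schrodinger V \<phi> n - z * \<phi> n - delta j n) \<le> \<tau>"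
    "\<And>S. finite S \<Longrightarrow> (\<Sum>n\<in>S. (cmod (\<phi> n))\<^sup>2) \<le> cmod F / \<eta> + \<tau>"
    "cmod (\<phi> j - F) \<le> \<tau>"
    using approximate_resolvent_vector[OF sr V z(1) \<tau>(1) F_def] unfolding \<eta>_def by blast
  have \<eta>: "0 < \<eta>" "\<eta> \<le> 1" using z by (simp_all add: \<eta>_def)
  have Fle: "cmod F \<le> 1 / \<eta>" unfolding F_def \<eta>_def by (rule norm_borel_transform_le[OF resolution_pvm[OF sr] z(1)])
  have small: "cmod (\<phi> n) \<le> 2 / \<eta>" for n
  proof -
    have "(cmod (\<phi> n))\<^sup>2 \<le> cmod F / \<eta> + \<tau>" using \<phi>(2)[of "{n}"] by simp
    also have "cmod F / \<eta> \<le> (1 / \<eta>) / \<eta>" using Fle \<eta> by (intro divide_right_mono) auto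
    also have "\<tau> \<le> 1 * 1" using \<tau> by simp
    also have "\<dots> \<le> (1 / \<eta>) * (1 / \<eta>)" using \<eta> by (intro mult_mono) auto
    finally have "(cmod (\<phi> n))\<^sup>2 \<le> 2 * (1 / \<eta>)\<^sup>2" by (simp add: power2_eq_square)
    also have "\<dots> \<le> (2 / \<eta>)\<^sup>2" by (simp add: power_divide divide_right_mono)
    finally show ?thesis by (rule power2_le_imp_le) (use \<eta> in simp)
  qed
  have kap0: "\<kappa> \<ge> 0" using order_trans[OF abs_ge_zero close[of 0]] by simp
  \<comment> \<open>Replacing \<open>V\<close> by \<open>W\<close> adds the source \<open>(W - V) \<phi>\<close> to the residual \<open>\<tau>\<close>.\<close>
  define \<kappa>1 where "\<kappa>1 = \<tau> + \<kappa> * (2 / \<eta>)"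
  have src: "cmod (schrodinger W \<phi> n - z * \<phi> n - (if n = j then 1 else 0)) \<le> \<kappa>1"
    if n: "\<bar>n - j\<bar> \<le> int (2 * N * q)" for n
  proof -
    have "\<bar>n\<bar> \<le> int (2 * N * q) + 1" using n j by auto
    then have c: "\<bar>W n - V n\<bar> \<le> \<kappa>" using close by (metis abs_minus_commute)
    have "schrodinger W \<phi> n - z * \<phi> n - (if n = j then 1 else 0)
      = (schrodinger V \<phi> n - z * \<phi> n - delta j n) + of_real (W n - V n) * \<phi> n"
      by (simp add: schrodinger_def delta_def algebra_simps)
    then have "cmod (schrodinger W \<phi> n - z * \<phi> n - (if n = j then 1 else 0))
      \<le> cmod (schrodinger V \<phi> n - z * \<phi> n - delta j n) + \<bar>W n - V n\<bar> * cmod (\<phi> n)"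
      by (metis norm_mult norm_of_real norm_triangle_ineq)
    also have "\<dots> \<le> \<tau> + \<kappa> * (2 / \<eta>)"
      using \<phi>(1) c small kap0 by (intro add_mono mult_mono) auto
    finally show ?thesis by (simp add: \<kappa>1_def)
  qed
  have k1: "8 * real N * real q * \<kappa>1 \<le> 1"
  proof -
    have A: "8 * real N * real q * \<tau> = 1 / 2" using Nq by (simp add: \<tau>_def)
    have "8 * real N * real q * (\<kappa> * (2 / \<eta>)) = (32 * real N * real q * \<kappa>) / (2 * \<eta>)" by simp
    also have "\<dots> \<le> \<eta> / (2 * \<eta>)" using kap \<eta> unfolding \<eta>_def[symmetric] by (intro divide_right_mono) auto
    also have "\<dots> = 1 / 2" using \<eta> by simp
    finally show ?thesis using A unfolding \<kappa>1_def distrib_left by linarith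
  qed
  show ?thesis unfolding F_def[symmetric] \<eta>_def[symmetric]
  proof (rule ccontr)
    assume "\<not> cmod F \<le> 8 * Y * D ^ (2 * q) + 256 / (real N * \<eta>) + 1"
    moreover have "Y * D ^ (2 * q) \<ge> 0"
    proof -
      have "norm (cheb_u t 1) \<le> Y * norm (cheb_t t 1)" if "norm (cheb_t t 1) \<ge> 1" using Y[of 1 1] N that by auto
      moreover have "norm (cheb_u t 2) \<le> Y * norm (cheb_t t 2)" if "norm (cheb_t t 2) \<ge> 1" using Y[of 2 2] N that by auto
      ultimately have "Y \<ge> 0" using cheb_t_ge1_or_double[of t 1]
        by (smt (verit) mult_neg_pos mult_1_right nat_mult_1_right norm_ge_zero)
      moreover have "D \<ge> 0" using D[of 0] norm_ge_zero[of "z - of_real (W 0)"] by linarith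
      ultimately show ?thesis by simp
    qed
    moreover have "256 / (real N * \<eta>) \<ge> 0" using \<eta> by simp
    ultimately have F: "cmod F > 256 / (real N * \<eta>)" "cmod F \<ge> 1" "cmod F \<ge> 8 * (Y * D ^ (2 * q))" by linarith+
    have "cmod F \<le> cmod (\<phi> j) + cmod (\<phi> j - F)" by (metis norm_triangle_sub norm_minus_commute add.commute)
    then have X: "cmod (\<phi> j) \<ge> cmod F / 2" using \<phi>(3) \<tau> F by linarith
    have "1 \<le> cmod F / \<eta>" using F(2) \<eta> by (simp add: le_divide_eq)
    then have \<tau>F: "\<tau> \<le> cmod F / \<eta>" using \<tau> by linarith
    have "real N * (cmod F / 2)\<^sup>2 \<le> real N * (cmod (\<phi> j))\<^sup>2" using X by (intro mult_left_mono power_mono) auto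
    also have "\<dots> \<le> 32 * (cmod F / \<eta> + \<tau>)"
      by (rule window_mass_lower_bound[where W = W and q = q and z = z and t = t and Y = Y and D = D and \<kappa> = \<kappa>1, OF per q t D Y src k1 \<phi>(2)])
         (use X F(3) in auto)
    also have "\<dots> \<le> 32 * (cmod F / \<eta> + cmod F / \<eta>)" using \<tau>F by simp
    finally have "real N * (cmod F / 2)\<^sup>2 \<le> 64 * (cmod F / \<eta>)" by simp
    then have "real N * cmod F * cmod F * \<eta> \<le> 256 * cmod F" using \<eta> by (simp add: power2_eq_square field_simps)
    then have "cmod F * (real N * cmod F * \<eta>) \<le> cmod F * 256" by (simp only: mult_ac)
    then have "real N * cmod F * \<eta> \<le> 256" by (rule mult_left_le_imp_le) (use F(2) in linarith)
    then have "cmod F \<le> 256 / (real N * \<eta>)" using Nq \<eta> by (simp add: field_simps)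
    then show False using F(1) by simp
  qed
qed

definition periodic_copy :: "(int \<Rightarrow> real) \<Rightarrow> nat \<Rightarrow> int \<Rightarrow> real" where
  "periodic_copy V q n = V (1 + (n - 1) mod int q)"

lemma periodic_copy_periodic: "periodic_copy V q (n + int q) = periodic_copy V q n"
proof -
  have "(n + int q - 1) mod int q = (n - 1) mod int q" by (metis add_diff_eq diff_add_eq mod_add_self2)
  then show ?thesis by (simp add: periodic_copy_def)
qed

text \<open>The condition of almost periodicity at a single period \<open>q\<close>, with range \<open>K\<close> and accuracy \<open>d\<close>.\<close>

definition nearly_periodic :: "(int \<Rightarrow> real) \<Rightarrow> nat \<Rightarrow> real \<Rightarrow> real \<Rightarrow> bool" where
  "nearly_periodic V q K d \<longleftrightarrow> (\<forall>j\<in>{1..int q}. \<forall>k :: int. real_of_int \<bar>k\<bar> \<le> K \<longrightarrow>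
     \<bar>V (j + k * int q) - V (j + (k + 1) * int q)\<bar> \<le> d \<and>
     \<bar>V (j + k * int q) - V (j + (k - 1) * int q)\<bar> \<le> d)"

lemma periodic_copy_close:
  assumes q: "q > 0" and np: "nearly_periodic V q K d" and K: "real m \<le> K"
    and n: "\<bar>n\<bar> \<le> int m * int q - 1"
  shows "\<bar>V n - periodic_copy V q n\<bar> \<le> real m * d"
proof -
  define j where "j = 1 + (n - 1) mod int q"
  define k where "k = (n - 1) div int q"
  have "0 \<le> (n - 1) mod int q" "(n - 1) mod int q < int q" using q by simp_all
  then have j: "j \<in> {1..int q}" by (simp add: j_def)
  have njk: "n = j + k * int q" unfolding j_def k_def by simp
  have kle: "\<bar>k\<bar> \<le> int m"
  proof -
    have "k * int q \<le> int m * int q" using njk j n by (simp only: atLeastAtMost_iff) linarith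
    then have "k \<le> int m" using q by simp
    moreover have "(- int m - 1) * int q < k * int q" using njk j n by (simp only: left_diff_distrib mult_minus_left mult_1 atLeastAtMost_iff) linarith
    then have "- int m - 1 < k" using q by (simp add: mult_less_cancel_right)
    ultimately show ?thesis by simp
  qed
  have st: "\<bar>V (j + k * int q) - V (j + (k + 1) * int q)\<bar> \<le> d" "\<bar>V (j + k * int q) - V (j + (k - 1) * int q)\<bar> \<le> d"
    if "real_of_int \<bar>k\<bar> \<le> K" for k
    using np j that unfolding nearly_periodic_def by blast+
  have d0: "d \<ge> 0" using order_trans[OF abs_ge_zero st(1)[of 0]] K by simp
  have walk: "\<bar>V (j + int i * int q) - V j\<bar> \<le> real i * d \<and> \<bar>V (j - int i * int q) - V j\<bar> \<le> real i * d" if "i \<le> m" for i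
    using that
  proof (induction i)
    case (Suc i)
    have Ki: "real_of_int \<bar>int i\<bar> \<le> K" "real_of_int \<bar>- int i\<bar> \<le> K" using Suc.prems K by auto
    have "\<bar>V (j + int i * int q) - V (j + int (Suc i) * int q)\<bar> \<le> d" using st(1)[OF Ki(1)] by (simp add: add.commute)
    moreover have "\<bar>V (j - int i * int q) - V (j - int (Suc i) * int q)\<bar> \<le> d"
      using st(2)[OF Ki(2)] by (simp add: algebra_simps)
    ultimately show ?case using Suc.IH Suc.prems by (auto simp: distrib_right)
  qed simp
  have "\<bar>V n - V j\<bar> \<le> real (nat \<bar>k\<bar>) * d"
  proof (cases "k \<ge> 0")
    case True
    then obtain i where "k = int i" using nonneg_int_cases by blast
    then show ?thesis using walk[of i] kle njk by simp
  next
    case False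
    then have "k = - int (nat (- k))" by simp
    then obtain i where "k = - int i" by blast
    then show ?thesis using walk[of i] kle njk by simp
  qed
  also have "\<dots> \<le> real m * d" using kle d0 by (intro mult_right_mono) auto
  finally show ?thesis by (simp add: periodic_copy_def j_def)
qed

section \<open>Choice of scales\<close>

text \<open>The exponents of all scales in terms of \<open>Q = q\<close>. Here \<open>L = exp (l Q)\<close> bounds the transfer
  matrices over two periods, \<open>\<eta>\<close> is the final height above the real axis, \<open>N\<close> about \<open>1 / \<eta>\<close> is the number
  of periods in the window, \<open>\<delta>\<close> is the distance to the band edges measured by \<open>t\<^sup>2 - 4\<close>, and
  \<open>\<rho> = 7 sqrt \<delta>\<close> is the width of the exceptional intervals. The exponent \<open>4 l + 4\<close> of \<open>\<delta>\<close> is the one for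
  which \<open>L sqrt \<rho>\<close>, up to a constant the mass of an exceptional interval, is of order \<open>exp (- Q)\<close>. The
  bounds on \<open>c\<close> keep the accuracy \<open>exp (- \<beta> Q)\<close> well below \<open>\<eta>\<^sup>3\<close> and the window within the range
  \<open>exp (\<epsilon> \<beta> Q)\<close>, and \<open>384 Q \<le> exp Q\<close> absorbs all polynomial factors.\<close>

lemma scale_arithmetic:
  fixes l c \<beta> \<epsilon> Q :: real
  assumes l: "l \<ge> 0" and c: "0 < c" "2 * c \<le> \<epsilon>" "4 * c \<le> 1" and b: "c * \<beta> \<ge> 6 * l + 5"
    and Q: "Q \<ge> 1" "384 * Q \<le> exp Q"
  defines "\<eta> \<equiv> exp (- (c * \<beta> * Q))" and "N \<equiv> real (nat \<lceil>exp (c * \<beta> * Q)\<rceil>)" and "\<delta> \<equiv> exp (- ((4 * l + 4) * Q))"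
    and "L \<equiv> exp (l * Q)" and "\<rho> \<equiv> 7 * exp (- ((2 * l + 2) * Q))"
  shows "1 / \<eta> \<le> N" "N \<ge> 1" "2 * N + 2 \<le> exp (\<epsilon> * \<beta> * Q) / Q"
    and "32 * N * Q * ((2 * N + 2) * exp (- \<beta> * Q)) \<le> \<eta>"
    and "8 * \<eta> * L\<^sup>2 \<le> 3 / 4 * \<delta>" and "\<eta> \<le> \<rho>" "\<rho> = 7 * sqrt \<delta>" "\<delta> \<le> 1 / 4" "\<delta> \<le> \<rho>" "\<rho> \<le> 1"
    and "12 * L * sqrt \<rho> \<le> 1" "L * sqrt \<rho> \<le> 3 * exp (- Q)" "10 / sqrt \<delta> * L = 10 * exp ((3 * l + 2) * Q)"
proof -
  have Qe: "exp Q \<ge> 384" using Q by linarith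
  have b1: "c * \<beta> \<ge> 1" using b l by linarith
  have b1Q: "c * \<beta> * Q \<ge> Q" using mult_right_mono[OF b1, of Q] Q by simp
  have b0: "\<beta> > 0" using b1 c by (meson less_le_not_le mult_nonneg_nonpos not_less order_trans zero_less_one)
  have inv: "1 / \<eta> = exp (c * \<beta> * Q)" by (simp add: \<eta>_def exp_minus divide_inverse)
  show N1: "1 / \<eta> \<le> N" unfolding inv N_def by linarith
  have "exp (c * \<beta> * Q) \<ge> 1" using b1Q Q by simp
  then show N2: "N \<ge> 1" using N1 unfolding inv by linarith
  have N3: "N \<le> 2 * exp (c * \<beta> * Q)" unfolding N_def using \<open>exp (c * \<beta> * Q) \<ge> 1\<close> by linarith
  have N4: "2 * N + 2 \<le> 6 * exp (c * \<beta> * Q)" using N3 \<open>exp (c * \<beta> * Q) \<ge> 1\<close> by linarith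
  have "(2 * N + 2) * Q \<le> (6 * exp (c * \<beta> * Q)) * Q" using N4 Q by (intro mult_right_mono) auto
  also have "\<dots> = (6 * Q) * exp (c * \<beta> * Q)" by simp
  also have "\<dots> \<le> exp Q * exp (c * \<beta> * Q)" using Q by (intro mult_right_mono) auto
  also have "\<dots> \<le> exp (c * \<beta> * Q) * exp (c * \<beta> * Q)" using b1Q by (intro mult_right_mono) auto
  also have "\<dots> = exp (2 * c * \<beta> * Q)" by (simp add: exp_add[symmetric])
  also have "\<dots> \<le> exp (\<epsilon> * \<beta> * Q)" using c b0 Q by (simp add: mult_right_mono)
  finally show "2 * N + 2 \<le> exp (\<epsilon> * \<beta> * Q) / Q" using Q by (simp add: le_divide_eq)
  have "32 * N * Q * ((2 * N + 2) * exp (- \<beta> * Q)) \<le> 32 * (2 * exp (c * \<beta> * Q)) * Q * ((6 * exp (c * \<beta> * Q)) * exp (- \<beta> * Q))"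
    using N2 N3 N4 Q by (intro mult_mono) auto
  also have "\<dots> = (384 * Q) * (exp (c * \<beta> * Q) * exp (c * \<beta> * Q) * exp (- \<beta> * Q))" by simp
  also have "\<dots> \<le> exp Q * (exp (c * \<beta> * Q) * exp (c * \<beta> * Q) * exp (- \<beta> * Q))" using Q by (intro mult_right_mono) auto
  also have "\<dots> = exp (Q + c * \<beta> * Q + c * \<beta> * Q - \<beta> * Q)" by (simp add: exp_add[symmetric])
  also have "\<dots> \<le> \<eta>"
  proof -
    have "4 * c * \<beta> \<le> 1 * \<beta>" using c b0 by (intro mult_right_mono) auto
    then have "1 + 3 * (c * \<beta>) \<le> \<beta>" using b1 by linarith
    then have "(1 + 3 * (c * \<beta>)) * Q \<le> \<beta> * Q" using Q by (intro mult_right_mono) auto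
    then show ?thesis unfolding \<eta>_def by (simp add: algebra_simps)
  qed
  finally show "32 * N * Q * ((2 * N + 2) * exp (- \<beta> * Q)) \<le> \<eta>" .
  have bQ: "(6 * l + 5) * Q \<le> c * \<beta> * Q" using b Q by (intro mult_right_mono) auto
  have lQ: "l * Q \<ge> 0" using l Q by simp
  have "8 * \<eta> * L\<^sup>2 = 8 * exp (- (c * \<beta> * Q) + l * Q + l * Q)"
    unfolding \<eta>_def L_def power2_eq_square exp_add by simp
  also have "\<dots> \<le> 8 * exp (- ((4 * l + 4) * Q) - Q)" using bQ by (simp add: algebra_simps)
  also have "\<dots> = 8 * (\<delta> / exp Q)" by (simp add: \<delta>_def exp_diff)
  also have "\<dots> \<le> 8 * (\<delta> / 384)" using Qe by (intro mult_left_mono divide_left_mono) (auto simp: \<delta>_def)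
  also have "\<dots> \<le> 3 / 4 * \<delta>" by (simp add: \<delta>_def)
  finally show "8 * \<eta> * L\<^sup>2 \<le> 3 / 4 * \<delta>" .
  have sd: "sqrt \<delta> = exp (- ((2 * l + 2) * Q))"
  proof (rule real_sqrt_unique)
    show "(exp (- ((2 * l + 2) * Q)))\<^sup>2 = \<delta>" by (simp add: \<delta>_def power2_eq_square exp_add[symmetric] algebra_simps)
  qed simp
  show \<rho>d: "\<rho> = 7 * sqrt \<delta>" by (simp add: \<rho>_def sd)
  have "\<eta> \<le> exp (- ((2 * l + 2) * Q))" unfolding \<eta>_def using bQ lQ Q by (simp add: distrib_right)
  also have "\<dots> \<le> \<rho>" by (simp add: \<rho>_def)
  finally show "\<eta> \<le> \<rho>" .
  have dle: "\<delta> \<le> exp (- Q)" unfolding \<delta>_def using lQ Q by (simp add: distrib_right)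
  have e384: "exp (- Q) \<le> 1 / 384" using Qe by (simp add: exp_minus field_simps)
  show "\<delta> \<le> 1 / 4" using dle e384 by linarith
  have "\<delta> \<le> exp (- ((2 * l + 2) * Q))" unfolding \<delta>_def using lQ Q by (simp add: algebra_simps)
  then show "\<delta> \<le> \<rho>" unfolding \<rho>_def using exp_gt_zero[of "- ((2 * l + 2) * Q)"] by linarith
  have "exp (- ((2 * l + 2) * Q)) \<le> exp (- Q)" using lQ Q by (simp add: distrib_right)
  then show "\<rho> \<le> 1" using e384 unfolding \<rho>_def by linarith
  have "\<rho> \<le> (3 * exp (- ((l + 1) * Q)))\<^sup>2"
    by (simp add: \<rho>_def power2_eq_square exp_add[symmetric] algebra_simps)
  then have "sqrt \<rho> \<le> 3 * exp (- ((l + 1) * Q))" by (intro real_le_lsqrt) auto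
  then have "L * sqrt \<rho> \<le> exp (l * Q) * (3 * exp (- ((l + 1) * Q)))" unfolding L_def by (intro mult_left_mono) auto
  also have "\<dots> = 3 * exp (- Q)" by (simp add: exp_add[symmetric] distrib_right)
  finally show Ls: "L * sqrt \<rho> \<le> 3 * exp (- Q)" .
  show "12 * L * sqrt \<rho> \<le> 1" using Ls e384 by linarith
  have "10 / sqrt \<delta> * L = 10 * (exp ((2 * l + 2) * Q) * exp (l * Q))" unfolding sd L_def by (simp add: exp_minus divide_inverse)
  also have "\<dots> = 10 * exp ((3 * l + 2) * Q)" by (simp add: exp_add[symmetric] algebra_simps)
  finally show "10 / sqrt \<delta> * L = 10 * exp ((3 * l + 2) * Q)" .
qed

text \<open>Away from the band edges, \<open>cheb_u\<close> is bounded by the trace times \<open>\<delta>\<^sup>-\<^sup>1\<^sup>/\<^sup>2\<close>, and the window of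
  \<open>N \<ge> 1 / \<eta>\<close> periods bounds the Borel transform at height \<open>\<eta>\<close>.

  Near a band edge the parabolic bound is available for about \<open>1 / (L sqrt \<rho>)\<close> periods. At height \<open>\<rho>\<close>
  this window gives \<open>\<bar>F\<bar>\<close> of order \<open>L / sqrt \<rho>\<close>, the size of a square root singularity at a band edge,
  and the Poisson kernel turns it into mass of order \<open>L sqrt \<rho>\<close>.\<close>

lemma estimates_at_one_period:
  fixes V :: "int \<Rightarrow> real" and q :: nat
  assumes sr: "spectral_resolution (schrodinger V) P" and V: "\<And>n. \<bar>V n\<bar> \<le> v" and v: "v \<ge> 0"
    and l: "l = 2 * ln (2 * v + 6)"
    and c: "0 < c" "2 * c \<le> \<epsilon>" "4 * c \<le> 1" and b: "c * \<beta> \<ge> 6 * l + 5"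
    and q: "q > 0" "384 * real q \<le> exp (real q)"
    and np: "nearly_periodic V q (exp (\<epsilon> * \<beta> * real q) / real q) (exp (- \<beta> * real q))"
    and E: "\<bar>E\<bar> \<le> 3 + v" and j: "j \<in> {0, 1}"
  defines "\<delta> \<equiv> exp (- ((4 * l + 4) * real q))"
    and "T \<equiv> discriminant (periodic_copy V q) q (of_real E)"
  shows "norm (T\<^sup>2 - 4) > \<delta> \<Longrightarrow>
      cmod (borel_transform (vector_measure P (delta j)) (Complex E (exp (- (c * \<beta> * real q)))))
       \<le> 80 * exp ((3 * l + 2) * real q) + 257"
    and "norm (T\<^sup>2 - 4) \<le> \<delta> \<Longrightarrow>
      measure (vector_measure P (delta j)) {E - 7 * sqrt \<delta>..E + 7 * sqrt \<delta>} \<le> 40000 * exp (- real q)"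
proof -
  define W where "W = periodic_copy V q"
  define D where "D = 2 * v + 6"
  define Q where "Q = real q"
  define L where "L = exp (l * Q)"
  define \<eta> where "\<eta> = exp (- (c * \<beta> * Q))"
  define N where "N = nat \<lceil>exp (c * \<beta> * Q)\<rceil>"
  define \<rho> where "\<rho> = 7 * exp (- ((2 * l + 2) * Q))"
  define \<kappa> where "\<kappa> = (2 * real N + 2) * exp (- \<beta> * Q)"
  have D6: "D \<ge> 6" using v by (simp add: D_def)
  have l0: "l \<ge> 0" using v by (simp add: l)
  have DL: "D ^ (2 * q) = L"
  proof -
    have "D ^ (2 * q) = exp (ln D) ^ (2 * q)" using D6 by simp
    also have "\<dots> = L" unfolding L_def l D_def[symmetric] exp_of_nat_mult[symmetric] by (simp add: Q_def)
    finally show ?thesis .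
  qed
  have L1: "L \<ge> 1" using l0 by (simp add: L_def Q_def)
  have Q1: "Q \<ge> 1" "384 * Q \<le> exp Q" using q by (simp_all add: Q_def)
  note ar = scale_arithmetic[OF l0 c b Q1, folded \<eta>_def N_def L_def \<rho>_def]
  have \<delta>: "\<delta> = exp (- ((4 * l + 4) * Q))" by (simp add: \<delta>_def Q_def)
  note ar = ar[folded \<delta>]
  have \<eta>0: "\<eta> > 0" by (simp add: \<eta>_def)
  have \<rho>0: "\<rho> > 0" by (simp add: \<rho>_def)
  have \<delta>0: "\<delta> > 0" by (simp add: \<delta>)
  have \<eta>1: "\<eta> \<le> 1" using ar(6,10) by linarith
  have per: "W (n + int q) = W n" for n unfolding W_def by (rule periodic_copy_periodic)
  have Wv: "\<bar>W n\<bar> \<le> v" for n unfolding W_def periodic_copy_def by (rule V)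
  have close: "\<bar>V n - W n\<bar> \<le> \<kappa>" if "\<bar>n\<bar> \<le> int (2 * N * q) + 1" for n
  proof -
    have "\<bar>V n - W n\<bar> \<le> real (2 * N + 2) * exp (- \<beta> * Q)" unfolding W_def
    proof (rule periodic_copy_close[OF q(1)])
    show "nearly_periodic V q (exp (\<epsilon> * \<beta> * Q) / Q) (exp (- \<beta> * Q))" using np by (simp add: Q_def)
    show "real (2 * N + 2) \<le> exp (\<epsilon> * \<beta> * Q) / Q" using ar(3) by simp
    have "int q \<ge> 1" using q by simp
    then show "\<bar>n\<bar> \<le> int (2 * N + 2) * int q - 1" using that by (simp add: algebra_simps)
    qed
    then show ?thesis by (simp add: \<kappa>_def add.commute)
  qed
  have kap: "32 * real N * Q * \<kappa> \<le> \<eta>" using ar(4) unfolding \<kappa>_def .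
  have kap0: "\<kappa> \<ge> 0" by (simp add: \<kappa>_def)
  have dist: "norm (Complex E y - of_real (W n)) + 2 \<le> D" if "0 \<le> y" "y \<le> 1" for y n
  proof -
    have "norm (Complex E y - of_real (W n)) \<le> \<bar>E - W n\<bar> + \<bar>y\<bar>"
      using cmod_le[of "Complex E y - of_real (W n)"] by simp
    then show ?thesis using E Wv[of n] that unfolding D_def by linarith
  qed
  have dist1: "norm (Complex E y - of_real (W n)) + 1 \<le> D" if "0 \<le> y" "y \<le> 1" for y n
    using dist[OF that, of n] by linarith
  define t where "t y = discriminant W q (Complex E y)" for y
  have T: "T = t 0" by (simp add: T_def t_def W_def complex_of_real_def)
  have tT: "norm ((t y)\<^sup>2 - T\<^sup>2) \<le> 8 * y * L\<^sup>2" if y: "0 \<le> y" "y \<le> 1" for y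
  proof -
    have "norm (Complex E y - Complex E 0) = y" using y by (simp add: cmod_def)
    then show ?thesis
      using discriminant_square_lipschitz[where W = W and z = "Complex E y" and z' = "Complex E 0", OF dist[OF y] dist q(1)]
      unfolding T t_def DL by simp
  qed
  show "cmod (borel_transform (vector_measure P (delta j)) (Complex E (exp (- (c * \<beta> * real q))))) \<le> 80 * exp ((3 * l + 2) * real q) + 257"
    if big: "norm (T\<^sup>2 - 4) > \<delta>"
  proof -
    have y: "0 \<le> \<eta>" "\<eta> \<le> 1" using \<eta>0 \<eta>1 by auto
    have "norm (T\<^sup>2 - 4) \<le> norm ((t \<eta>)\<^sup>2 - 4) + norm ((t \<eta>)\<^sup>2 - T\<^sup>2)"
      using norm_triangle_ineq4[of "(t \<eta>)\<^sup>2 - 4" "(t \<eta>)\<^sup>2 - T\<^sup>2"] by simp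
    then have t4: "norm ((t \<eta>)\<^sup>2 - 4) \<ge> \<delta> / 4" using tT[OF y] ar(5) big by linarith
    have "cmod (borel_transform (vector_measure P (delta j)) (Complex E \<eta>)) \<le>
       8 * (10 / sqrt \<delta>) * D ^ (2 * q) + 256 / (real N * Im (Complex E \<eta>)) + 1"
    proof (rule borel_transform_bound_from_window[where W = W and z = "Complex E \<eta>" and t = "t \<eta>" and D = D and N = N and \<kappa> = \<kappa>,
          OF sr V per q(1) _ _ _ dist1[OF y] _ _ close _ j])
      show "t \<eta> = discriminant W q (Complex E \<eta>)" by (simp add: t_def)
      fix k i assume "norm (cheb_t (t \<eta>) k) \<ge> 1" "i \<le> k"
      then have "norm (cheb_u (t \<eta>) i) \<le> 5 / sqrt (\<delta> / 4) * norm (cheb_t (t \<eta>) k)"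
        by (intro cheb_u_hyperbolic_bound[OF t4]) (use \<delta>0 in auto)
      then show "norm (cheb_u (t \<eta>) i) \<le> 10 / sqrt \<delta> * norm (cheb_t (t \<eta>) k)"
        by (simp add: real_sqrt_divide)
    next
      show "1 \<le> N" using ar(2) by simp
      show "32 * real N * real q * \<kappa> \<le> Im (Complex E \<eta>)" using kap by (simp add: Q_def)
    qed (use \<eta>0 \<eta>1 in auto)
    also have "256 / (real N * Im (Complex E \<eta>)) \<le> 256"
      using ar(1,2) \<eta>0 by (simp add: divide_le_eq mult.commute)
    also have "8 * (10 / sqrt \<delta>) * D ^ (2 * q) = 80 * exp ((3 * l + 2) * Q)"
      using ar(13) unfolding DL by simp
    finally show ?thesis by (simp add: \<eta>_def Q_def)
  qed
  show "measure (vector_measure P (delta j)) {E - 7 * sqrt \<delta>..E + 7 * sqrt \<delta>} \<le> 40000 * exp (- real q)"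
    if small: "norm (T\<^sup>2 - 4) \<le> \<delta>"
  proof -
    define s where "s = sqrt \<rho>"
    have s: "s > 0" "s\<^sup>2 = \<rho>" "s \<le> 1" using \<rho>0 ar(10) by (simp_all add: s_def)
    \<comment> \<open>The largest window for which \<open>(2 n)\<^sup>2\<close> times the bound \<open>9 \<rho> L\<^sup>2\<close> on \<open>t\<^sup>2 - 4\<close> is at most \<open>1 / 4\<close>.\<close>
    define n where "n = nat \<lfloor>1 / (12 * L * s)\<rfloor>"
    have Ls: "12 * L * s \<le> 1" "12 * L * s > 0" using ar(11) s L1 by (simp_all add: s_def)
    have x1: "1 / (12 * L * s) \<ge> 1" using Ls by (simp add: le_divide_eq)
    have n1: "real n \<le> 1 / (12 * L * s)" "n \<ge> 1" "real n \<ge> 1 / (24 * L * s)"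
    proof -
      have "0 \<le> 1 / (12 * L * s)" using x1 by linarith
      then show "real n \<le> 1 / (12 * L * s)" unfolding n_def by linarith
      show "n \<ge> 1" unfolding n_def using x1 by linarith
      have "real (nat \<lfloor>x\<rfloor>) \<ge> x / 2" if "x \<ge> 1" for x :: real
      proof -
        have "\<lfloor>x\<rfloor> \<ge> 1" using that by simp
        then have "real (nat \<lfloor>x\<rfloor>) = of_int \<lfloor>x\<rfloor>" "of_int \<lfloor>x\<rfloor> \<ge> (1::real)" by simp_all
        then show ?thesis using floor_correct[of x] by linarith
      qed
      then have "real n \<ge> 1 / (12 * L * s) / 2" unfolding n_def using x1 by blast
      then show "real n \<ge> 1 / (24 * L * s)" by simp
    qed
    have y: "0 \<le> \<rho>" "\<rho> \<le> 1" using \<rho>0 ar(10) by auto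
    have L2: "L\<^sup>2 \<ge> 1" using L1 by (simp add: one_le_power)
    have t4: "norm ((t \<rho>)\<^sup>2 - 4) \<le> 9 * \<rho> * L\<^sup>2"
    proof -
      have "norm ((t \<rho>)\<^sup>2 - 4) \<le> norm ((t \<rho>)\<^sup>2 - T\<^sup>2) + norm (T\<^sup>2 - 4)"
        using norm_triangle_ineq[of "(t \<rho>)\<^sup>2 - T\<^sup>2" "T\<^sup>2 - 4"] by simp
      also have "\<dots> \<le> 8 * \<rho> * L\<^sup>2 + \<rho>" using tT[OF y] small ar(9) by linarith
      finally have "norm ((t \<rho>)\<^sup>2 - 4) \<le> 8 * \<rho> * L\<^sup>2 + \<rho>" .
      moreover have "\<rho> * 1 \<le> \<rho> * L\<^sup>2" using L2 \<rho>0 by (intro mult_left_mono) auto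
      ultimately show ?thesis by linarith
    qed
    have n2: "real (2 * n) ^ 2 * (9 * \<rho> * L\<^sup>2) \<le> 1 / 4"
    proof -
      have "real (2 * n) ^ 2 \<le> (2 * (1 / (12 * L * s)))\<^sup>2" using n1(1) by (intro power_mono) auto
      then have "real (2 * n) ^ 2 * (9 * \<rho> * L\<^sup>2) \<le> (2 * (1 / (12 * L * s)))\<^sup>2 * (9 * \<rho> * L\<^sup>2)"
        using \<rho>0 by (intro mult_right_mono) auto
      also have "\<dots> = 1 / 4" unfolding s(2)[symmetric] using s(1) L1 by (simp add: power2_eq_square field_simps)
      finally show ?thesis .
    qed
    have nN: "n \<le> N"
    proof -
      have "\<rho> \<le> s" using s by (metis mult_left_le power2_eq_square less_imp_le)
      also have "s \<le> 12 * L * s" using L1 s(1) by simp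
      finally have "1 / (12 * L * s) \<le> 1 / \<rho>" using \<rho>0 Ls by (intro divide_left_mono) auto
      also have "\<dots> \<le> 1 / \<eta>" using ar(6) \<eta>0 by (intro divide_left_mono) auto
      finally show ?thesis using n1(1) ar(1) by linarith
    qed
    have "cmod (borel_transform (vector_measure P (delta j)) (Complex E \<rho>)) \<le>
       8 * (4 * real n) * D ^ (2 * q) + 256 / (real n * Im (Complex E \<rho>)) + 1"
    proof (rule borel_transform_bound_from_window[where W = W and z = "Complex E \<rho>" and t = "t \<rho>" and D = D and N = n and \<kappa> = \<kappa>,
          OF sr V per q(1) _ _ _ dist1[OF y] _ _ _ _ j])
      show "t \<rho> = discriminant W q (Complex E \<rho>)" by (simp add: t_def)
      fix k i assume k: "k \<le> 2 * n" "norm (cheb_t (t \<rho>) k) \<ge> 1" "i \<le> k"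
      then have "norm (cheb_u (t \<rho>) i) \<le> 2 * real i"
        by (intro cheb_u_parabolic_bound[OF t4 n2]) auto
      also have "\<dots> \<le> (4 * real n) * 1" using k by simp
      also have "\<dots> \<le> 4 * real n * norm (cheb_t (t \<rho>) k)" using k(2) by (intro mult_left_mono) auto
      finally show "norm (cheb_u (t \<rho>) i) \<le> 4 * real n * norm (cheb_t (t \<rho>) k)" .
    next
      show "1 \<le> n" by (rule n1)
      have "32 * real n * real q * \<kappa> \<le> 32 * real N * Q * \<kappa>"
        using nN kap0 by (intro mult_right_mono mult_mono) (auto simp: Q_def)
      then show "32 * real n * real q * \<kappa> \<le> Im (Complex E \<rho>)" using kap ar(6) by simp
      fix m assume "\<bar>m\<bar> \<le> int (2 * n * q) + 1"
      moreover have "int (2 * n * q) \<le> int (2 * N * q)" using nN by (simp only: of_nat_le_iff mult_le_mono1 mult_le_mono2)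
      ultimately show "\<bar>V m - W m\<bar> \<le> \<kappa>" by (intro close) linarith
    qed (use \<rho>0 ar(10) in auto)
    also have "8 * (4 * real n) * D ^ (2 * q) \<le> 8 * (4 * (1 / (12 * L * s))) * L"
      unfolding DL using n1(1) L1 by (intro mult_right_mono mult_left_mono) auto
    also have "\<dots> = (8 / 3) / s" using L1 s(1) by simp
    also have "256 / (real n * Im (Complex E \<rho>)) \<le> 256 / (1 / (24 * L * s) * s\<^sup>2)"
    proof -
      have m: "1 / (24 * L * s) * s\<^sup>2 \<le> real n * s\<^sup>2" by (intro mult_right_mono n1(3)) auto
      have "256 / (real n * s\<^sup>2) \<le> 256 / (1 / (24 * L * s) * s\<^sup>2)"
        by (rule divide_left_mono[OF m]) (use n1(2) s L1 in auto)
      then show ?thesis using s(2) by simp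
    qed
    also have "\<dots> = 6144 * L / s" using L1 s(1) by (simp add: power2_eq_square field_simps)
    also have "1 \<le> 1 / s" using s by (simp add: le_divide_eq)
    finally have F: "cmod (borel_transform (vector_measure P (delta j)) (Complex E \<rho>)) \<le> (8 / 3) / s + 6144 * L / s + 1 / s" by simp
    also have "\<dots> = (8 / 3 + 6144 * L + 1) / s" by (simp add: add_divide_distrib)
    also have "\<dots> \<le> 6148 * L / s" using L1 s(1) by (intro divide_right_mono) auto
    finally have F: "cmod (borel_transform (vector_measure P (delta j)) (Complex E \<rho>)) \<le> 6148 * L / s" .
    have "measure (vector_measure P (delta j)) {E - \<rho>..E + \<rho>} \<le> 2 * \<rho> * cmod (borel_transform (vector_measure P (delta j)) (Complex E \<rho>))"
      by (rule measure_ball_le_borel_transform[OF finite_measure_vector_measure[OF resolution_pvm[OF sr] delta_ell2] sets_vector_measure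
            resolution_support[OF sr V _ delta_ell2] \<rho>0, of "3 + v"]) simp
    also have "\<dots> \<le> 2 * \<rho> * (6148 * L / s)" using F \<rho>0 by (intro mult_left_mono) auto
    also have "\<dots> = 12296 * (L * s)" unfolding s(2)[symmetric] using s(1) by (simp add: power2_eq_square)
    also have "\<dots> \<le> 12296 * (3 * exp (- Q))" using ar(12) by (simp add: s_def)
    also have "\<dots> \<le> 40000 * exp (- Q)" by simp
    finally show ?thesis unfolding ar(7) by (simp add: Q_def)
  qed
qed

lemma energies_borel:
  "{E. \<bar>E\<bar> \<le> a \<and> norm ((discriminant W q (of_real E))\<^sup>2 - 4) \<le> d} \<in> sets borel"
proof -
  have f: "continuous_on UNIV (\<lambda>E :: real. three_term (\<lambda>k. complex_of_real E - of_real (w k)) 0 1 k)" for w k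
    by (induction k rule: induct_nat_012) (auto intro!: continuous_intros)
  have "closed {E. \<bar>E\<bar> \<le> a \<and> norm ((discriminant W q (of_real E))\<^sup>2 - 4) \<le> d}"
    unfolding discriminant_def fundamental_def
    by (intro closed_Collect_conj closed_Collect_le continuous_intros f)
  then show ?thesis by (rule borel_closed)
qed

text \<open>The exceptional energies of one scale have exponentially small spectral mass: at most
  \<open>2 (q + 1)\<close> intervals of width comparable to \<open>\<rho>\<close>, each of mass of order \<open>exp (- q)\<close>.\<close>

lemma near_edge_energies:
  fixes V :: "int \<Rightarrow> real" and q :: nat
  assumes sr: "spectral_resolution (schrodinger V) P" and V: "\<And>n. \<bar>V n\<bar> \<le> v" and v: "v \<ge> 0"
    and l: "l = 2 * ln (2 * v + 6)"
    and c: "0 < c" "2 * c \<le> \<epsilon>" "4 * c \<le> 1" and b: "c * \<beta> \<ge> 6 * l + 5"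
    and q: "q > 0" "384 * real q \<le> exp (real q)"
    and np: "nearly_periodic V q (exp (\<epsilon> * \<beta> * real q) / real q) (exp (- \<beta> * real q))"
    and j: "j \<in> {0, 1}"
  defines "B \<equiv> {E. \<bar>E\<bar> \<le> 3 + v \<and>
      norm ((discriminant (periodic_copy V q) q (of_real E))\<^sup>2 - 4) \<le> exp (- ((4 * l + 4) * real q))}"
  shows "measure (vector_measure P (delta j)) B \<le> 80000 * ((real q + 1) * exp (- real q))"
proof -
  define \<delta> where "\<delta> = exp (- ((4 * l + 4) * real q))"
  have l0: "l \<ge> 0" using v by (simp add: l)
  have Q1: "real q \<ge> 1" using q by simp
  have \<delta>4: "\<delta> \<le> 1 / 4" using scale_arithmetic(8)[OF l0 c b Q1 q(2)] by (simp add: \<delta>_def)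
  obtain r where r: "\<And>z. discriminant (periodic_copy V q) q z = (\<Prod>i<q. z - of_real (r i))"
    using discriminant_factorization[where W = "periodic_copy V q", OF periodic_copy_periodic q(1)] by blast
  have "discriminant (periodic_copy V q) q (of_real E) = of_real (real_rooted r q E)" for E
    unfolding r real_rooted_def by simp
  then have n: "norm ((discriminant (periodic_copy V q) q (of_real E))\<^sup>2 - 4) = \<bar>(real_rooted r q E)\<^sup>2 - 4\<bar>" for E
    using norm_of_real[of "(real_rooted r q E)\<^sup>2 - 4", where 'a = complex] by simp
  have B: "B = {E \<in> space borel. \<bar>E\<bar> \<le> 3 + v \<and> \<bar>(real_rooted r q E)\<^sup>2 - 4\<bar> \<le> \<delta>}"
    unfolding B_def n \<delta>_def by simp
  have Bm: "B \<in> sets borel" unfolding B_def by (rule energies_borel)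
  have "measure (vector_measure P (delta j)) B \<le> 2 * (real q + 1) * (40000 * exp (- real q))"
  proof (rule near_edge_measure_le[OF finite_measure_vector_measure[OF resolution_pvm[OF sr] delta_ell2] sets_vector_measure q(1) \<delta>4 Bm])
    fix E assume E: "E \<in> B"
    then show "near_edge r q \<delta> E" by (simp add: B near_edge_def)
    show "measure (vector_measure P (delta j)) {E - 7 * sqrt \<delta>..E + 7 * sqrt \<delta>} \<le> 40000 * exp (- real q)"
      unfolding \<delta>_def
      by (rule estimates_at_one_period(2)[OF sr V v l c b q np _ j]) (use E in \<open>auto simp: B_def\<close>)
  qed simp
  then show ?thesis by (simp add: algebra_simps)
qed

text \<open>An energy outside the exceptional sets of infinitely many scales has, at these scales \<open>\<eta>\<close>,
  a Borel transform of order at most \<open>exp ((3 l + 2) q)\<close>, and the choice of \<open>C\<close> makes \<open>\<eta>\<^sup>1\<^sup>-\<^sup>\<gamma>\<close> smaller than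
  the inverse of that. The energies lying in all but finitely many exceptional sets form a null set,
  because already the mass of a single exceptional set tends to \<open>0\<close> along the scales.\<close>

theorem theorem1:
  fixes V :: "int \<Rightarrow> real"
  assumes "bounded (range V)"
  shows "\<forall>\<epsilon>>0. \<exists>C>0. \<forall>\<beta>>0. almost_periodic \<beta> \<epsilon> V \<longrightarrow>
           (\<forall>P. spectral_resolution (schrodinger V) P \<longrightarrow>
             (\<forall>\<gamma>. 0 < \<gamma> \<longrightarrow> \<gamma> < 1 \<longrightarrow> \<gamma> < 1 - C / \<beta> \<longrightarrow>
               spectral_continuous \<gamma> (spectral_measure P)))"
proof (intro allI impI)
  obtain v where v': "\<And>n. \<bar>V n\<bar> \<le> v" using assms by (auto simp: bounded_iff)
  have v0: "v \<ge> 0" using v'[of 0] by simp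
  fix \<epsilon> :: real assume \<epsilon>: "\<epsilon> > 0"
  define l where "l = 2 * ln (2 * v + 6)"
  define c where "c = min (\<epsilon> / 2) (1 / 4)"
  have l0: "l \<ge> 0" using v0 by (simp add: l_def)
  have c: "0 < c" "2 * c \<le> \<epsilon>" "4 * c \<le> 1" using \<epsilon> by (auto simp: c_def)
  define C where "C = (6 * l + 5) / c"
  have C0: "C > 0" using c l0 by (simp add: C_def)
  show "\<exists>C>0. \<forall>\<beta>>0. almost_periodic \<beta> \<epsilon> V \<longrightarrow>
           (\<forall>P. spectral_resolution (schrodinger V) P \<longrightarrow>
             (\<forall>\<gamma>. 0 < \<gamma> \<longrightarrow> \<gamma> < 1 \<longrightarrow> \<gamma> < 1 - C / \<beta> \<longrightarrow>
               spectral_continuous \<gamma> (spectral_measure P)))"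
  proof (intro exI[of _ C] conjI C0 allI impI)
    fix \<beta> P \<gamma>
    assume \<beta>: "0 < \<beta>" and ap: "almost_periodic \<beta> \<epsilon> V" and sr: "spectral_resolution (schrodinger V) P"
      and \<gamma>: "0 < \<gamma>" "\<gamma> < 1" "\<gamma> < 1 - C / \<beta>"
    have "C < \<beta> * (1 - \<gamma>)" using \<gamma>(3) \<beta> by (simp add: field_simps)
    then have cb': "6 * l + 5 \<le> c * \<beta> * (1 - \<gamma>)" using c by (simp add: C_def field_simps)
    have "c * \<beta> * (1 - \<gamma>) \<le> c * \<beta> * 1" using c \<beta> \<gamma> by (intro mult_left_mono) auto
    then have cb: "6 * l + 5 \<le> c * \<beta>" using cb' by simp
    have cb0: "c * \<beta> > 0" using c \<beta> by simp
    obtain q :: "nat \<Rightarrow> nat" where q: "\<And>n. 0 < q n" "filterlim q at_top sequentially"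
      and np: "\<And>n. nearly_periodic V (q n) (exp (\<epsilon> * \<beta> * real (q n)) / real (q n)) (exp (- \<beta> * real (q n)))"
      using ap unfolding almost_periodic_def nearly_periodic_def by blast
    define good where "good n \<longleftrightarrow> 384 * real (q n) \<le> exp (real (q n))" for n
    have "eventually (\<lambda>m::nat. 384 * real m \<le> exp (real m)) at_top" by real_asymp
    then have good: "eventually good sequentially"
      unfolding good_def by (rule eventually_compose_filterlim[OF _ q(2)])
    define B where "B n = {E. \<bar>E\<bar> \<le> 3 + v \<and>
      norm ((discriminant (periodic_copy V (q n)) (q n) (of_real E))\<^sup>2 - 4) \<le> exp (- ((4 * l + 4) * real (q n)))}" for n
    have Bm: "B n \<in> sets borel" for n unfolding B_def by (rule energies_borel)
    define Z where "Z = (\<Union>m. \<Inter>n\<in>{m..}. B n)"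
    have Zm: "(\<Inter>n\<in>{m..}. B n) \<in> sets borel" for m using Bm by (intro sets.countable_INT'') auto
    have null: "Z \<in> null_sets (vector_measure P (delta j))" if j: "j \<in> {0, 1}" for j
      unfolding Z_def
    proof (rule null_sets_UN)
      fix m
      let ?M = "vector_measure P (delta j)"
      interpret finite_measure ?M by (rule finite_measure_vector_measure[OF resolution_pvm[OF sr] delta_ell2])
      have "(\<lambda>k::nat. 80000 * ((real k + 1) * exp (- real k))) \<longlonglongrightarrow> 0" by real_asymp
      then have lim: "(\<lambda>n. 80000 * ((real (q n) + 1) * exp (- real (q n)))) \<longlonglongrightarrow> 0"
        by (rule filterlim_compose[OF _ q(2)])
      have "measure ?M (\<Inter>n\<in>{m..}. B n) \<le> 0"
      proof (rule tendsto_lowerbound[OF lim])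
        show "\<forall>\<^sub>F n in sequentially. measure ?M (\<Inter>n\<in>{m..}. B n) \<le> 80000 * ((real (q n) + 1) * exp (- real (q n)))"
          using good eventually_ge_at_top[of m]
        proof eventually_elim
          case (elim n)
          have "measure ?M (\<Inter>n\<in>{m..}. B n) \<le> measure ?M (B n)"
            by (rule finite_measure_mono) (use elim Bm in auto)
          also have "\<dots> \<le> 80000 * ((real (q n) + 1) * exp (- real (q n)))"
            unfolding B_def
            by (rule near_edge_energies[OF sr v' v0 l_def c cb q(1) _ np j]) (use elim in \<open>simp add: good_def\<close>)
          finally show ?case .
        qed
      qed simp
      then have "measure ?M (\<Inter>n\<in>{m..}. B n) = 0" using measure_nonneg[of ?M] by (meson antisym)
      then show "(\<Inter>n\<in>{m..}. B n) \<in> null_sets ?M"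
        using Zm[of m] by (simp add: null_sets_def emeasure_eq_measure)
    qed
    have Znull: "Z \<in> null_sets (spectral_measure P)"
      using null[of 0] null[of 1] by (auto simp: null_sets_def emeasure_spectral_measure)
    define \<eta> where "\<eta> n = exp (- (c * \<beta> * real (q n)))" for n
    have "filterlim (\<lambda>k::nat. exp (- (a * real k))) (at_right 0) sequentially" if "a > 0" for a :: real
      using that by real_asymp
    from this[OF cb0] have \<eta>lim: "filterlim \<eta> (at_right 0) sequentially"
      unfolding \<eta>_def by (rule filterlim_compose[OF _ q(2)])
    let ?f = "\<lambda>E e. e powr (1 - \<gamma>) * cmod (borel_transform (spectral_measure P) (Complex E e))"
    have bound: "?f E (\<eta> n) \<le> 674" if E: "\<bar>E\<bar> \<le> 3 + v" and n: "good n" "E \<notin> B n" for E n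
    proof -
      let ?Q = "real (q n)"
      have F: "cmod (borel_transform (vector_measure P (delta j)) (Complex E (\<eta> n))) \<le> 80 * exp ((3 * l + 2) * ?Q) + 257"
        if j: "j \<in> {0, 1}" for j
        unfolding \<eta>_def
        by (rule estimates_at_one_period(1)[OF sr v' v0 l_def c cb q(1) _ np E j])
           (use n E in \<open>auto simp: good_def B_def\<close>)
      have "borel_transform (spectral_measure P) (Complex E (\<eta> n)) =
         borel_transform (vector_measure P (delta 0)) (Complex E (\<eta> n)) + borel_transform (vector_measure P (delta 1)) (Complex E (\<eta> n))"
        by (rule borel_transform_spectral_measure[OF sr v']) (simp add: \<eta>_def)
      then have "cmod (borel_transform (spectral_measure P) (Complex E (\<eta> n))) \<le>
         (80 * exp ((3 * l + 2) * ?Q) + 257) + (80 * exp ((3 * l + 2) * ?Q) + 257)"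
        using F[of 0] F[of 1] norm_triangle_ineq[of "borel_transform (vector_measure P (delta 0)) (Complex E (\<eta> n))" "borel_transform (vector_measure P (delta 1)) (Complex E (\<eta> n))"]
        by simp
      also have "\<dots> \<le> 674 * exp ((3 * l + 2) * ?Q)"
      proof -
        have "exp ((3 * l + 2) * ?Q) \<ge> 1" using l0 by simp
        then show ?thesis by linarith
      qed
      finally have "?f E (\<eta> n) \<le> exp (- (c * \<beta> * ?Q)) powr (1 - \<gamma>) * (674 * exp ((3 * l + 2) * ?Q))"
        unfolding \<eta>_def by (intro mult_left_mono) auto
      also have "\<dots> = 674 * exp ((3 * l + 2) * ?Q - (c * \<beta> * (1 - \<gamma>)) * ?Q)"
      proof -
        have "exp (- (c * \<beta> * ?Q)) powr (1 - \<gamma>) = exp (- ((c * \<beta> * (1 - \<gamma>)) * ?Q))"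
          by (simp add: exp_powr_real algebra_simps)
        then show ?thesis by (simp add: exp_add[symmetric])
      qed
      also have "\<dots> \<le> 674 * 1"
      proof -
        have "(3 * l + 2) * ?Q \<le> (c * \<beta> * (1 - \<gamma>)) * ?Q"
          using cb' l0 by (intro mult_right_mono) auto
        then show ?thesis by simp
      qed
      finally show ?thesis by simp
    qed
    have pointwise: "Liminf (at_right 0) (\<lambda>e. ereal (?f E e)) < \<infinity>" if E: "\<bar>E\<bar> \<le> 3 + v" "E \<notin> Z" for E
    proof (rule ccontr)
      assume "\<not> ?thesis"
      then have "Liminf (at_right 0) (\<lambda>e. ereal (?f E e)) = \<infinity>" by simp
      then have "ereal 674 < Liminf (at_right 0) (\<lambda>e. ereal (?f E e))" by simp
      then have "eventually (\<lambda>e. ereal 674 < ereal (?f E e)) (at_right 0)" by (rule less_LiminfD)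
      then have "eventually (\<lambda>n. 674 < ?f E (\<eta> n)) sequentially"
        using eventually_compose_filterlim[OF _ \<eta>lim] by simp
      with good have "eventually (\<lambda>n. good n \<and> 674 < ?f E (\<eta> n)) sequentially" by eventually_elim simp
      then obtain m where m: "\<And>n. n \<ge> m \<Longrightarrow> good n \<and> 674 < ?f E (\<eta> n)" by (auto simp: eventually_sequentially)
      obtain n where "n \<ge> m" "E \<notin> B n" using E(2) unfolding Z_def by auto
      then show False using m[of n] bound[OF E(1), of n] by simp
    qed
    have "AE E in spectral_measure P. E \<notin> Z" by (rule AE_not_in[OF Znull])
    moreover have "AE E in spectral_measure P. \<bar>E\<bar> \<le> 3 + v"
      by (rule spectral_measure_properties(2)[OF sr v']) simp
    ultimately show "spectral_continuous \<gamma> (spectral_measure P)"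
      unfolding spectral_continuous_def
    proof eventually_elim
      case (elim E)
      then show ?case using pointwise by simp
    qed
  qed
qed

end
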